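(* Assume (H$_1$)–(H$_3$) (listed in the context). Let $\overline W$ be a constant equilibrium state (with $\overline\eta=\overline\theta^4$), let $\widetilde A^0,\widetilde A^1,\widetilde L,\widetilde B$ be the constant matrices and $e^{t\Phi}$ the solution operator defined in the context, and let $\mathcal M\subset\mathbb{R}^4$ be the null space of $\widetilde L$. Let $s\ge0$ and let $h\in(H^s(\mathbb{R})\cap L^1(\mathbb{R}))^4$ take values in $\mathcal M^\perp$. Then for all integers $0\le\ell\le s$ and all $t\ge0$, $$\|\partial_x^\ell e^{t\Phi}(\widetilde A^0)^{-1}h\|_0\le Ce^{-c_1t}\|\partial_x^\ell h\|_0+C(1+t)^{-(\ell/2+3/4)}\|h\|_{L^1},$$ for some positive constants $C,c_1$ independent of $t$ and $h$.
   Context: $\|\cdot\|_0$ is the $L^2(\mathbb{R})$ norm. The operator $e^{t\Phi}$ is $$(e^{t\Phi}h)(x)=\frac1{(2\pi)^{1/2}}\int_{\mathbb{R}}e^{t\Phi(i\xi)}\hat h(\xi)e^{i\xi x}\,d\xi,\qquad \Phi(i\xi)=-(\widetilde A^0)^{-1}\big(\widetilde L+i\xi\widetilde A^1-(i\xi)^2\widetilde B\big),$$ $\hat h$ being the Fourier transform; it gives the solution of $\widetilde A^0Z_t+\widetilde A^1Z_x+\widetilde LZ=\widetilde BZ_{xx}$ with $Z(0)=h$. Variables: $V=(\rho,u,\theta,\eta)$ with $\rho,\theta,\eta>0$, $u\in\mathbb{R}$, and $W=(\rho,m,\mathcal E,\eta)$ with $m=\rho u$, $\mathcal E=\rho(e(\rho,\theta)+u^2/2)$.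 Since $e_\theta>0$, $V\mapsto W$ is a diffeomorphism of $\{\rho>0,u\in\mathbb{R},\theta>0,\eta>0\}$ onto its image $\mathcal O_W\subset\mathbb{R}^4$; $u,\theta,p,e,s$ are regarded as functions of $W$ through its inverse. Put $$f^1(W)=\begin{pmatrix}\rho u\\ \rho u^2+p+\tfrac13\eta\\ \mathcal Eu+(p+\tfrac13\eta)u\\ \eta u\end{pmatrix},\quad Q(W)=\begin{pmatrix}0\\0\\ \sigma_a(\eta-\theta^4)\\-\sigma_a(\eta-\theta^4)\end{pmatrix},$$ $$C(W)=\begin{pmatrix}0&0&0&0\\0&0&0&0\\-\frac{u\eta}{3\rho}&\frac{\eta}{3\rho}&0&0\\ \frac{u\eta}{3\rho}&-\frac{\eta}{3\rho}&0&0\end{pmatrix},\quad \overline G=\mathrm{diag}\big(0,0,0,\tfrac1{3\sigma_s}\big),\quad \mathcal S(W)=-\rho s-\tfrac43\eta^{3/4}.$$ The Hessian $D_W^2\mathcal S$ is positive definite. Define $\widetilde A^0=D_W^2\mathcal S(\overline W)^{-1}$, $\widetilde A^1=(D_Wf^1(\overline W)-C(\overline W))D_W^2\mathcal S(\overline W)^{-1}$, $\widetilde L=-D_WQ(\overline W)D_W^2\mathcal S(\overline W)^{-1}$, $\widetilde B=\overline G\,D_W^2\mathcal S(\overline W)^{-1}$. Explicitly $\widetilde B=\mathrm{diag}(0,0,0,4\overline\eta^{5/4}/(3\sigma_s))$ and $\widetilde L$ vanishes except for its lower-right block $4\sigma_a\overline\theta^5\begin{pmatrix}1&-1\\-1&1\end{pmatrix}$,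 so $\mathcal M=\mathrm{span}\{(1,0,0,0),(0,1,0,0),(0,0,1,1)\}$. Assumptions: (H$_1$) the independent thermodynamic variables $(\rho,\theta)$ take values in $\mathcal D=\{\rho>0,\theta>0\}$. (H$_2$) the pressure $p$, internal energy $e$ and specific entropy $s$ of the fluid are $C^\infty$ functions on $\mathcal D$ with $p>0$, $p_\rho>0$, $p_\theta>0$, $e_\theta>0$, satisfying $de=\theta\,ds-p\,d(1/\rho)$, i.e. $e_\rho=(p-\theta p_\theta)/\rho^2$, $s_\rho=-p_\theta/\rho^2$, $s_\theta=e_\theta/\theta$. (H$_3$) $\sigma_a,\sigma_s$ are positive constants. (The letter $s$ in Sobolev indices is unrelated to the entropy $s$.) *)

theory Defs
  imports "HOL-Analysis.Analysis"
begin

section \<open>Smooth functions and differential operators\<close>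

fun Ck_on :: "nat \<Rightarrow> ('a::real_normed_vector \<Rightarrow> 'b::real_normed_vector) \<Rightarrow> 'a set \<Rightarrow> bool" where
  "Ck_on 0 f U \<longleftrightarrow> continuous_on U f"
| "Ck_on (Suc k) f U \<longleftrightarrow>
     (\<forall>x\<in>U. f differentiable (at x)) \<and> (\<forall>v. Ck_on k (\<lambda>x. frechet_derivative f (at x) v) U)"

definition smooth_on :: "('a::real_normed_vector \<Rightarrow> 'b::real_normed_vector) \<Rightarrow> 'a set \<Rightarrow> bool" where
  "smooth_on f U \<longleftrightarrow> (\<forall>k. Ck_on k f U)"

definition jacobian :: "(real^'n \<Rightarrow> real^'m) \<Rightarrow> real^'n \<Rightarrow> real^'n^'m" where
  "jacobian F W = matrix (frechet_derivative F (at W))"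

definition gradient :: "(real^'n \<Rightarrow> real) \<Rightarrow> real^'n \<Rightarrow> real^'n" where
  "gradient F W = (\<chi> i. frechet_derivative F (at W) (axis i 1))"

definition hessian :: "(real^'n \<Rightarrow> real) \<Rightarrow> real^'n \<Rightarrow> real^'n^'n" where
  "hessian F W = jacobian (gradient F) W"

section \<open>The fluid and the radiation hydrodynamics system\<close>

definition d_rho :: "(real \<times> real \<Rightarrow> real) \<Rightarrow> real \<Rightarrow> real \<Rightarrow> real" where
  "d_rho f \<rho> \<theta> = deriv (\<lambda>r. f (r, \<theta>)) \<rho>"

definition d_theta :: "(real \<times> real \<Rightarrow> real) \<Rightarrow> real \<Rightarrow> real \<Rightarrow> real" where
  "d_theta f \<rho> \<theta> = deriv (\<lambda>t. f (\<rho>, t)) \<theta>"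

definition thermo_domain :: "(real \<times> real) set" where
  "thermo_domain = {(\<rho>, \<theta>). \<rho> > 0 \<and> \<theta> > 0}"

text \<open>The last three equations are the Gibbs relation \<open>de = \<theta> ds - p d(1/\<rho>)\<close> in coordinates.\<close>

definition thermodynamic_laws ::
  "(real \<times> real \<Rightarrow> real) \<Rightarrow> (real \<times> real \<Rightarrow> real) \<Rightarrow> (real \<times> real \<Rightarrow> real) \<Rightarrow> bool" where
  "thermodynamic_laws p e s \<longleftrightarrow>
     smooth_on p thermo_domain \<and> smooth_on e thermo_domain \<and> smooth_on s thermo_domain \<and>
     (\<forall>(\<rho>, \<theta>) \<in> thermo_domain.
        p (\<rho>, \<theta>) > 0 \<and> d_rho p \<rho> \<theta> > 0 \<and> d_theta p \<rho> \<theta> > 0 \<and> d_theta e \<rho> \<theta> > 0 \<and>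
        d_rho e \<rho> \<theta> = (p (\<rho>, \<theta>) - \<theta> * d_theta p \<rho> \<theta>) / \<rho>\<^sup>2 \<and>
        d_rho s \<rho> \<theta> = - d_theta p \<rho> \<theta> / \<rho>\<^sup>2 \<and>
        d_theta s \<rho> \<theta> = d_theta e \<rho> \<theta> / \<theta>)"

text \<open>
  \<open>V = (\<rho>, u, \<theta>, \<eta>)\<close> are the primitive and \<open>W = (\<rho>, m, E, \<eta>)\<close> the conserved variables. In the
  index type \<open>4\<close>, the index \<open>4\<close> denotes the last component of \<open>vector [_, _, _, _]\<close>.
\<close>

definition V_domain :: "(real^4) set" where
  "V_domain = {V. V$1 > 0 \<and> V$3 > 0 \<and> V$4 > 0}"

definition conserved :: "(real \<times> real \<Rightarrow> real) \<Rightarrow> real^4 \<Rightarrow> real^4" where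
  "conserved e V = vector [V$1, V$1 * V$2, V$1 * (e (V$1, V$3) + (V$2)\<^sup>2 / 2), V$4]"

definition W_domain :: "(real \<times> real \<Rightarrow> real) \<Rightarrow> (real^4) set" where
  "W_domain e = conserved e ` V_domain"

definition primitive :: "(real \<times> real \<Rightarrow> real) \<Rightarrow> real^4 \<Rightarrow> real^4" where
  "primitive e = inv_into V_domain (conserved e)"

definition velocity :: "(real \<times> real \<Rightarrow> real) \<Rightarrow> real^4 \<Rightarrow> real" where
  "velocity e W = primitive e W $ 2"

definition temperature :: "(real \<times> real \<Rightarrow> real) \<Rightarrow> real^4 \<Rightarrow> real" where
  "temperature e W = primitive e W $ 3"

definition flux :: "(real \<times> real \<Rightarrow> real) \<Rightarrow> (real \<times> real \<Rightarrow> real) \<Rightarrow> real^4 \<Rightarrow> real^4" where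
  "flux p e W =
     (let \<rho> = W$1; \<E> = W$3; \<eta> = W$4; u = velocity e W; P = p (\<rho>, temperature e W) in
      vector [\<rho> * u, \<rho> * u\<^sup>2 + P + \<eta> / 3, \<E> * u + (P + \<eta> / 3) * u, \<eta> * u])"

definition source :: "(real \<times> real \<Rightarrow> real) \<Rightarrow> real \<Rightarrow> real^4 \<Rightarrow> real^4" where
  "source e \<sigma>a W =
     vector [0, 0, \<sigma>a * (W$4 - temperature e W ^ 4), - \<sigma>a * (W$4 - temperature e W ^ 4)]"

definition nonconservative :: "(real \<times> real \<Rightarrow> real) \<Rightarrow> real^4 \<Rightarrow> real^4^4" where
  "nonconservative e W =
     (let \<rho> = W$1; \<eta> = W$4; u = velocity e W in
      vector [0,
              0,
              vector [- (u * \<eta> / (3 * \<rho>)), \<eta> / (3 * \<rho>), 0, 0],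
              vector [u * \<eta> / (3 * \<rho>), - (\<eta> / (3 * \<rho>)), 0, 0]])"

definition diffusion :: "real \<Rightarrow> real^4^4" where
  "diffusion \<sigma>s = vector [0, 0, 0, vector [0, 0, 0, 1 / (3 * \<sigma>s)]]"

definition entropy :: "(real \<times> real \<Rightarrow> real) \<Rightarrow> (real \<times> real \<Rightarrow> real) \<Rightarrow> real^4 \<Rightarrow> real" where
  "entropy e s W = - (W$1 * s (W$1, temperature e W)) - 4/3 * (W$4) powr (3/4)"

definition A0 :: "(real \<times> real \<Rightarrow> real) \<Rightarrow> (real \<times> real \<Rightarrow> real) \<Rightarrow> real^4 \<Rightarrow> real^4^4" where
  "A0 e s W = matrix_inv (hessian (entropy e s) W)"

definition A1 ::
  "(real \<times> real \<Rightarrow> real) \<Rightarrow> (real \<times> real \<Rightarrow> real) \<Rightarrow> (real \<times> real \<Rightarrow> real) \<Rightarrow> real^4 \<Rightarrow> real^4^4" where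
  "A1 p e s W =
     (jacobian (flux p e) W - nonconservative e W) ** matrix_inv (hessian (entropy e s) W)"

definition Lmat ::
  "(real \<times> real \<Rightarrow> real) \<Rightarrow> (real \<times> real \<Rightarrow> real) \<Rightarrow> real \<Rightarrow> real^4 \<Rightarrow> real^4^4" where
  "Lmat e s \<sigma>a W = - (jacobian (source e \<sigma>a) W ** matrix_inv (hessian (entropy e s) W))"

definition Bmat ::
  "(real \<times> real \<Rightarrow> real) \<Rightarrow> (real \<times> real \<Rightarrow> real) \<Rightarrow> real \<Rightarrow> real^4 \<Rightarrow> real^4^4" where
  "Bmat e s \<sigma>s W = diffusion \<sigma>s ** matrix_inv (hessian (entropy e s) W)"

definition null_space :: "real^'n^'m \<Rightarrow> (real^'n) set" where
  "null_space A = {v. A *v v = 0}"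

section \<open>Function spaces on the line\<close>

text \<open>
  Elements of \<open>L\<^sup>p\<close> are represented by Borel functions; every class of Lebesgue measurable functions
  modulo null sets has such a representative.
\<close>

definition square_integrable :: "(real \<Rightarrow> 'a::euclidean_space) \<Rightarrow> bool" where
  "square_integrable f \<longleftrightarrow> f \<in> borel_measurable lborel \<and> integrable lborel (\<lambda>x. (norm (f x))\<^sup>2)"

definition L2_norm :: "(real \<Rightarrow> 'a::euclidean_space) \<Rightarrow> real" where
  "L2_norm f = sqrt (\<integral>x. (norm (f x))\<^sup>2 \<partial>lborel)"

definition L1_norm :: "(real \<Rightarrow> 'a::euclidean_space) \<Rightarrow> real" where
  "L1_norm f = (\<integral>x. norm (f x) \<partial>lborel)"

text \<open>
  For square integrable functions the Fourier integrals need not converge absolutely. They are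
  understood in Plancherel's sense, as limits in \<open>L\<^sup>2\<close> of the integrals over \<open>[-R, R]\<close>.
  The limit is taken with the extended nonnegative integral, so that it does not
  hold accidentally when the difference fails to be square integrable.
\<close>

definition is_L2_limit :: "(real \<Rightarrow> real \<Rightarrow> 'a::euclidean_space) \<Rightarrow> (real \<Rightarrow> 'a) \<Rightarrow> bool" where
  "is_L2_limit F g \<longleftrightarrow> square_integrable g \<and>
     ((\<lambda>R. \<integral>\<^sup>+x. ennreal ((norm (F R x - g x))\<^sup>2) \<partial>lborel) \<longlongrightarrow> 0) at_top"

definition L2_limit :: "(real \<Rightarrow> real \<Rightarrow> 'a::euclidean_space) \<Rightarrow> real \<Rightarrow> 'a" where
  "L2_limit F = (SOME g. is_L2_limit F g)"

definition fourier :: "(real \<Rightarrow> complex^'n) \<Rightarrow> real \<Rightarrow> complex^'n" where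
  "fourier f = L2_limit (\<lambda>R \<xi>. (1 / sqrt (2 * pi)) *\<^sub>R
     (LINT x:{-R..R}|lborel. exp (- \<i> * complex_of_real (\<xi> * x)) *s f x))"

definition inverse_fourier :: "(real \<Rightarrow> complex^'n) \<Rightarrow> real \<Rightarrow> complex^'n" where
  "inverse_fourier k = L2_limit (\<lambda>R x. (1 / sqrt (2 * pi)) *\<^sub>R
     (LINT \<xi>:{-R..R}|lborel. exp (\<i> * complex_of_real (\<xi> * x)) *s k \<xi>))"

definition sobolev :: "real \<Rightarrow> (real \<Rightarrow> complex^'n) \<Rightarrow> bool" where
  "sobolev r f \<longleftrightarrow> square_integrable f \<and>
     integrable lborel (\<lambda>\<xi>. (1 + \<xi>\<^sup>2) powr r * (norm (fourier f \<xi>))\<^sup>2)"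

definition test_function :: "(real \<Rightarrow> real) \<Rightarrow> bool" where
  "test_function \<phi> \<longleftrightarrow> smooth_on \<phi> UNIV \<and> (\<exists>K. compact K \<and> (\<forall>x. x \<notin> K \<longrightarrow> \<phi> x = 0))"

definition locally_integrable :: "(real \<Rightarrow> 'a::euclidean_space) \<Rightarrow> bool" where
  "locally_integrable f \<longleftrightarrow>
     f \<in> borel_measurable lborel \<and> (\<forall>K. compact K \<longrightarrow> set_integrable lborel K f)"

definition has_weak_derivative ::
  "nat \<Rightarrow> (real \<Rightarrow> 'a::euclidean_space) \<Rightarrow> (real \<Rightarrow> 'a) \<Rightarrow> bool" where
  "has_weak_derivative l f g \<longleftrightarrow> locally_integrable f \<and> locally_integrable g \<and>
     (\<forall>\<phi>. test_function \<phi> \<longrightarrow>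
        (\<integral>x. (deriv ^^ l) \<phi> x *\<^sub>R f x \<partial>lborel) = (-1) ^ l *\<^sub>R (\<integral>x. \<phi> x *\<^sub>R g x \<partial>lborel))"

definition weak_derivative :: "nat \<Rightarrow> (real \<Rightarrow> 'a::euclidean_space) \<Rightarrow> real \<Rightarrow> 'a" where
  "weak_derivative l f = (SOME g. has_weak_derivative l f g)"

section \<open>The solution operator\<close>

definition complex_vec :: "real^'n \<Rightarrow> complex^'n" where
  "complex_vec v = (\<chi> i. complex_of_real (v $ i))"

definition complex_mat :: "real^'n^'m \<Rightarrow> complex^'n^'m" where
  "complex_mat = map_matrix complex_of_real"

definition scale_mat :: "complex \<Rightarrow> complex^'n^'m \<Rightarrow> complex^'n^'m" where
  "scale_mat z = map_matrix ((*) z)"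

primrec mat_power :: "complex^'n^'n \<Rightarrow> nat \<Rightarrow> complex^'n^'n" where
  "mat_power A 0 = mat 1"
| "mat_power A (Suc k) = A ** mat_power A k"

definition mat_exp :: "complex^'n^'n \<Rightarrow> complex^'n^'n" where
  "mat_exp A = (\<Sum>k. (1 / fact k) *\<^sub>R mat_power A k)"

definition symbol ::
  "real^'n^'n \<Rightarrow> real^'n^'n \<Rightarrow> real^'n^'n \<Rightarrow> real^'n^'n \<Rightarrow> complex \<Rightarrow> complex^'n^'n" where
  "symbol a0 a1 L B z =
     - (complex_mat (matrix_inv a0) **
        (complex_mat L + scale_mat z (complex_mat a1) - scale_mat (z\<^sup>2) (complex_mat B)))"

definition solution_op ::
  "(complex \<Rightarrow> complex^'n^'n) \<Rightarrow> real \<Rightarrow> (real \<Rightarrow> complex^'n) \<Rightarrow> real \<Rightarrow> complex^'n" where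
  "solution_op \<Phi> t h = inverse_fourier
     (\<lambda>\<xi>. mat_exp (scale_mat (complex_of_real t) (\<Phi> (\<i> * complex_of_real \<xi>))) *v fourier h \<xi>)"

end

theory Submission
  imports Defs "HOL-Probability.Probability" "HOL-Real_Asymp.Real_Asymp"
begin

text \<open>
  On the Fourier side the solution is \<open>Z(t) = e\<^sup>t\<^sup>\<Phi> (A\<^sup>0)\<inverse> h\<close> at every frequency \<open>\<xi>\<close> separately, so the estimate
  is a pointwise bound on a matrix exponential in \<open>\<complex>\<^sup>4\<close> combined with Plancherel's theorem.

  \<^bold>\<open>The pointwise bound.\<close> With \<open>H\<close> the Hessian of the entropy one has \<open>A\<^sup>0 = H\<inverse>\<close>; the variable \<open>A\<^sup>0 Z\<close> is the
  perturbation of the conserved variables, and its initial value is \<open>h\<close> itself. In primitive variables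
  (density, velocity, temperature, radiation), scaled by suitable positive factors, the system becomes
  symmetric: the velocity is coupled through the transport terms to the three other unknowns, the
  matrix \<open>L\<close> damps one combination \<open>m\<^sub>1 \<theta> - m\<^sub>2 n\<close> of temperature and radiation,
  and \<open>B\<close> damps \<open>\<xi> n\<close>. The velocity and the density are not damped directly. Adding to
  the energy small multiples of \<open>Im (\<theta> \<bar>u)\<close> and \<open>Im (u \<bar>r)\<close> passes the damping first from \<open>\<theta>\<close> to \<open>u\<close>, and
  then from \<open>u\<close> to \<open>r\<close> (\<open>energy_inequality\<close>); this is a Kawashima compensating functional written out by hand. The
  result is decay at the rate \<open>\<xi>\<^sup>2 / (1 + \<xi>\<^sup>2)\<close>, hence exponential decay for \<open>\<bar>\<xi>\<bar> \<ge> 1\<close> and heat-like decay for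
  \<open>\<bar>\<xi>\<bar> \<le> 1\<close>.

  \<^bold>\<open>The gain from the orthogonality.\<close> A vector orthogonal to the null space of \<open>L\<close> is \<open>(0, 0, a, - a)\<close>,
  and in the scaled variables this datum is a multiple of \<open>q = (0, 0, m\<^sub>1, - m\<^sub>2)\<close>, an eigenvector at \<open>\<xi> = 0\<close> for the
  eigenvalue \<open>- \<bar>q\<bar>\<^sup>2 < 0\<close>. Subtracting \<open>e\<^sup>-\<^sup>\<lambda>\<^sup>t q\<close> with \<open>\<lambda> = \<bar>q\<bar>\<^sup>2\<close> leaves a remainder that starts at zero and is driven by a
  source of size \<open>\<bar>\<xi>\<bar> e\<^sup>-\<^sup>\<lambda>\<^sup>t\<close>. The energy inequality with a source then gives
  the additional factor \<open>\<bar>\<xi>\<bar>\<close> at low frequencies (\<open>frequency_decay\<close>).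
  This factor improves \<open>(1 + t)\<close> from the power \<open>- (\<ell>/2 + 1/4)\<close> to \<open>- (\<ell>/2 + 3/4)\<close>.

  \<^bold>\<open>Fourier analysis.\<close> Bessel's inequality for integrable functions comes from a
  Gaussian regularization, and it makes the truncated Fourier integrals of a square integrable function
  a Cauchy family. Pairing with test functions, for which inversion is elementary, and the lemma of Du Bois-Reymond
  give inversion in \<open>L\<^sup>2\<close>; inversion together with Bessel's inequality in both directions gives the
  isometry. The same pairing identifies weak derivatives with multiplication by \<open>(i\<xi>)\<^sup>\<ell>\<close>. Uniqueness of weak derivatives,
  again by Du Bois-Reymond, transfers all this to the chosen representatives.
\<close>

section \<open>Fourier integrals and Gaussian regularization\<close>

text \<open>Both signs of the exponent are treated at once: \<open>\<sigma> = -1\<close> is the Fourier transform and \<open>\<sigma> = 1\<close> its inverse.\<close>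

definition ft :: "real \<Rightarrow> (real \<Rightarrow> complex) \<Rightarrow> real \<Rightarrow> complex" where
  "ft \<sigma> f \<xi> = (1 / sqrt (2 * pi)) *\<^sub>R (\<integral>x. cis (\<sigma> * (\<xi> * x)) * f x \<partial>lborel)"

lemma borel_measurable_cis [measurable]:
  "cis \<in> borel_measurable borel"
  by (intro borel_measurable_continuous_onI continuous_intros)

lemma integrable_bounded_mult:
  fixes f g :: "'a \<Rightarrow> complex"
  assumes "integrable M f" and [measurable]: "g \<in> borel_measurable M" and "\<And>x. norm (g x) \<le> B"
  shows "integrable M (\<lambda>x. g x * f x)"
proof (rule Bochner_Integration.integrable_bound[where f="\<lambda>x. B * norm (f x)"])
  show "integrable M (\<lambda>x. B * norm (f x))" using assms by simp
  have [measurable]: "f \<in> borel_measurable M" using assms by simp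
  show "(\<lambda>x. g x * f x) \<in> borel_measurable M" by measurable
  show "AE x in M. norm (g x * f x) \<le> norm (B * norm (f x))"
    using assms(3) by (intro always_eventually allI)
      (auto simp: norm_mult abs_mult intro!: mult_right_mono order_trans[OF assms(3) abs_ge_self])
qed

lemma integrable_cis_mult:
  "integrable lborel f \<Longrightarrow> integrable lborel (\<lambda>x. cis (a * x) * f x)"
  by (rule integrable_bounded_mult[where B=1]) auto

text \<open>The product of two integrable functions dominates the integrand, since the kernel is bounded. All exchanges of integrals below are instances, with an exponential as kernel.\<close>

lemma bounded_kernel_Fubini:
  fixes f g :: "real \<Rightarrow> complex" and k :: "real \<Rightarrow> real \<Rightarrow> complex"
  assumes f: "integrable lborel f" and g: "integrable lborel g"
    and k[measurable]: "case_prod k \<in> borel_measurable (lborel \<Otimes>\<^sub>M lborel)"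
    and B: "\<And>x y. norm (k x y) \<le> B"
  shows "(\<integral>x. f x * (\<integral>y. k x y * g y \<partial>lborel) \<partial>lborel) = (\<integral>y. (\<integral>x. k x y * f x \<partial>lborel) * g y \<partial>lborel)"
proof -
  have [measurable]: "f \<in> borel_measurable borel" "g \<in> borel_measurable borel" using f g by auto
  have [measurable]: "\<And>x. k x \<in> borel_measurable borel" using k by measurable
  have "integrable (lborel \<Otimes>\<^sub>M lborel) (\<lambda>(x,y). f x * (k x y * g y))"
  proof (rule lborel_pair.Fubini_integrable)
    have *: "integrable lborel (\<lambda>y. f x * (k x y * g y))" for x
      by (intro integrable_mult_right integrable_bounded_mult[OF g _ B]) measurable
    show "AE x in lborel. integrable lborel (\<lambda>y. case (x, y) of (x, y) \<Rightarrow> f x * (k x y * g y))"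
      using * by simp
    show "integrable lborel (\<lambda>x. \<integral>y. norm (case (x, y) of (x, y) \<Rightarrow> f x * (k x y * g y)) \<partial>lborel)"
    proof (rule Bochner_Integration.integrable_bound)
      show "integrable lborel (\<lambda>x. norm (f x) * (B * (\<integral>y. norm (g y) \<partial>lborel)))" using f by simp
      show "AE x in lborel. norm (\<integral>y. norm (case (x, y) of (x, y) \<Rightarrow> f x * (k x y * g y)) \<partial>lborel)
        \<le> norm (norm (f x) * (B * (\<integral>y. norm (g y) \<partial>lborel)))"
      proof (intro always_eventually allI)
        fix x
        have "(\<integral>y. norm (f x * (k x y * g y)) \<partial>lborel) \<le> (\<integral>y. norm (f x) * (B * norm (g y)) \<partial>lborel)"
          using g by (intro integral_mono integrable_norm *) (auto simp: norm_mult B intro!: mult_left_mono mult_right_mono)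
        then show "norm (\<integral>y. norm (case (x, y) of (x, y) \<Rightarrow> f x * (k x y * g y)) \<partial>lborel)
        \<le> norm (norm (f x) * (B * (\<integral>y. norm (g y) \<partial>lborel)))" by simp
      qed
    qed measurable
  qed measurable
  from lborel_pair.Fubini_integral[OF this]
  have "(\<integral>y. (\<integral>x. f x * (k x y * g y) \<partial>lborel) \<partial>lborel) = (\<integral>x. (\<integral>y. f x * (k x y * g y) \<partial>lborel) \<partial>lborel)" .
  moreover have "(\<integral>x. f x * (k x y * g y) \<partial>lborel) = (\<integral>x. k x y * f x \<partial>lborel) * g y" for y
  proof -
    have "(\<lambda>x. f x * (k x y * g y)) = (\<lambda>x. (k x y * f x) * g y)" by (auto simp: ac_simps)
    moreover have "integrable lborel (\<lambda>x. k x y * f x)"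
      by (intro integrable_bounded_mult[OF f _ B]) measurable
    ultimately show ?thesis by simp
  qed
  moreover have "(\<integral>y. f x * (k x y * g y) \<partial>lborel) = f x * (\<integral>y. k x y * g y \<partial>lborel)" for x
    by simp
  ultimately show ?thesis by simp
qed

lemma ft_mult_formula:
  assumes "integrable lborel f" "integrable lborel g"
  shows "(\<integral>x. f x * ft \<sigma> g x \<partial>lborel) = (\<integral>x. ft \<sigma> f x * g x \<partial>lborel)"
proof -
  have "(\<integral>x. f x * (\<integral>y. cis (\<sigma> * (x * y)) * g y \<partial>lborel) \<partial>lborel)
      = (\<integral>y. (\<integral>x. cis (\<sigma> * (x * y)) * f x \<partial>lborel) * g y \<partial>lborel)"
    by (rule bounded_kernel_Fubini[OF assms, where B=1]) auto
  then show ?thesis by (simp add: ft_def ac_simps)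
qed

lemma measurable_ft [measurable]:
  assumes [measurable]: "f \<in> borel_measurable borel"
  shows "ft \<sigma> f \<in> borel_measurable borel"
  unfolding ft_def by measurable

lemma norm_ft_le:
  "norm (ft \<sigma> f x) \<le> (1 / sqrt (2 * pi)) * (\<integral>x. norm (f x) \<partial>lborel)"
proof -
  have "norm (\<integral>y. cis (\<sigma> * (x * y)) * f y \<partial>lborel) \<le> (\<integral>y. norm (cis (\<sigma> * (x * y)) * f y) \<partial>lborel)"
    by (rule integral_norm_bound)
  then show ?thesis by (simp add: ft_def norm_mult divide_right_mono)
qed

lemma cnj_ft: "cnj (ft \<sigma> f x) = ft (-\<sigma>) (\<lambda>x. cnj (f x)) x"
  by (simp add: ft_def cis_cnj Bochner_Integration.integral_cnj[symmetric] del: Bochner_Integration.integral_cnj)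

definition gauss :: "real \<Rightarrow> real \<Rightarrow> complex" where
  "gauss \<delta> \<xi> = complex_of_real (exp (- (\<delta> * \<xi>)\<^sup>2 / 2))"

lemma gauss_eq: "\<delta> > 0 \<Longrightarrow> gauss \<delta> \<xi> = sqrt (2 * pi) * std_normal_density (\<delta> * \<xi>)"
  by (simp add: gauss_def std_normal_density_def)

lemma measurable_gauss [measurable]: "gauss \<delta> \<in> borel_measurable borel"
  unfolding gauss_def by measurable

lemma norm_gauss_le: "norm (gauss \<delta> \<xi>) \<le> 1"
  by (simp add: gauss_def)

lemma integrable_gauss: "\<delta> > 0 \<Longrightarrow> integrable lborel (gauss \<delta>)"
proof -
  assume \<delta>: "\<delta> > 0"
  have "integrable lborel (\<lambda>\<xi>. std_normal_density (0 + \<delta> * \<xi>))"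
    using \<delta> by (intro lborel_integrable_real_affine) auto
  then have "integrable lborel (\<lambda>\<xi>. complex_of_real (sqrt (2 * pi) * std_normal_density (0 + \<delta> * \<xi>)))"
    by (intro integrable_of_real integrable_mult_right)
  moreover have "gauss \<delta> = (\<lambda>\<xi>. complex_of_real (sqrt (2 * pi) * std_normal_density (0 + \<delta> * \<xi>)))"
    using \<delta> by (simp add: gauss_eq fun_eq_iff)
  ultimately show ?thesis by simp
qed

text \<open>A rescaling of the characteristic function of the normal distribution.\<close>

lemma integral_cis_gauss:
  assumes \<delta>: "\<delta> > 0"
  shows "(\<integral>\<xi>. cis (y * \<xi>) * gauss \<delta> \<xi> \<partial>lborel) = complex_of_real (2 * pi * normal_density 0 \<delta> y)"
proof -
  have "exp (- ((y/\<delta>)\<^sup>2) / 2) = char std_normal_distribution (y/\<delta>)"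
    by (simp add: char_std_normal_distribution)
  also have "\<dots> = (\<integral>x. std_normal_density x *\<^sub>R iexp (y/\<delta> * x) \<partial>lborel)"
    unfolding char_def by (subst integral_density) auto
  also have "\<dots> = (\<integral>x. std_normal_density x *\<^sub>R cis (y/\<delta> * x) \<partial>lborel)"
    by (simp add: cis_conv_exp)
  also have "\<dots> = \<delta> *\<^sub>R (\<integral>x. std_normal_density (0 + \<delta> * x) *\<^sub>R cis (y/\<delta> * (0 + \<delta> * x)) \<partial>lborel)"
    using \<delta> by (subst lborel_integral_real_affine[where c=\<delta> and t=0]) auto
  also have "(\<lambda>x. std_normal_density (0 + \<delta> * x) *\<^sub>R cis (y/\<delta> * (0 + \<delta> * x)))
     = (\<lambda>x. complex_of_real (1 / sqrt (2 * pi)) * (cis (y * x) * gauss \<delta> x))"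
    using \<delta> by (auto simp: gauss_eq scaleR_conv_of_real field_simps fun_eq_iff)
  also have "\<delta> *\<^sub>R (\<integral>x. complex_of_real (1 / sqrt (2 * pi)) * (cis (y * x) * gauss \<delta> x) \<partial>lborel) =
    complex_of_real (\<delta> / sqrt (2 * pi)) * (\<integral>\<xi>. cis (y * \<xi>) * gauss \<delta> \<xi> \<partial>lborel)"
    by (simp add: scaleR_conv_of_real)
  finally have "(\<integral>\<xi>. cis (y * \<xi>) * gauss \<delta> \<xi> \<partial>lborel) = complex_of_real (sqrt (2 * pi) / \<delta> * exp (- ((y/\<delta>)\<^sup>2) / 2))"
    using \<delta> by (simp add: field_simps)
  also have "sqrt (2 * pi) / \<delta> * exp (- ((y/\<delta>)\<^sup>2) / 2) = 2 * pi * normal_density 0 \<delta> y"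
  proof -
    have "sqrt (2 * pi * \<delta>\<^sup>2) = sqrt (2*pi) * \<delta>" using \<delta> by (simp add: real_sqrt_mult)
    moreover have "sqrt (2*pi) * sqrt (2*pi) = 2 * pi" by simp
    ultimately show ?thesis using \<delta> unfolding normal_density_def
      by (simp add: field_simps)
  qed
  finally show ?thesis .
qed

text \<open>Damping the transform by a Gaussian before inverting it convolves the function with a normal density. Both Bessel's inequality and the inversion formula are limits of this identity.\<close>

lemma ft_gauss_ft:
  assumes f: "integrable lborel f" and \<delta>: "\<delta> > 0" and \<sigma>: "\<bar>\<sigma>\<bar> = 1"
  shows "ft (-\<sigma>) (\<lambda>\<xi>. gauss \<delta> \<xi> * ft \<sigma> f \<xi>) y = (\<integral>x. complex_of_real (normal_density 0 \<delta> (x - y)) * f x \<partial>lborel)"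
proof -
  have "ft (-\<sigma>) (\<lambda>\<xi>. gauss \<delta> \<xi> * ft \<sigma> f \<xi>) y
    = complex_of_real (1 / (2*pi)) * (\<integral>\<xi>. (cis (-\<sigma> * (y * \<xi>)) * gauss \<delta> \<xi>) * (\<integral>x. cis (\<sigma> * (\<xi> * x)) * f x \<partial>lborel) \<partial>lborel)"
    by (simp add: ft_def scaleR_conv_of_real ac_simps flip: of_real_mult)
  also have "(\<integral>\<xi>. (cis (-\<sigma> * (y * \<xi>)) * gauss \<delta> \<xi>) * (\<integral>x. cis (\<sigma> * (\<xi> * x)) * f x \<partial>lborel) \<partial>lborel)
    = (\<integral>x. (\<integral>\<xi>. cis (\<sigma> * (\<xi> * x)) * (cis (-\<sigma> * (y * \<xi>)) * gauss \<delta> \<xi>) \<partial>lborel) * f x \<partial>lborel)"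
    using integrable_cis_mult[OF integrable_gauss[OF \<delta>], of "-\<sigma>*y"]
    by (intro bounded_kernel_Fubini[where B=1] f) (auto simp: ac_simps)
  also have "(\<lambda>x. (\<integral>\<xi>. cis (\<sigma> * (\<xi> * x)) * (cis (-\<sigma> * (y * \<xi>)) * gauss \<delta> \<xi>) \<partial>lborel))
     = (\<lambda>x. complex_of_real (2 * pi * normal_density 0 \<delta> (x - y)))"
  proof
    fix x
    have "(\<lambda>\<xi>. cis (\<sigma> * (\<xi> * x)) * (cis (-\<sigma> * (y * \<xi>)) * gauss \<delta> \<xi>)) = (\<lambda>\<xi>. cis ((\<sigma> * (x - y)) * \<xi>) * gauss \<delta> \<xi>)"
      by (simp add: fun_eq_iff cis_mult mult.assoc[symmetric]) (simp add: algebra_simps)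
    moreover have "normal_density 0 \<delta> (\<sigma> * (x - y)) = normal_density 0 \<delta> (x - y)"
      using \<sigma> by (auto simp: normal_density_def abs_if split: if_splits) (auto simp: power2_eq_square algebra_simps)
    ultimately show "(\<integral>\<xi>. cis (\<sigma> * (\<xi> * x)) * (cis (-\<sigma> * (y * \<xi>)) * gauss \<delta> \<xi>) \<partial>lborel) = complex_of_real (2 * pi * normal_density 0 \<delta> (x - y))"
      by (simp add: integral_cis_gauss[OF \<delta>])
  qed
  finally show ?thesis
    by (simp add: mult.assoc)
qed

lemma borel_measurable_cnj [measurable]: "cnj \<in> borel_measurable borel"
  by (intro borel_measurable_continuous_onI continuous_intros)

lemma nn_integral_normal_density:
  "\<delta> > 0 \<Longrightarrow> (\<integral>\<^sup>+x. ennreal (normal_density y \<delta> x) \<partial>lborel) = 1"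
  by (subst nn_integral_eq_integral) (auto simp: integrable_normal_density)

lemma normal_density_0_diff: "normal_density 0 \<delta> (x - y) = normal_density y \<delta> x"
  "normal_density 0 \<delta> (x - y) = normal_density x \<delta> y"
  by (auto simp: normal_density_def power2_commute)

text \<open>Since \<open>2 \<bar>f x\<bar> \<bar>f y\<bar> \<le> \<bar>f x\<bar>\<^sup>2 + \<bar>f y\<bar>\<^sup>2\<close> and the normal density has integral one in either variable, smoothing does not increase the quadratic form.\<close>

lemma normal_average_le:
  fixes f :: "real \<Rightarrow> complex"
  assumes [measurable]: "f \<in> borel_measurable borel" and \<delta>: "\<delta> > 0"
  shows "(\<integral>\<^sup>+y. ennreal (cmod (f y)) * (\<integral>\<^sup>+x. ennreal (normal_density 0 \<delta> (x - y)) * ennreal (cmod (f x)) \<partial>lborel) \<partial>lborel)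
    \<le> (\<integral>\<^sup>+x. ennreal ((cmod (f x))\<^sup>2) \<partial>lborel)" (is "?L \<le> ?I")
proof -
  let ?N = "\<lambda>x y. ennreal (normal_density 0 \<delta> (x - y))"
  let ?s = "\<lambda>x. ennreal ((cmod (f x))\<^sup>2)"
  have "2 * ?L = (\<integral>\<^sup>+y. (\<integral>\<^sup>+x. 2 * (ennreal (cmod (f y)) * (?N x y * ennreal (cmod (f x)))) \<partial>lborel) \<partial>lborel)"
    by (simp add: nn_integral_cmult)
  also have "\<dots> \<le> (\<integral>\<^sup>+y. (\<integral>\<^sup>+x. ?N x y * ?s x + ?N x y * ?s y \<partial>lborel) \<partial>lborel)"
  proof (intro nn_integral_mono)
    fix x y :: real
    have "normal_density 0 \<delta> (x - y) * (2 * cmod (f y) * cmod (f x)) \<le> normal_density 0 \<delta> (x - y) * ((cmod (f x))\<^sup>2 + (cmod (f y))\<^sup>2)"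
      using sum_squares_bound[of "cmod (f y)" "cmod (f x)"] by (intro mult_left_mono) auto
    then show "2 * (ennreal (cmod (f y)) * (?N x y * ennreal (cmod (f x)))) \<le> ?N x y * ?s x + ?N x y * ?s y"
      by (simp flip: ennreal_mult ennreal_plus ennreal_numeral add: algebra_simps)
  qed
  also have "\<dots> = (\<integral>\<^sup>+y. (\<integral>\<^sup>+x. ?N x y * ?s x \<partial>lborel) \<partial>lborel) + (\<integral>\<^sup>+y. (\<integral>\<^sup>+x. ?N x y * ?s y \<partial>lborel) \<partial>lborel)"
    by (simp add: nn_integral_add)
  also have "(\<integral>\<^sup>+y. (\<integral>\<^sup>+x. ?N x y * ?s x \<partial>lborel) \<partial>lborel) = (\<integral>\<^sup>+x. (\<integral>\<^sup>+y. ?N x y * ?s x \<partial>lborel) \<partial>lborel)"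
    by (rule lborel_pair.Fubini') measurable
  also have "\<dots> = ?I"
    by (simp add: nn_integral_multc normal_density_0_diff(2) nn_integral_normal_density[OF \<delta>])
  also have "(\<integral>\<^sup>+y. (\<integral>\<^sup>+x. ?N x y * ?s y \<partial>lborel) \<partial>lborel) = ?I"
    by (simp add: nn_integral_multc normal_density_0_diff(1) nn_integral_normal_density[OF \<delta>])
  also have "?I + ?I = 2 * ?I" by (simp add: mult_2)
  finally show ?thesis by (simp add: ennreal_mult_le_mult_iff)
qed

lemma bounded_ft:
  assumes "integrable lborel f" obtains B where "\<And>x. norm (ft \<sigma> f x) \<le> B"
  using norm_ft_le by blast

text \<open>By the multiplication formula and \<open>ft_gauss_ft\<close>, the left side is the quadratic form of \<open>f\<close> smoothed by a normal density.\<close>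

lemma Bessel_gauss:
  assumes f: "integrable lborel f" and \<delta>: "\<delta> > 0" and \<sigma>: "\<bar>\<sigma>\<bar> = 1"
  shows "(\<integral>\<^sup>+\<xi>. ennreal (exp (- (\<delta> * \<xi>)\<^sup>2 / 2) * (cmod (ft \<sigma> f \<xi>))\<^sup>2) \<partial>lborel) \<le> (\<integral>\<^sup>+x. ennreal ((cmod (f x))\<^sup>2) \<partial>lborel)"
proof -
  have [measurable]: "f \<in> borel_measurable borel" using f by auto
  obtain B where B: "\<And>x. norm (ft \<sigma> f x) \<le> B" using bounded_ft[OF f] by blast
  let ?g = "\<lambda>\<xi>. gauss \<delta> \<xi> * ft \<sigma> f \<xi>"
  let ?K = "\<lambda>y. (\<integral>x. complex_of_real (normal_density 0 \<delta> (x - y)) * f x \<partial>lborel)"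
  have g: "integrable lborel ?g"
    using integrable_bounded_mult[OF integrable_gauss[OF \<delta>] _ B] by (simp add: mult.commute)
  have cf: "integrable lborel (\<lambda>x. cnj (f x))" using f by simp
  have Kft: "ft (-\<sigma>) ?g = ?K" using ft_gauss_ft[OF f \<delta> \<sigma>] by (intro ext)
  have "(\<integral>\<xi>. cnj (ft \<sigma> f \<xi>) * ?g \<xi> \<partial>lborel) = (\<integral>x. cnj (f x) * ?K x \<partial>lborel)"
    using ft_mult_formula[OF cf g, of "-\<sigma>"] unfolding Kft by (simp add: cnj_ft)
  moreover have "(\<lambda>\<xi>. cnj (ft \<sigma> f \<xi>) * ?g \<xi>) = (\<lambda>\<xi>. complex_of_real (exp (- (\<delta> * \<xi>)\<^sup>2 / 2) * (cmod (ft \<sigma> f \<xi>))\<^sup>2))"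
    by (auto simp: gauss_def fun_eq_iff complex_norm_square[symmetric] mult.left_commute mult.commute[of "cnj _"] simp del: of_real_power)
  ultimately have eq: "complex_of_real (\<integral>\<xi>. exp (- (\<delta> * \<xi>)\<^sup>2 / 2) * (cmod (ft \<sigma> f \<xi>))\<^sup>2 \<partial>lborel) = (\<integral>x. cnj (f x) * ?K x \<partial>lborel)"
    by (simp only: integral_complex_of_real)
  have int: "integrable lborel (\<lambda>\<xi>. exp (- (\<delta> * \<xi>)\<^sup>2 / 2) * (cmod (ft \<sigma> f \<xi>))\<^sup>2)"
  proof -
    have "integrable lborel (\<lambda>\<xi>. cnj (ft \<sigma> f \<xi>) * ?g \<xi>)"
      by (rule integrable_bounded_mult[OF g, of _ B]) (use B in \<open>simp_all\<close>)
    then have "integrable lborel (\<lambda>\<xi>. norm (cnj (ft \<sigma> f \<xi>) * ?g \<xi>))" by (rule integrable_norm)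
    then show ?thesis by (simp add: norm_mult gauss_def power2_eq_square ac_simps)
  qed
  have "(\<integral>\<^sup>+\<xi>. ennreal (exp (- (\<delta> * \<xi>)\<^sup>2 / 2) * (cmod (ft \<sigma> f \<xi>))\<^sup>2) \<partial>lborel) = ennreal (\<integral>\<xi>. exp (- (\<delta> * \<xi>)\<^sup>2 / 2) * (cmod (ft \<sigma> f \<xi>))\<^sup>2 \<partial>lborel)"
    by (rule nn_integral_eq_integral[OF int]) simp
  also have "\<dots> \<le> ennreal (norm (\<integral>x. cnj (f x) * ?K x \<partial>lborel))"
    unfolding eq[symmetric] by (intro ennreal_leI) simp
  also have "\<dots> \<le> (\<integral>\<^sup>+x. ennreal (norm (cnj (f x) * ?K x)) \<partial>lborel)"
  proof (rule integral_norm_bound_ennreal)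
    obtain B' where "\<And>x. norm (ft (-\<sigma>) ?g x) \<le> B'" using bounded_ft[OF g] by blast
    then show "integrable lborel (\<lambda>x. cnj (f x) * ?K x)"
      using integrable_bounded_mult[OF cf, of ?K B'] unfolding Kft by (simp add: mult.commute)
  qed
  also have "\<dots> \<le> (\<integral>\<^sup>+y. ennreal (cmod (f y)) * (\<integral>\<^sup>+x. ennreal (normal_density 0 \<delta> (x - y)) * ennreal (cmod (f x)) \<partial>lborel) \<partial>lborel)"
  proof (intro nn_integral_mono)
    fix y
    have "integrable lborel (\<lambda>x. complex_of_real (normal_density 0 \<delta> (x - y)) * f x)"
      using \<delta> by (intro integrable_bounded_mult[OF f, of _ "1 / sqrt (2 * pi * \<delta>\<^sup>2)"])
         (auto simp: normal_density_def norm_divide divide_right_mono)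
    then have "ennreal (norm (?K y)) \<le> (\<integral>\<^sup>+x. ennreal (norm (complex_of_real (normal_density 0 \<delta> (x - y)) * f x)) \<partial>lborel)"
      by (rule integral_norm_bound_ennreal)
    also have "\<dots> = (\<integral>\<^sup>+x. ennreal (normal_density 0 \<delta> (x - y)) * ennreal (cmod (f x)) \<partial>lborel)"
      by (simp add: norm_mult ennreal_mult)
    finally show "ennreal (norm (cnj (f y) * ?K y)) \<le> ennreal (cmod (f y)) * (\<integral>\<^sup>+x. ennreal (normal_density 0 \<delta> (x - y)) * ennreal (cmod (f x)) \<partial>lborel)"
      by (simp add: norm_mult ennreal_mult mult_left_mono)
  qed
  also have "\<dots> \<le> (\<integral>\<^sup>+x. ennreal ((cmod (f x))\<^sup>2) \<partial>lborel)"
    by (rule normal_average_le[OF _ \<delta>]) simp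
  finally show ?thesis .
qed

text \<open>The Gaussian damping is removed by Fatou's lemma.\<close>

lemma Bessel:
  assumes f: "integrable lborel f" and \<sigma>: "\<bar>\<sigma>\<bar> = 1"
  shows "(\<integral>\<^sup>+\<xi>. ennreal ((cmod (ft \<sigma> f \<xi>))\<^sup>2) \<partial>lborel) \<le> (\<integral>\<^sup>+x. ennreal ((cmod (f x))\<^sup>2) \<partial>lborel)"
proof -
  have [measurable]: "f \<in> borel_measurable borel" using f by auto
  let ?u = "\<lambda>n \<xi>. ennreal (exp (- (inverse (real (Suc n)) * \<xi>)\<^sup>2 / 2) * (cmod (ft \<sigma> f \<xi>))\<^sup>2)"
  have lim: "(\<lambda>n. ?u n \<xi>) \<longlonglongrightarrow> ennreal ((cmod (ft \<sigma> f \<xi>))\<^sup>2)" for \<xi>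
  proof -
    have "(\<lambda>n. exp (- (inverse (real (Suc n)) * \<xi>)\<^sup>2 / 2) * (cmod (ft \<sigma> f \<xi>))\<^sup>2) \<longlonglongrightarrow> exp (- (0 * \<xi>)\<^sup>2 / 2) * (cmod (ft \<sigma> f \<xi>))\<^sup>2"
      by (intro tendsto_intros LIMSEQ_inverse_real_of_nat) simp_all
    then show ?thesis by (intro tendsto_ennrealI) simp
  qed
  have "(\<integral>\<^sup>+\<xi>. ennreal ((cmod (ft \<sigma> f \<xi>))\<^sup>2) \<partial>lborel) = (\<integral>\<^sup>+\<xi>. liminf (\<lambda>n. ?u n \<xi>) \<partial>lborel)"
    using lim by (intro nn_integral_cong) (metis lim_imp_Liminf trivial_limit_sequentially)
  also have "\<dots> \<le> liminf (\<lambda>n. \<integral>\<^sup>+\<xi>. ?u n \<xi> \<partial>lborel)"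
    by (rule nn_integral_liminf) measurable
  also have "\<dots> \<le> liminf (\<lambda>n::nat. \<integral>\<^sup>+x. ennreal ((cmod (f x))\<^sup>2) \<partial>lborel)"
    by (intro Liminf_mono always_eventually allI Bessel_gauss f \<sigma>) simp
  finally show ?thesis by (simp add: Liminf_const)
qed

text \<open>As the damping disappears, the transform side converges by domination by \<open>ft \<sigma> f\<close>; the other side is an average of \<open>f\<close> around \<open>y\<close> and converges by continuity.\<close>

lemma ft_inversion:
  assumes f: "integrable lborel f" and cont: "\<And>x. isCont f x" and B: "\<And>x. norm (f x) \<le> B"
    and Ff: "integrable lborel (ft \<sigma> f)" and \<sigma>: "\<bar>\<sigma>\<bar> = 1"
  shows "ft (-\<sigma>) (ft \<sigma> f) y = f y"
proof -
  have [measurable]: "f \<in> borel_measurable borel" using f by auto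
  let ?d = "\<lambda>n. inverse (real (Suc n))"
  have "(\<lambda>n. ft (-\<sigma>) (\<lambda>\<xi>. gauss (?d n) \<xi> * ft \<sigma> f \<xi>) y) \<longlonglongrightarrow> ft (-\<sigma>) (ft \<sigma> f) y"
    unfolding ft_def[of "-\<sigma>"]
  proof (intro tendsto_intros integral_dominated_convergence[where w="\<lambda>x. norm (ft \<sigma> f x)"])
    show "integrable lborel (\<lambda>x. norm (ft \<sigma> f x))" using Ff by simp
    show "AE x in lborel. (\<lambda>n. cis (- \<sigma> * (y * x)) * (gauss (?d n) x * ft \<sigma> f x)) \<longlonglongrightarrow> cis (- \<sigma> * (y * x)) * ft \<sigma> f x"
    proof (intro always_eventually allI)
      fix x
      have "(\<lambda>n. gauss (?d n) x) \<longlonglongrightarrow> complex_of_real (exp (- (0 * x)\<^sup>2 / 2))"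
        unfolding gauss_def by (intro tendsto_intros LIMSEQ_inverse_real_of_nat) simp_all
      then have "(\<lambda>n. cis (- \<sigma> * (y * x)) * (gauss (?d n) x * ft \<sigma> f x)) \<longlonglongrightarrow> cis (- \<sigma> * (y * x)) * (complex_of_real (exp (- (0 * x)\<^sup>2 / 2)) * ft \<sigma> f x)"
        by (intro tendsto_intros)
      then show "(\<lambda>n. cis (- \<sigma> * (y * x)) * (gauss (?d n) x * ft \<sigma> f x)) \<longlonglongrightarrow> cis (- \<sigma> * (y * x)) * ft \<sigma> f x" by simp
    qed
    show "AE x in lborel. norm (cis (- \<sigma> * (y * x)) * (gauss (?d n) x * ft \<sigma> f x)) \<le> norm (ft \<sigma> f x)" for n
      using norm_gauss_le by (auto simp: norm_mult intro!: mult_left_le_one_le)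
  qed simp_all
  moreover have "(\<lambda>n. ft (-\<sigma>) (\<lambda>\<xi>. gauss (?d n) \<xi> * ft \<sigma> f \<xi>) y) \<longlonglongrightarrow> f y"
  proof -
    have *: "ft (-\<sigma>) (\<lambda>\<xi>. gauss \<delta> \<xi> * ft \<sigma> f \<xi>) y = (\<integral>z. complex_of_real (std_normal_density z) * f (y + \<delta> * z) \<partial>lborel)"
      if \<delta>: "\<delta> > 0" for \<delta>
    proof -
      have "normal_density 0 \<delta> (\<delta> * z) = std_normal_density z / \<delta>" for z
        using \<delta> by (simp add: normal_density_def real_sqrt_mult power_mult_distrib)
      then have "(\<lambda>z. complex_of_real (normal_density 0 \<delta> (y + \<delta> * z - y)) * f (y + \<delta> * z))
        = (\<lambda>z. complex_of_real (1 / \<delta>) * (complex_of_real (std_normal_density z) * f (y + \<delta> * z)))"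
        by (simp add: fun_eq_iff)
      then show ?thesis
        unfolding ft_gauss_ft[OF f \<delta> \<sigma>] using \<delta>
        by (subst lborel_integral_real_affine[where c=\<delta> and t=y]) (simp_all add: scaleR_conv_of_real)
    qed
    have "ft (-\<sigma>) (\<lambda>\<xi>. gauss (?d n) \<xi> * ft \<sigma> f \<xi>) y = (\<integral>z. complex_of_real (std_normal_density z) * f (y + ?d n * z) \<partial>lborel)" for n
      by (rule *) simp
    moreover have "(\<lambda>n. \<integral>z. complex_of_real (std_normal_density z) * f (y + ?d n * z) \<partial>lborel) \<longlonglongrightarrow> (\<integral>z. complex_of_real (std_normal_density z) * f y \<partial>lborel)"
    proof (intro integral_dominated_convergence[where w="\<lambda>z. std_normal_density z * B"])
      show "AE x in lborel. (\<lambda>n. complex_of_real (std_normal_density x) * f (y + ?d n * x)) \<longlonglongrightarrow> complex_of_real (std_normal_density x) * f y"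
      proof (intro always_eventually allI)
        fix x
        have "(\<lambda>n. y + ?d n * x) \<longlonglongrightarrow> y + 0 * x" by (intro tendsto_intros LIMSEQ_inverse_real_of_nat)
        then have "(\<lambda>n. f (y + ?d n * x)) \<longlonglongrightarrow> f y" using cont isCont_tendsto_compose by fastforce
        then show "(\<lambda>n. complex_of_real (std_normal_density x) * f (y + ?d n * x)) \<longlonglongrightarrow> complex_of_real (std_normal_density x) * f y"
          by (intro tendsto_intros)
      qed
    qed (auto simp: norm_mult intro!: mult_left_mono B)
    moreover have "(\<integral>z. complex_of_real (std_normal_density z) * f y \<partial>lborel) = f y"
      by simp
    ultimately show ?thesis by simp
  qed
  ultimately show ?thesis using LIMSEQ_unique by blast
qed

section \<open>Square integrable functions and limits in the mean\<close>

abbreviation L2sq :: "(real \<Rightarrow> 'a::euclidean_space) \<Rightarrow> ennreal" where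
  "L2sq f \<equiv> \<integral>\<^sup>+x. ennreal ((norm (f x))\<^sup>2) \<partial>lborel"

lemma square_integrable_iff_L2sq:
  "square_integrable f \<longleftrightarrow> f \<in> borel_measurable borel \<and> L2sq f < \<infinity>"
  unfolding square_integrable_def integrable_iff_bounded by auto

lemma square_integrable_borel: "square_integrable f \<Longrightarrow> f \<in> borel_measurable borel"
  by (simp add: square_integrable_def)

lemma L2sq_eq: "square_integrable f \<Longrightarrow> L2sq f = ennreal ((L2_norm f)\<^sup>2)"
  unfolding square_integrable_def L2_norm_def by (subst nn_integral_eq_integral) auto

lemma norm_add_square_le: "(norm (x + y))\<^sup>2 \<le> 2 * (norm x)\<^sup>2 + 2 * (norm y)\<^sup>2" for x y :: "'a::real_normed_vector"
proof -
  have "(norm (x + y))\<^sup>2 \<le> (norm x + norm y)\<^sup>2" by (intro power_mono norm_triangle_ineq) auto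
  also have "\<dots> \<le> 2 * (norm x)\<^sup>2 + 2 * (norm y)\<^sup>2"
    using sum_squares_bound[of "norm x" "norm y"] by (simp add: power2_eq_square algebra_simps)
  finally show ?thesis .
qed

lemma L2sq_add_le:
  fixes f g :: "real \<Rightarrow> 'a::euclidean_space"
  assumes [measurable]: "f \<in> borel_measurable borel" "g \<in> borel_measurable borel"
  shows "L2sq (\<lambda>x. f x + g x) \<le> 2 * L2sq f + 2 * L2sq g"
proof -
  have "L2sq (\<lambda>x. f x + g x) \<le> (\<integral>\<^sup>+x. 2 * ennreal ((norm (f x))\<^sup>2) + 2 * ennreal ((norm (g x))\<^sup>2) \<partial>lborel)"
  proof (intro nn_integral_mono)
    fix x
    have "ennreal ((norm (f x + g x))\<^sup>2) \<le> ennreal (2 * (norm (f x))\<^sup>2 + 2 * (norm (g x))\<^sup>2)"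
      by (intro ennreal_leI norm_add_square_le)
    then show "ennreal ((norm (f x + g x))\<^sup>2) \<le> 2 * ennreal ((norm (f x))\<^sup>2) + 2 * ennreal ((norm (g x))\<^sup>2)"
      by (simp add: ennreal_mult)
  qed
  also have "\<dots> = 2 * L2sq f + 2 * L2sq g" by (simp add: nn_integral_add nn_integral_cmult)
  finally show ?thesis .
qed

lemma square_integrable_add:
  assumes "square_integrable f" "square_integrable g"
  shows "square_integrable (\<lambda>x. f x + g x)"
proof -
  have [measurable]: "f \<in> borel_measurable borel" "g \<in> borel_measurable borel"
    using assms by (auto simp: square_integrable_borel)
  have "2 * L2sq f + 2 * L2sq g < \<infinity>"
    using assms by (simp add: square_integrable_iff_L2sq ennreal_mult_less_top)
  then show ?thesis
    unfolding square_integrable_iff_L2sq using L2sq_add_le[of f g] by (auto intro: le_less_trans)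
qed

lemma square_integrable_minus:
  "square_integrable f \<Longrightarrow> square_integrable (\<lambda>x. - f x)"
  by (simp add: square_integrable_def)

lemma square_integrable_diff:
  "square_integrable f \<Longrightarrow> square_integrable g \<Longrightarrow> square_integrable (\<lambda>x. f x - g x)"
  using square_integrable_add[OF _ square_integrable_minus, of f g] by simp

lemma square_integrable_bound:
  fixes f :: "real \<Rightarrow> 'a::euclidean_space" and g :: "real \<Rightarrow> 'b::euclidean_space"
  assumes "square_integrable f" and [measurable]: "g \<in> borel_measurable borel" and "\<And>x. norm (g x) \<le> C * norm (f x)"
  shows "square_integrable g"
  unfolding square_integrable_def
proof
  have "(norm (g x))\<^sup>2 \<le> C\<^sup>2 * (norm (f x))\<^sup>2" for x
    unfolding power_mult_distrib[symmetric] by (intro power_mono assms(3) norm_ge_zero)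
  then have bound: "AE x in lborel. norm ((norm (g x))\<^sup>2) \<le> norm (C\<^sup>2 * (norm (f x))\<^sup>2)"
    by (intro always_eventually allI) (simp only: real_norm_def abs_mult abs_power2)
  have int: "integrable lborel (\<lambda>x. C\<^sup>2 * (norm (f x))\<^sup>2)"
    using assms(1) unfolding square_integrable_def by (intro integrable_mult_right) blast
  show "integrable lborel (\<lambda>x. (norm (g x))\<^sup>2)"
    by (rule Bochner_Integration.integrable_bound[OF int _ bound]) measurable
qed simp

lemma is_L2_limit_unique:
  assumes "is_L2_limit F g" "is_L2_limit F g'" and [measurable]: "\<And>R. F R \<in> borel_measurable borel"
  shows "AE x in lborel. g x = g' x"
proof -
  have [measurable]: "g \<in> borel_measurable borel" "g' \<in> borel_measurable borel"
    using assms by (auto simp: is_L2_limit_def square_integrable_borel)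
  have "((\<lambda>R. 2 * L2sq (\<lambda>x. F R x - g' x) + 2 * L2sq (\<lambda>x. F R x - g x)) \<longlongrightarrow> 2 * 0 + 2 * 0) at_top"
    using assms(1,2) unfolding is_L2_limit_def
    by (intro tendsto_add ennreal_tendsto_cmult) auto
  moreover have "L2sq (\<lambda>x. g x - g' x) \<le> 2 * L2sq (\<lambda>x. F R x - g' x) + 2 * L2sq (\<lambda>x. F R x - g x)" for R
    using L2sq_add_le[of "\<lambda>x. F R x - g' x" "\<lambda>x. g x - F R x"] by (simp add: norm_minus_commute)
  ultimately have "L2sq (\<lambda>x. g x - g' x) \<le> 2 * 0 + 2 * 0"
    by (intro tendsto_lowerbound[of _ _ at_top]) auto
  then have "L2sq (\<lambda>x. g x - g' x) = 0" by simp
  then have "AE x in lborel. ennreal ((norm (g x - g' x))\<^sup>2) = 0"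
    by (subst (asm) nn_integral_0_iff_AE) auto
  then show ?thesis by (rule AE_mp) (intro always_eventually, auto)
qed

text \<open>The Riesz-Fischer argument, for a family indexed by the real parameter that tends to infinity.\<close>

lemma L2_complete:
  fixes F :: "real \<Rightarrow> real \<Rightarrow> 'a::euclidean_space"
  assumes F: "\<And>R. square_integrable (F R)"
    and Cauchy: "\<And>e. e > 0 \<Longrightarrow> \<exists>R0. \<forall>R\<ge>R0. \<forall>S\<ge>R0. L2sq (\<lambda>x. F R x - F S x) \<le> ennreal e"
  shows "\<exists>g. is_L2_limit F g"
proof -
  have [measurable]: "F R \<in> borel_measurable borel" for R using F square_integrable_borel by blast
  (* A sequence along which consecutive differences d n satisfy |d n|^2 <= 4^(-n) in the mean; the weights 2^n
     then leave a convergent series, and |d n| <= (2^n |d n|^2 + 2^(-n)) / 2 makes it converge pointwise. *)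
  have "\<forall>n. \<exists>R0. \<forall>R\<ge>R0. \<forall>S\<ge>R0. L2sq (\<lambda>x. F R x - F S x) \<le> ennreal ((1/4)^n)"
    using Cauchy by auto
  then obtain \<rho> where \<rho>: "\<And>n R S. R \<ge> \<rho> n \<Longrightarrow> S \<ge> \<rho> n \<Longrightarrow> L2sq (\<lambda>x. F R x - F S x) \<le> ennreal ((1/4)^n)"
    by metis
  define r where "r n = (\<Sum>k\<le>n. \<bar>\<rho> k\<bar>)" for n
  have r: "r n \<ge> \<rho> k" if "k \<le> n" for n k
  proof -
    have "\<bar>\<rho> k\<bar> \<le> r n" unfolding r_def using that by (intro member_le_sum) auto
    then show ?thesis by linarith
  qed
  define d where "d n x = F (r (Suc n)) x - F (r n) x" for n x
  have [measurable]: "d n \<in> borel_measurable borel" for n unfolding d_def by measurable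
  have "(\<integral>\<^sup>+x. (\<Sum>n. ennreal (2^n * (norm (d n x))\<^sup>2)) \<partial>lborel) = (\<Sum>n. \<integral>\<^sup>+x. ennreal (2^n * (norm (d n x))\<^sup>2) \<partial>lborel)"
    by (rule nn_integral_suminf) measurable
  also have "\<dots> \<le> (\<Sum>n. ennreal ((1/2)^n))"
  proof (intro suminf_le allI)
    fix n
    have "(\<integral>\<^sup>+x. ennreal (2^n * (norm (d n x))\<^sup>2) \<partial>lborel) = ennreal (2^n) * L2sq (d n)"
      by (simp add: ennreal_mult nn_integral_cmult)
    also have "\<dots> \<le> ennreal (2^n) * ennreal ((1/4)^n)"
      unfolding d_def by (intro mult_left_mono \<rho> r) auto
    also have "\<dots> = ennreal ((1/2)^n)" by (simp flip: ennreal_mult power_mult_distrib)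
    finally show "(\<integral>\<^sup>+x. ennreal (2^n * (norm (d n x))\<^sup>2) \<partial>lborel) \<le> ennreal ((1/2)^n)" .
  qed auto
  also have "\<dots> < \<infinity>"
    by (subst suminf_ennreal2) (auto intro: summable_geometric)
  finally have fin: "(\<integral>\<^sup>+x. (\<Sum>n. ennreal (2^n * (norm (d n x))\<^sup>2)) \<partial>lborel) \<noteq> \<infinity>" by simp
  have "AE x in lborel. (\<Sum>n. ennreal (2^n * (norm (d n x))\<^sup>2)) \<noteq> \<infinity>"
    by (rule nn_integral_PInf_AE[OF _ fin]) measurable
  then have conv: "AE x in lborel. convergent (\<lambda>n. F (r n) x)"
  proof (rule AE_mp, intro always_eventually allI impI)
    fix x assume "(\<Sum>n. ennreal (2^n * (norm (d n x))\<^sup>2)) \<noteq> \<infinity>"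
    then have "summable (\<lambda>n. 2^n * (norm (d n x))\<^sup>2)"
      by (intro summable_suminf_not_top) auto
    then have "summable (\<lambda>n. (2^n * (norm (d n x))\<^sup>2 + (1/2)^n) / 2)"
      by (intro summable_divide summable_add summable_geometric) auto
    moreover have "norm (d n x) \<le> (2^n * (norm (d n x))\<^sup>2 + (1/2)^n) / 2" for n
    proof -
      have "0 \<le> (2^n * norm (d n x) - 1)\<^sup>2" by simp
      then have "2 * (2^n * norm (d n x)) \<le> 2^n * (2^n * (norm (d n x))\<^sup>2) + 1"
        by (simp add: power2_eq_square algebra_simps)
      then show ?thesis by (simp add: power_divide field_simps)
    qed
    ultimately have "summable (\<lambda>n. d n x)"
      by (rule summable_comparison_test'[where N=0])
    then have "convergent (\<lambda>n. (\<Sum>k<n. d k x))" by (simp add: summable_iff_convergent)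
    then have "convergent (\<lambda>n. (\<Sum>k<n. d k x) + F (r 0) x)" by (intro convergent_add convergent_const)
    moreover have "(\<Sum>k<n. d k x) + F (r 0) x = F (r n) x" for n
      using sum_lessThan_telescope[of "\<lambda>n. F (r n) x" n] by (simp add: d_def)
    ultimately show "convergent (\<lambda>n. F (r n) x)" by simp
  qed
  define g where "g x = lim (\<lambda>n. F (r n) x)" for x
  have [measurable]: "g \<in> borel_measurable borel" unfolding g_def by measurable
  have bound: "L2sq (\<lambda>x. F R x - g x) \<le> ennreal ((1/4)^k)" if R: "R \<ge> \<rho> k" for R k
  proof -
    have "AE x in lborel. ennreal ((norm (F R x - g x))\<^sup>2) = liminf (\<lambda>n. ennreal ((norm (F R x - F (r n) x))\<^sup>2))"
      using conv
    proof (rule AE_mp, intro always_eventually allI impI)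
      fix x assume "convergent (\<lambda>n. F (r n) x)"
      then have "(\<lambda>n. F (r n) x) \<longlonglongrightarrow> g x" unfolding g_def by (simp add: convergent_LIMSEQ_iff)
      then have "(\<lambda>n. ennreal ((norm (F R x - F (r n) x))\<^sup>2)) \<longlonglongrightarrow> ennreal ((norm (F R x - g x))\<^sup>2)"
        by (intro tendsto_ennrealI tendsto_intros)
      then show "ennreal ((norm (F R x - g x))\<^sup>2) = liminf (\<lambda>n. ennreal ((norm (F R x - F (r n) x))\<^sup>2))"
        by (metis lim_imp_Liminf trivial_limit_sequentially)
    qed
    then have "L2sq (\<lambda>x. F R x - g x) = (\<integral>\<^sup>+x. liminf (\<lambda>n. ennreal ((norm (F R x - F (r n) x))\<^sup>2)) \<partial>lborel)"
      by (rule nn_integral_cong_AE)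
    also have "\<dots> \<le> liminf (\<lambda>n. L2sq (\<lambda>x. F R x - F (r n) x))"
      by (rule nn_integral_liminf) measurable
    also have "\<dots> \<le> liminf (\<lambda>n::nat. ennreal ((1/4)^k))"
      by (intro Liminf_mono eventually_mono[OF eventually_ge_at_top[of k]] \<rho> r R)
    finally show ?thesis by (simp add: Liminf_const)
  qed
  have "square_integrable g"
  proof -
    have "square_integrable (\<lambda>x. F (\<rho> 0) x - g x)"
      using bound[of 0 "\<rho> 0"] unfolding square_integrable_iff_L2sq by (auto intro: le_less_trans)
    from square_integrable_diff[OF F[of "\<rho> 0"] this] show ?thesis by simp
  qed
  moreover have "((\<lambda>R. L2sq (\<lambda>x. F R x - g x)) \<longlongrightarrow> 0) at_top"
  proof (rule order_tendstoI)
    fix a :: ennreal assume a: "a > 0"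
    have "(\<lambda>k. ennreal ((1/4)^k)) \<longlonglongrightarrow> ennreal 0"
      by (intro tendsto_ennrealI LIMSEQ_realpow_zero) auto
    then have "eventually (\<lambda>k. ennreal ((1/4)^k) < a) sequentially"
      using a by (intro order_tendstoD(2)) auto
    then obtain k where k: "ennreal ((1/4)^k) < a" by (auto simp: eventually_sequentially)
    show "\<forall>\<^sub>F R in at_top. L2sq (\<lambda>x. F R x - g x) < a"
      using eventually_ge_at_top[of "\<rho> k"] by eventually_elim (use bound[of k] k in \<open>auto intro: le_less_trans\<close>)
  qed auto
  ultimately show ?thesis unfolding is_L2_limit_def by blast
qed

lemma integrable_mult_square_integrable:
  fixes f g :: "real \<Rightarrow> complex"
  assumes "square_integrable f" "square_integrable g"
  shows "integrable lborel (\<lambda>x. f x * g x)"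
proof (rule Bochner_Integration.integrable_bound[where f="\<lambda>x. (norm (f x))\<^sup>2 + (norm (g x))\<^sup>2"])
  show "integrable lborel (\<lambda>x. (norm (f x))\<^sup>2 + (norm (g x))\<^sup>2)" using assms by (simp add: square_integrable_def)
  have [measurable]: "f \<in> borel_measurable borel" "g \<in> borel_measurable borel"
    using assms by (auto simp: square_integrable_borel)
  show "(\<lambda>x. f x * g x) \<in> borel_measurable lborel" by measurable
  have "norm (f x) * norm (g x) \<le> (norm (f x))\<^sup>2 + (norm (g x))\<^sup>2" for x
    using sum_squares_bound[of "norm (f x)" "norm (g x)"] zero_le_power2[of "norm (f x)"] zero_le_power2[of "norm (g x)"]
      mult_nonneg_nonneg[of "norm (f x)" "norm (g x)"] by linarith
  then show "AE x in lborel. norm (f x * g x) \<le> norm ((norm (f x))\<^sup>2 + (norm (g x))\<^sup>2)"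
    by (simp add: norm_mult)
qed

text \<open>The weighted inequality \<open>\<bar>\<psi> d\<bar> \<le> \<eta>/2 \<bar>\<psi>\<bar>\<^sup>2 + \<bar>d\<bar>\<^sup>2 / (2\<eta>)\<close> bounds the error of the pairing by \<open>\<eta> \<parallel>\<psi>\<parallel>\<^sup>2 / 2\<close> plus a term that tends to zero for every fixed \<open>\<eta>\<close>.\<close>

lemma L2_pairing_tendsto:
  fixes G :: "real \<Rightarrow> real \<Rightarrow> complex"
  assumes lim: "is_L2_limit G g" and G: "\<And>R. square_integrable (G R)" and \<psi>: "square_integrable \<psi>"
  shows "((\<lambda>R. \<integral>x. \<psi> x * G R x \<partial>lborel) \<longlongrightarrow> (\<integral>x. \<psi> x * g x \<partial>lborel)) at_top"
proof (rule tendstoI)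
  have g: "square_integrable g" using lim by (simp add: is_L2_limit_def)
  define M where "M = (\<integral>x. (norm (\<psi> x))\<^sup>2 \<partial>lborel) + 1"
  have M: "M \<ge> 1" by (simp add: M_def)
  fix e :: real assume e: "e > 0"
  define h where "h = e / M"
  have h: "h > 0" using e M by (simp add: h_def)
  define a where "a R = (\<integral>x. (norm (G R x - g x))\<^sup>2 \<partial>lborel)" for R
  have int: "integrable lborel (\<lambda>x. (norm (G R x - g x))\<^sup>2)" for R
    using square_integrable_diff[OF G g] by (simp add: square_integrable_def)
  have "L2sq (\<lambda>x. G R x - g x) = ennreal (a R)" for R
    unfolding a_def by (rule nn_integral_eq_integral[OF int]) simp
  then have "((\<lambda>R. ennreal (a R)) \<longlongrightarrow> ennreal 0) at_top" using lim by (simp add: is_L2_limit_def)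
  then have "\<forall>\<^sub>F R in at_top. ennreal (a R) < ennreal (h * e)"
    using e h by (intro order_tendstoD(2)) auto
  then show "\<forall>\<^sub>F R in at_top. dist (\<integral>x. \<psi> x * G R x \<partial>lborel) (\<integral>x. \<psi> x * g x \<partial>lborel) < e"
  proof eventually_elim
    fix R assume "ennreal (a R) < ennreal (h * e)"
    then have aR: "a R < h * e" using e h by (simp add: ennreal_less_iff a_def)
    have "dist (\<integral>x. \<psi> x * G R x \<partial>lborel) (\<integral>x. \<psi> x * g x \<partial>lborel) = norm (\<integral>x. \<psi> x * (G R x - g x) \<partial>lborel)"
      using integrable_mult_square_integrable[OF \<psi> G[of R]] integrable_mult_square_integrable[OF \<psi> g]
      by (simp add: dist_norm algebra_simps)
    also have "\<dots> \<le> (\<integral>x. norm (\<psi> x * (G R x - g x)) \<partial>lborel)" by (rule integral_norm_bound)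
    also have "\<dots> \<le> (\<integral>x. h / 2 * (norm (\<psi> x))\<^sup>2 + 1 / (2 * h) * (norm (G R x - g x))\<^sup>2 \<partial>lborel)"
    proof (rule integral_mono)
      show "integrable lborel (\<lambda>x. norm (\<psi> x * (G R x - g x)))"
        by (intro integrable_norm integrable_mult_square_integrable \<psi> square_integrable_diff G g)
      show "integrable lborel (\<lambda>x. h / 2 * (norm (\<psi> x))\<^sup>2 + 1 / (2 * h) * (norm (G R x - g x))\<^sup>2)"
        using int \<psi> by (simp add: square_integrable_def)
      fix x
      have "0 \<le> (h * norm (\<psi> x) - norm (G R x - g x))\<^sup>2" by simp
      then have "2 * h * (norm (\<psi> x) * norm (G R x - g x)) \<le> h * (h * (norm (\<psi> x))\<^sup>2) + (norm (G R x - g x))\<^sup>2"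
        by (simp add: power2_eq_square algebra_simps)
      then show "norm (\<psi> x * (G R x - g x)) \<le> h / 2 * (norm (\<psi> x))\<^sup>2 + 1 / (2 * h) * (norm (G R x - g x))\<^sup>2"
        unfolding norm_mult using h by (simp add: field_simps)
    qed
    also have "\<dots> = h / 2 * (M - 1) + 1 / (2 * h) * a R"
      using int \<psi> by (simp add: square_integrable_def M_def a_def)
    also have "\<dots> \<le> h / 2 * M + 1 / (2 * h) * a R" using h by (intro add_right_mono mult_left_mono) auto
    also have "\<dots> < e / 2 + 1 / (2 * h) * (h * e)"
      using h M aR e by (intro add_le_less_mono mult_strict_left_mono) (auto simp: h_def)
    also have "\<dots> = e" using h by simp
    finally show "dist (\<integral>x. \<psi> x * G R x \<partial>lborel) (\<integral>x. \<psi> x * g x \<partial>lborel) < e" .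
  qed
qed

section \<open>Test functions\<close>

text \<open>On the line the recursion that defines \<open>Ck_on\<close> may be run with \<open>deriv\<close>, because the Frechet derivative is multiplication by it.\<close>

lemma Ck_on_deriv:
  fixes f :: "real \<Rightarrow> real"
  shows "Ck_on (Suc k) f UNIV \<Longrightarrow> (f has_real_derivative deriv f x) (at x) \<and> Ck_on k (deriv f) UNIV"
proof -
  assume *: "Ck_on (Suc k) f UNIV"
  then have d: "(f has_real_derivative deriv f x) (at x)" for x
    by (auto simp: DERIV_deriv_iff_real_differentiable)
  have "deriv f = (\<lambda>x. frechet_derivative f (at x) 1)"
  proof
    fix x
    have "frechet_derivative f (at x) = (*) (deriv f x)"
      using d[of x] unfolding has_field_derivative_def by (rule frechet_derivative_at[symmetric])
    then show "deriv f x = frechet_derivative f (at x) 1" by simp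
  qed
  then show ?thesis using * d by simp
qed

lemma smooth_on_deriv_pow:
  fixes f :: "real \<Rightarrow> real"
  assumes "smooth_on f UNIV"
  shows "((deriv ^^ n) f has_real_derivative (deriv ^^ Suc n) f x) (at x)"
proof -
  have "\<forall>k. Ck_on k ((deriv ^^ n) f) UNIV"
  proof (induction n)
    case 0 then show ?case using assms by (simp add: smooth_on_def)
  next
    case (Suc n) then show ?case using Ck_on_deriv by (metis comp_apply funpow.simps(2))
  qed
  then have "Ck_on (Suc 0) ((deriv ^^ n) f) UNIV" by blast
  from Ck_on_deriv[OF this] show ?thesis by simp
qed

lemma deriv_pow_zero_outside:
  fixes f :: "real \<Rightarrow> real"
  assumes "closed K" "\<And>x. x \<notin> K \<Longrightarrow> f x = 0" "x \<notin> K"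
  shows "(deriv ^^ n) f x = 0"
  using assms(3)
proof (induction n arbitrary: x)
  case 0 then show ?case using assms(2) by simp
next
  case (Suc n)
  have "open (-K)" using assms(1) by auto
  then have "\<forall>\<^sub>F y in nhds x. y \<in> -K" using Suc.prems by (intro eventually_nhds_in_open) auto
  then have "\<forall>\<^sub>F y in nhds x. (deriv ^^ n) f y = (\<lambda>_. 0) y"
    by eventually_elim (use Suc.IH in auto)
  then have "deriv ((deriv ^^ n) f) x = deriv (\<lambda>_. 0) x" by (rule deriv_cong_ev) simp
  then show ?case by simp
qed

lemma test_function_cases:
  assumes "test_function \<phi>"
  obtains M where "M > 0" "\<And>n x. x \<notin> {-M..M} \<Longrightarrow> (deriv ^^ n) \<phi> x = 0"
    "\<And>n x. ((deriv ^^ n) \<phi> has_real_derivative (deriv ^^ Suc n) \<phi> x) (at x)"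
proof -
  obtain K where K: "compact K" "\<And>x. x \<notin> K \<Longrightarrow> \<phi> x = 0" and s: "smooth_on \<phi> UNIV"
    using assms by (auto simp: test_function_def)
  obtain M where M: "M > 0" "\<And>x. x \<in> K \<Longrightarrow> norm x \<le> M"
    using compact_imp_bounded[OF K(1)] bounded_pos by blast
  show ?thesis
  proof (rule that[OF M(1)])
    fix n x assume "x \<notin> {-M..M}"
    then have "x \<notin> K" using M(2)[of x] by auto
    then show "(deriv ^^ n) \<phi> x = 0" using deriv_pow_zero_outside[of K \<phi>, OF compact_imp_closed[OF K(1)] K(2)] by blast
  qed (rule smooth_on_deriv_pow[OF s])
qed

lemma Ck_on_reduce:
  fixes f :: "real \<Rightarrow> real"
  shows "Ck_on (Suc k) f UNIV \<Longrightarrow> Ck_on k f UNIV"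
proof (induction k arbitrary: f)
  case 0
  then show ?case
    by (auto intro!: continuous_at_imp_continuous_on differentiable_imp_continuous_within)
next
  case (Suc k)
  then show ?case by (metis Ck_on.simps(2))
qed

lemma Ck_on_SucI:
  fixes f :: "real \<Rightarrow> real"
  assumes "\<And>x. (f has_real_derivative f' x) (at x)" "\<And>v. Ck_on k (\<lambda>x. f' x * v) UNIV"
  shows "Ck_on (Suc k) f UNIV"
proof -
  have "frechet_derivative f (at x) = (*) (f' x)" for x
    using assms(1)[of x] unfolding has_field_derivative_def by (rule frechet_derivative_at[symmetric])
  then show ?thesis using assms by (auto simp: real_differentiable_def)
qed

lemma Ck_on_cmult:
  fixes f :: "real \<Rightarrow> real"
  shows "Ck_on k f UNIV \<Longrightarrow> Ck_on k (\<lambda>x. f x * c) UNIV"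
proof (induction k arbitrary: f c)
  case 0 then show ?case by (auto intro!: continuous_intros)
next
  case (Suc k)
  note d = Ck_on_deriv[OF Suc.prems]
  show ?case
  proof (rule Ck_on_SucI)
    show "((\<lambda>x. f x * c) has_real_derivative deriv f x * c) (at x)" for x
      using d by (auto intro!: derivative_eq_intros)
    show "Ck_on k (\<lambda>x. deriv f x * c * v) UNIV" for v
      using Suc.IH[of "deriv f" "c * v"] d by (simp add: mult.assoc)
  qed
qed

lemma Ck_on_add:
  fixes f :: "real \<Rightarrow> real"
  shows "Ck_on k f UNIV \<Longrightarrow> Ck_on k g UNIV \<Longrightarrow> Ck_on k (\<lambda>x. f x + g x) UNIV"
proof (induction k arbitrary: f g)
  case 0 then show ?case by (auto intro!: continuous_intros)
next
  case (Suc k)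
  note d = Ck_on_deriv[OF Suc.prems(1)] Ck_on_deriv[OF Suc.prems(2)]
  show ?case
  proof (rule Ck_on_SucI)
    show "((\<lambda>x. f x + g x) has_real_derivative deriv f x + deriv g x) (at x)" for x
      using d by (auto intro!: derivative_eq_intros)
    show "Ck_on k (\<lambda>x. (deriv f x + deriv g x) * v) UNIV" for v
      using Suc.IH d by (intro Ck_on_cmult) auto
  qed
qed

lemma Ck_on_mult:
  fixes f :: "real \<Rightarrow> real"
  shows "Ck_on k f UNIV \<Longrightarrow> Ck_on k g UNIV \<Longrightarrow> Ck_on k (\<lambda>x. f x * g x) UNIV"
proof (induction k arbitrary: f g)
  case 0 then show ?case by (auto intro!: continuous_intros)
next
  case (Suc k)
  note d = Ck_on_deriv[OF Suc.prems(1)] Ck_on_deriv[OF Suc.prems(2)]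
  show ?case
  proof (rule Ck_on_SucI)
    show "((\<lambda>x. f x * g x) has_real_derivative deriv f x * g x + f x * deriv g x) (at x)" for x
      using d by (auto intro!: derivative_eq_intros)
    show "Ck_on k (\<lambda>x. (deriv f x * g x + f x * deriv g x) * v) UNIV" for v
      using Suc.IH d Suc.prems[THEN Ck_on_reduce] by (intro Ck_on_cmult Ck_on_add) auto
  qed
qed

text \<open>The functions \<open>p(1/x) exp(-c/x)\<close>, extended by zero to \<open>x \<le> 0\<close>. Polynomials \<open>p\<close> are included so that the class is closed under differentiation.\<close>

definition flat :: "real \<Rightarrow> real poly \<Rightarrow> real \<Rightarrow> real" where
  "flat c p x = (if x > 0 then poly p (1 / x) * exp (- c / x) else 0)"

lemma poly_exp_tendsto_0:
  assumes c: "c > 0"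
  shows "((\<lambda>y. poly p y * exp (- c * y)) \<longlongrightarrow> (0::real)) at_top"
proof (induction p)
  case 0 then show ?case by simp
next
  case (pCons a p)
  have "((\<lambda>y. y ^ n * exp (- c * y)) \<longlongrightarrow> (0::real)) at_top" for n
    using c by real_asymp
  then have "((\<lambda>y. \<Sum>i\<le>degree (pCons a p). coeff (pCons a p) i * (y ^ i * exp (- c * y))) \<longlongrightarrow> (\<Sum>i\<le>degree (pCons a p). coeff (pCons a p) i * 0)) at_top"
    by (intro tendsto_intros)
  then show ?case by (simp add: poly_altdef sum_distrib_right mult.assoc del: poly_pCons)
qed

lemma flat_tendsto_0:
  assumes c: "c > 0"
  shows "((\<lambda>x. poly p (1 / x) * exp (- c / x)) \<longlongrightarrow> (0::real)) (at_right 0)"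
  using filterlim_compose[OF poly_exp_tendsto_0[OF c, of p] filterlim_inverse_at_top_right]
  by (simp add: field_simps inverse_eq_divide)

text \<open>The exponential beats every power of \<open>1/x\<close> as \<open>x\<close> decreases to zero, so the two pieces also match at the origin.\<close>

lemma flat_deriv:
  assumes c: "c > 0"
  shows "(flat c p has_real_derivative flat c ([:0,0,1:] * (smult c p - pderiv p)) x) (at x)"
proof -
  consider "x > 0" | "x < 0" | "x = 0" by linarith
  then show ?thesis
  proof cases
    case 1
    have "((\<lambda>x. poly p (1 / x) * exp (- c / x)) has_real_derivative flat c ([:0,0,1:] * (smult c p - pderiv p)) x) (at x)"
      unfolding flat_def using 1
      by (auto intro!: derivative_eq_intros DERIV_chain'[OF _ poly_DERIV] simp: field_simps power2_eq_square)
    moreover have "\<forall>\<^sub>F y in nhds x. flat c p y = poly p (1 / y) * exp (- c / y)"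
      using eventually_nhds_in_open[of "{0<..}" x] 1 by (auto elim!: eventually_mono simp: flat_def)
    ultimately show ?thesis using 1 by (subst DERIV_cong_ev[OF refl _ refl]) auto
  next
    case 2
    have "\<forall>\<^sub>F y in nhds x. flat c p y = (\<lambda>_. 0) y"
      using eventually_nhds_in_open[of "{..<0}" x] 2 by (auto elim!: eventually_mono simp: flat_def)
    then show ?thesis using 2 by (subst DERIV_cong_ev[OF refl _ refl]) (auto simp: flat_def)
  next
    case 3
    have "((\<lambda>h. flat c p h / h) \<longlongrightarrow> 0) (at 0)"
      unfolding filterlim_at_split
    proof
      have "\<forall>\<^sub>F h in at_left 0. flat c p h / h = 0"
        by (auto simp: flat_def eventually_at_left_field intro!: exI[of _ "-1"])
      then show "((\<lambda>h. flat c p h / h) \<longlongrightarrow> 0) (at_left 0)" by (simp add: tendsto_eventually)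
      have "\<forall>\<^sub>F h in at_right 0. poly ([:0,1:] * p) (1 / h) * exp (- c / h) = flat c p h / h"
        by (auto simp: flat_def eventually_at_right_field intro!: exI[of _ "1"])
      then show "((\<lambda>h. flat c p h / h) \<longlongrightarrow> 0) (at_right 0)"
        using flat_tendsto_0[OF c, of "[:0,1:] * p"] by (rule Lim_transform_eventually[rotated])
    qed
    then show ?thesis using 3 by (simp add: DERIV_def flat_def)
  qed
qed

lemma Ck_on_flat: "c > 0 \<Longrightarrow> Ck_on k (\<lambda>x. flat c p (s * x + a)) UNIV"
proof (induction k arbitrary: p)
  case 0
  have "isCont (\<lambda>x. flat c p (s * x + a)) x" for x
    by (intro isCont_o2[OF _ DERIV_isCont[OF flat_deriv[OF 0]]] continuous_intros)
  then show ?case by (auto intro: continuous_at_imp_continuous_on)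
next
  case (Suc k)
  show ?case
  proof (rule Ck_on_SucI)
    show "((\<lambda>x. flat c p (s * x + a)) has_real_derivative flat c ([:0,0,1:] * (smult c p - pderiv p)) (s * x + a) * s) (at x)" for x
      by (intro DERIV_chain'[OF _ flat_deriv[OF Suc.prems]]) (auto intro!: derivative_eq_intros)
    show "Ck_on k (\<lambda>x. flat c ([:0,0,1:] * (smult c p - pderiv p)) (s * x + a) * s * v) UNIV" for v
      by (intro Ck_on_cmult Suc)
  qed
qed

text \<open>For small \<open>c\<close> these functions, supported in \<open>[a, b]\<close>, approximate the indicator of the interval. The arguments are written as \<open>s * x + a\<close> to fit \<open>Ck_on_flat\<close>.\<close>

definition bump :: "real \<Rightarrow> real \<Rightarrow> real \<Rightarrow> real \<Rightarrow> real" where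
  "bump a b c x = flat c 1 (1 * x + (-a)) * flat c 1 ((-1) * x + b)"

lemma test_function_bump: "c > 0 \<Longrightarrow> test_function (bump a b c)"
  unfolding test_function_def
proof
  assume "c > 0"
  then show "smooth_on (bump a b c) UNIV"
    unfolding smooth_on_def bump_def by (intro allI Ck_on_mult Ck_on_flat)
  show "\<exists>K. compact K \<and> (\<forall>x. x \<notin> K \<longrightarrow> bump a b c x = 0)"
    by (rule exI[of _ "{a..b}"]) (auto simp: bump_def flat_def)
qed

lemma bump_tendsto: "(\<lambda>n. bump a b (inverse (real (Suc n))) x) \<longlonglongrightarrow> indicator {a<..<b} x"
proof (cases "x \<in> {a<..<b}")
  case True
  have "(\<lambda>n. exp (- inverse (real (Suc n)) / (x - a)) * exp (- inverse (real (Suc n)) / (b - x))) \<longlonglongrightarrow> exp (- 0 / (x - a)) * exp (- 0 / (b - x))"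
    using True by (intro tendsto_intros LIMSEQ_inverse_real_of_nat) auto
  then show ?thesis using True by (simp add: bump_def flat_def)
qed (auto simp: bump_def flat_def)

lemma bump_le: "c > 0 \<Longrightarrow> \<bar>bump a b c x\<bar> \<le> indicator {a..b} x"
  by (auto simp: bump_def flat_def indicator_def mult_le_one)

section \<open>The fundamental lemma of the calculus of variations\<close>

text \<open>Intervals are stable under intersection and generate the Borel sets, so all integrals over Borel sets vanish, in particular those over the sets where \<open>f > 0\<close> and where \<open>f < 0\<close>.\<close>

lemma AE_zero_if_interval_integrals_zero:
  fixes f :: "real \<Rightarrow> real"
  assumes f: "integrable lborel f" and z: "\<And>a b. (\<integral>x. indicator {a<..<b} x * f x \<partial>lborel) = 0"
  shows "AE x in lborel. f x = 0"
proof -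
  have [measurable]: "f \<in> borel_measurable borel" using f by simp
  have sint: "set_integrable lborel A f" if "A \<in> sets borel" for A
    using that f unfolding set_integrable_def by (intro integrable_mult_indicator) auto
  have all: "(\<integral>x. f x \<partial>lborel) = 0"
  proof -
    have "(\<lambda>n. \<integral>x. indicator {-real n<..<real n} x * f x \<partial>lborel) \<longlonglongrightarrow> (\<integral>x. f x \<partial>lborel)"
    proof (rule integral_dominated_convergence[where w="\<lambda>x. \<bar>f x\<bar>"])
      show "AE x in lborel. (\<lambda>n. indicator {-real n<..<real n} x * f x) \<longlonglongrightarrow> f x"
      proof (intro always_eventually allI)
        fix x :: real
        obtain N :: nat where N: "\<bar>x\<bar> < real N" using reals_Archimedean2 by blast
        have "\<forall>\<^sub>F n in sequentially. indicator {-real n<..<real n} x * f x = f x"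
          using eventually_ge_at_top[of N] by eventually_elim (use N in \<open>auto simp: indicator_def\<close>)
        then show "(\<lambda>n. indicator {-real n<..<real n} x * f x) \<longlonglongrightarrow> f x" by (rule tendsto_eventually)
      qed
    qed (use f in \<open>auto simp: indicator_def\<close>)
    then show ?thesis using LIMSEQ_unique[OF _ tendsto_const] by (simp add: z)
  qed
  have gen: "sets borel = sigma_sets UNIV (range (\<lambda>(a, b). box a b :: real set))"
    by (subst borel_eq_box) simp
  have zero: "(LINT x:A|lborel. f x) = 0" if "A \<in> sets borel" for A
  proof -
    have "Int_stable (range (\<lambda>(a, b). box a b :: real set))"
    proof (rule Int_stableI)
      fix A B assume "A \<in> range (\<lambda>(a, b). box a b :: real set)" "B \<in> range (\<lambda>(a, b). box a b :: real set)"
      then obtain a b c d where "A = {a<..<b}" "B = {c<..<d}" by (auto simp: box_real)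
      then have "A \<inter> B = box (max a c) (min b d)" by (auto simp: box_real)
      then show "A \<inter> B \<in> range (\<lambda>(a, b). box a b :: real set)" by auto
    qed
    moreover have "range (\<lambda>(a, b). box a b :: real set) \<subseteq> Pow UNIV" by simp
    moreover have "A \<in> sigma_sets UNIV (range (\<lambda>(a, b). box a b :: real set))" using that gen by simp
    ultimately show ?thesis
  proof (induction rule: sigma_sets_induct_disjoint)
    case (basic A) then show ?case using z by (auto simp: set_lebesgue_integral_def box_real)
  next
    case empty then show ?case by (simp add: set_lebesgue_integral_def)
  next
    case (compl A)
    then have A: "A \<in> sets borel" by (simp add: gen)
    have "(LINT x:A \<union> (UNIV - A)|lborel. f x) = (LINT x:A|lborel. f x) + (LINT x:UNIV - A|lborel. f x)"
      using A by (intro set_integral_Un sint) auto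
    then show ?case using compl all by (simp add: set_lebesgue_integral_def)
  next
    case (union A)
    then have A: "range A \<subseteq> sets borel" by (simp add: gen)
    then have "(LINT x:(\<Union>i. A i)|lborel. f x) = (\<Sum>i. (LINT x:(A i)|lborel. f x))"
      using union(1) by (intro lebesgue_integral_countable_add sint) (auto simp: disjoint_family_on_def)
    then show ?case using union by simp
  qed
  qed
  have *: "AE x in lborel. indicator {x. g x > 0} x * g x = 0"
    if [measurable]: "integrable lborel g" and "(LINT x:{x. g x > 0}|lborel. g x) = 0" for g :: "real \<Rightarrow> real"
  proof -
    have [measurable]: "g \<in> borel_measurable borel" using that by simp
    have "{x. g x > 0} \<in> sets borel" by measurable
    then have i: "integrable lborel (\<lambda>x. indicator {x. g x > 0} x * g x)"
      using that(1) integrable_mult_indicator[of "{x. g x > 0}" lborel g] by simp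
    show ?thesis
      using that(2) integral_nonneg_eq_0_iff_AE[OF i] by (auto simp: set_lebesgue_integral_def indicator_def)
  qed
  have "AE x in lborel. indicator {x. f x > 0} x * f x = 0"
    using f by (intro * zero) measurable
  moreover have "AE x in lborel. indicator {x. - f x > 0} x * (- f x) = 0"
  proof (intro *)
    have "{x. - f x > 0} \<in> sets borel" by measurable
    from zero[OF this] show "(LINT x:{x. - f x > 0}|lborel. - f x) = 0" by (simp add: set_lebesgue_integral_def)
  qed (use f in simp)
  ultimately show ?thesis
    by eventually_elim (auto simp: indicator_def split: if_splits)
qed

text \<open>Bump functions converge boundedly to the indicator of an interval.\<close>

lemma AE_zero_if_test_integrals_zero:
  fixes f :: "real \<Rightarrow> real"
  assumes f: "locally_integrable f" and z: "\<And>\<phi>. test_function \<phi> \<Longrightarrow> (\<integral>x. \<phi> x * f x \<partial>lborel) = 0"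
  shows "AE x in lborel. f x = 0"
proof -
  have [measurable]: "f \<in> borel_measurable borel" using f by (simp add: locally_integrable_def)
  have loc: "integrable lborel (\<lambda>x. indicator {a..b} x * f x)" for a b
    using f compact_Icc[of a b] by (auto simp: locally_integrable_def set_integrable_def)
  have bm: "bump a b c \<in> borel_measurable borel" for a b c
    unfolding bump_def flat_def poly_1 by measurable
  have int0: "(\<integral>x. indicator {a<..<b} x * f x \<partial>lborel) = 0" for a b
  proof -
    have "(\<lambda>n. \<integral>x. bump a b (inverse (real (Suc n))) x * f x \<partial>lborel) \<longlonglongrightarrow> (\<integral>x. indicator {a<..<b} x * f x \<partial>lborel)"
    proof (rule integral_dominated_convergence[where w="\<lambda>x. \<bar>indicator {a..b} x * f x\<bar>"])
      show "integrable lborel (\<lambda>x. \<bar>indicator {a..b} x * f x\<bar>)" using loc by (intro integrable_abs)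
      show "AE x in lborel. (\<lambda>n. bump a b (inverse (real (Suc n))) x * f x) \<longlonglongrightarrow> indicator {a<..<b} x * f x"
        by (intro always_eventually allI tendsto_intros bump_tendsto)
      show "AE x in lborel. norm (bump a b (inverse (real (Suc n))) x * f x) \<le> \<bar>indicator {a..b} x * f x\<bar>" for n
        unfolding real_norm_def abs_mult
        by (intro always_eventually allI mult_right_mono order_trans[OF bump_le]) auto
    qed (use bm in auto)
    moreover have "(\<integral>x. bump a b (inverse (real (Suc n))) x * f x \<partial>lborel) = 0" for n
      by (intro z test_function_bump) simp
    ultimately show ?thesis using LIMSEQ_unique[OF _ tendsto_const] by simp
  qed
  have "AE x in lborel. indicator {-real n..real n} x * f x = 0" for n
  proof (rule AE_zero_if_interval_integrals_zero[OF loc])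
    fix a b
    have "AE x in lborel. x \<noteq> -real n" "AE x in lborel. x \<noteq> real n" by (rule AE_lborel_singleton)+
    then have "AE x in lborel. indicator {a<..<b} x * (indicator {-real n..real n} x * f x) = indicator {max a (-real n)<..<min b (real n)} x * f x"
      by eventually_elim (auto simp: indicator_def)
    then have "(\<integral>x. indicator {a<..<b} x * (indicator {-real n..real n} x * f x) \<partial>lborel) = (\<integral>x. indicator {max a (-real n)<..<min b (real n)} x * f x \<partial>lborel)"
      by (intro integral_cong_AE) auto
    then show "(\<integral>x. indicator {a<..<b} x * (indicator {-real n..real n} x * f x) \<partial>lborel) = 0" by (simp add: int0)
  qed
  then have "AE x in lborel. \<forall>n. indicator {-real n..real n} x * f x = 0" unfolding AE_all_countable by blast
  then show ?thesis
  proof eventually_elim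
    case (elim x)
    obtain N :: nat where N: "\<bar>x\<bar> < real N" using reals_Archimedean2 by blast
    with elim[rule_format, of N] show ?case by (auto simp: indicator_def split: if_splits)
  qed
qed

lemma locally_integrable_bounded_linear:
  assumes "bounded_linear T" "locally_integrable f"
  shows "locally_integrable (\<lambda>x. T (f x))"
  unfolding locally_integrable_def
proof safe
  interpret T: bounded_linear T by fact
  show "(\<lambda>x. T (f x)) \<in> borel_measurable lborel"
    using assms(2) borel_measurable_continuous_on[OF T.continuous_on[OF continuous_on_id]]
    by (auto simp: locally_integrable_def)
  fix K :: "real set" assume "compact K"
  then have "integrable lborel (\<lambda>x. T (indicator K x *\<^sub>R f x))"
    using assms(2) by (intro integrable_bounded_linear[OF assms(1)]) (simp add: locally_integrable_def set_integrable_def)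
  then show "set_integrable lborel K (\<lambda>x. T (f x))" by (simp add: set_integrable_def T.scaleR)
qed

lemma test_function_integrable:
  assumes "test_function \<phi>" "locally_integrable (f :: real \<Rightarrow> 'a::euclidean_space)"
  shows "integrable lborel (\<lambda>x. (deriv ^^ n) \<phi> x *\<^sub>R f x)"
proof -
  obtain M where M: "M > 0" "\<And>n x. x \<notin> {-M..M} \<Longrightarrow> (deriv ^^ n) \<phi> x = 0"
    "\<And>n x. ((deriv ^^ n) \<phi> has_real_derivative (deriv ^^ Suc n) \<phi> x) (at x)"
    using test_function_cases[OF assms(1)] by blast
  have c: "continuous_on UNIV ((deriv ^^ n) \<phi>)" using M(3) DERIV_isCont continuous_at_imp_continuous_on by blast
  then have [measurable]: "(deriv ^^ n) \<phi> \<in> borel_measurable borel" by (rule borel_measurable_continuous_onI)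
  have "compact ((deriv ^^ n) \<phi> ` {-M..M})" using c by (intro compact_continuous_image) (auto intro: continuous_on_subset)
  then obtain B where B: "\<And>x. x \<in> {-M..M} \<Longrightarrow> norm ((deriv ^^ n) \<phi> x) \<le> B"
    using compact_imp_bounded bounded_iff by (metis image_eqI)
  have B0: "0 \<le> B" using B[of 0] M(1) norm_ge_zero order_trans by fastforce
  have [measurable]: "f \<in> borel_measurable borel" using assms(2) by (simp add: locally_integrable_def)
  show ?thesis
  proof (rule Bochner_Integration.integrable_bound[where f="\<lambda>x. B * norm (indicator {-M..M} x *\<^sub>R f x)"])
    show "integrable lborel (\<lambda>x. B * norm (indicator {-M..M} x *\<^sub>R f x))"
      using assms(2) compact_Icc[of "-M" M] by (intro integrable_mult_right integrable_norm) (auto simp: locally_integrable_def set_integrable_def)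
    show "AE x in lborel. norm ((deriv ^^ n) \<phi> x *\<^sub>R f x) \<le> norm (B * norm (indicator {-M..M} x *\<^sub>R f x))"
    proof (intro always_eventually allI)
      fix x show "norm ((deriv ^^ n) \<phi> x *\<^sub>R f x) \<le> norm (B * norm (indicator {-M..M} x *\<^sub>R f x))"
        using B[of x] B0 M(2)[of x n] by (cases "x \<in> {-M..M}") (auto simp: abs_mult intro!: mult_right_mono)
    qed
  qed measurable
qed

lemma du_Bois_Reymond:
  fixes f :: "real \<Rightarrow> 'a::euclidean_space"
  assumes f: "locally_integrable f" and z: "\<And>\<phi>. test_function \<phi> \<Longrightarrow> (\<integral>x. \<phi> x *\<^sub>R f x \<partial>lborel) = 0"
  shows "AE x in lborel. f x = 0"
proof -
  have "AE x in lborel. \<forall>b\<in>Basis. f x \<bullet> b = 0"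
  proof (subst AE_finite_all, safe)
    fix b :: 'a assume "b \<in> Basis"
    show "AE x in lborel. f x \<bullet> b = 0"
    proof (rule AE_zero_if_test_integrals_zero)
      show "locally_integrable (\<lambda>x. f x \<bullet> b)"
        by (rule locally_integrable_bounded_linear[OF bounded_linear_inner_left f])
      fix \<phi> assume t: "test_function \<phi>"
      then have "integrable lborel (\<lambda>x. \<phi> x *\<^sub>R f x)" using test_function_integrable[OF t f, of 0] by simp
      then have "(\<integral>x. (\<phi> x *\<^sub>R f x) \<bullet> b \<partial>lborel) = (\<integral>x. \<phi> x *\<^sub>R f x \<partial>lborel) \<bullet> b"
        by (intro integral_inner_left)
      then show "(\<integral>x. \<phi> x * (f x \<bullet> b) \<partial>lborel) = 0"
        using z[OF t] by simp
    qed
  qed auto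
  then show ?thesis by eventually_elim (simp add: euclidean_all_zero_iff)
qed

lemma has_weak_derivative_unique:
  fixes f :: "real \<Rightarrow> 'a::euclidean_space"
  assumes "has_weak_derivative l f g" "has_weak_derivative l f g'"
  shows "AE x in lborel. g x = g' x"
proof -
  have li: "locally_integrable g" "locally_integrable g'" using assms by (auto simp: has_weak_derivative_def)
  have "AE x in lborel. g x - g' x = 0"
  proof (rule du_Bois_Reymond)
    show "locally_integrable (\<lambda>x. g x - g' x)"
      using li unfolding locally_integrable_def by (auto intro: set_integral_diff)
    fix \<phi> assume t: "test_function \<phi>"
    have "(-1) ^ l *\<^sub>R (\<integral>x. \<phi> x *\<^sub>R g x \<partial>lborel) = (-1) ^ l *\<^sub>R (\<integral>x. \<phi> x *\<^sub>R g' x \<partial>lborel)"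
      using assms t unfolding has_weak_derivative_def by metis
    then have "(\<integral>x. \<phi> x *\<^sub>R g x \<partial>lborel) = (\<integral>x. \<phi> x *\<^sub>R g' x \<partial>lborel)" by simp
    then show "(\<integral>x. \<phi> x *\<^sub>R (g x - g' x) \<partial>lborel) = 0"
      using test_function_integrable[OF t li(1), of 0] test_function_integrable[OF t li(2), of 0]
      by (simp add: scaleR_diff_right)
  qed
  then show ?thesis by simp
qed

section \<open>The Fourier transform on square integrable functions\<close>

definition trunc :: "real \<Rightarrow> (real \<Rightarrow> complex) \<Rightarrow> real \<Rightarrow> complex" where
  "trunc R f x = indicator {-R..R} x *\<^sub>R f x"

lemma measurable_trunc [measurable]: "f \<in> borel_measurable borel \<Longrightarrow> trunc R f \<in> borel_measurable borel"
  unfolding trunc_def by measurable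

lemma norm_trunc_le: "norm (trunc R f x) \<le> norm (f x)"
  by (simp add: trunc_def indicator_def)

lemma square_integrable_trunc: "square_integrable f \<Longrightarrow> square_integrable (trunc R f)"
proof -
  assume f: "square_integrable f"
  then have "trunc R f \<in> borel_measurable borel" by (intro measurable_trunc square_integrable_borel)
  then show ?thesis using square_integrable_bound[OF f, of "trunc R f" 1] norm_trunc_le by simp
qed

lemma square_integrable_imp_locally_integrable:
  fixes f :: "real \<Rightarrow> 'a::euclidean_space"
  assumes "square_integrable f"
  shows "locally_integrable f"
  unfolding locally_integrable_def
proof safe
  have [measurable]: "f \<in> borel_measurable borel" using assms by (rule square_integrable_borel)
  show "f \<in> borel_measurable lborel" by simp
  fix K :: "real set" assume K: "compact K"
  then have [measurable]: "K \<in> sets borel" by (simp add: borel_compact)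
  have iK: "integrable lborel (indicator K :: real \<Rightarrow> real)"
    using emeasure_compact_finite[OF K] by simp
  show "set_integrable lborel K f" unfolding set_integrable_def
  proof (rule Bochner_Integration.integrable_bound[where f="\<lambda>x. indicator K x + (norm (f x))\<^sup>2"])
    show "integrable lborel (\<lambda>x. indicator K x + (norm (f x))\<^sup>2)"
      using assms iK by (simp add: square_integrable_def)
    have *: "y \<le> 1 + y\<^sup>2" for y :: real
      proof -
      have "2 * y \<le> 1 + y\<^sup>2" using sum_squares_bound[of 1 y] by simp
      moreover have "0 \<le> y\<^sup>2" by simp
      ultimately show ?thesis by linarith
    qed
    have "norm (indicator K x *\<^sub>R f x) \<le> indicator K x + (norm (f x))\<^sup>2" for x
      using *[of "norm (f x)"] by (cases "x \<in> K") simp_all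
    then show "AE x in lborel. norm (indicator K x *\<^sub>R f x) \<le> norm (indicator K x + (norm (f x))\<^sup>2)"
      by (intro always_eventually allI) (metis abs_ge_self order_trans real_norm_def)
  qed measurable
qed

lemma integrable_trunc: "square_integrable f \<Longrightarrow> integrable lborel (trunc R f)"
  using square_integrable_imp_locally_integrable[of f] compact_Icc[of "-R" R]
  unfolding locally_integrable_def set_integrable_def trunc_def by blast

lemma trunc_is_L2_limit:
  assumes f: "square_integrable f"
  shows "is_L2_limit (\<lambda>R. trunc R f) f"
  unfolding is_L2_limit_def
proof
  have [measurable]: "f \<in> borel_measurable borel" using f by (rule square_integrable_borel)
  have "((\<lambda>R. \<integral>x. (norm (trunc R f x - f x))\<^sup>2 \<partial>lborel) \<longlongrightarrow> (\<integral>x. 0 \<partial>(lborel::real measure))) at_top"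
  proof (rule integral_dominated_convergence_at_top[where w="\<lambda>x. (norm (f x))\<^sup>2"])
    show "integrable lborel (\<lambda>x. (norm (f x))\<^sup>2)" using f by (simp add: square_integrable_def)
    show "AE x in lborel. ((\<lambda>R. (norm (trunc R f x - f x))\<^sup>2) \<longlongrightarrow> 0) at_top"
    proof (intro always_eventually allI)
      fix x
      have "\<forall>\<^sub>F R in at_top. (norm (trunc R f x - f x))\<^sup>2 = 0"
        using eventually_ge_at_top[of "\<bar>x\<bar>"] by eventually_elim (auto simp: trunc_def indicator_def)
      then show "((\<lambda>R. (norm (trunc R f x - f x))\<^sup>2) \<longlongrightarrow> 0) at_top" by (rule tendsto_eventually)
    qed
    show "\<forall>\<^sub>F R in at_top. AE x in lborel. norm ((norm (trunc R f x - f x))\<^sup>2) \<le> (norm (f x))\<^sup>2"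
      by (intro always_eventually allI) (simp add: trunc_def indicator_def)
  qed measurable
  moreover have "L2sq (\<lambda>x. trunc R f x - f x) = ennreal (\<integral>x. (norm (trunc R f x - f x))\<^sup>2 \<partial>lborel)" for R
    using square_integrable_diff[OF square_integrable_trunc[OF f] f]
    by (intro nn_integral_eq_integral) (simp_all add: square_integrable_def)
  ultimately show "((\<lambda>R. L2sq (\<lambda>x. trunc R f x - f x)) \<longlongrightarrow> 0) at_top"
    using tendsto_ennrealI by fastforce
qed fact

lemma ft_diff:
  assumes "integrable lborel f" "integrable lborel g"
  shows "ft \<sigma> (\<lambda>x. f x - g x) \<xi> = ft \<sigma> f \<xi> - ft \<sigma> g \<xi>"
proof -
  have "integrable lborel (\<lambda>x. cis (\<sigma> * \<xi> * x) * f x)" "integrable lborel (\<lambda>x. cis (\<sigma> * \<xi> * x) * g x)"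
    using assms by (auto intro: integrable_cis_mult)
  then show ?thesis by (simp add: ft_def algebra_simps scaleR_diff_right)
qed

lemma square_integrable_ft:
  assumes "integrable lborel f" "square_integrable f" "\<bar>\<sigma>\<bar> = 1"
  shows "square_integrable (ft \<sigma> f)"
  using Bessel[OF assms(1,3)] assms(2) measurable_ft[of f \<sigma>]
  unfolding square_integrable_iff_L2sq by (auto intro: le_less_trans)

definition FT :: "real \<Rightarrow> (real \<Rightarrow> complex) \<Rightarrow> real \<Rightarrow> complex" where
  "FT \<sigma> f = L2_limit (\<lambda>R. ft \<sigma> (trunc R f))"

text \<open>By Bessel's inequality the transforms of the truncations inherit the Cauchy property from the truncations.\<close>

lemma FT_is_L2_limit:
  assumes f: "square_integrable f" and \<sigma>: "\<bar>\<sigma>\<bar> = 1"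
  shows "is_L2_limit (\<lambda>R. ft \<sigma> (trunc R f)) (FT \<sigma> f)"
proof -
  have [measurable]: "f \<in> borel_measurable borel" using f by (rule square_integrable_borel)
  have "\<exists>g. is_L2_limit (\<lambda>R. ft \<sigma> (trunc R f)) g"
  proof (rule L2_complete)
    show "square_integrable (ft \<sigma> (trunc R f))" for R
      by (intro square_integrable_ft integrable_trunc square_integrable_trunc f \<sigma>)
    fix e :: real assume e: "e > 0"
    have "((\<lambda>R. L2sq (\<lambda>x. trunc R f x - f x)) \<longlongrightarrow> 0) at_top"
      using trunc_is_L2_limit[OF f] by (simp add: is_L2_limit_def)
    then have "\<forall>\<^sub>F R in at_top. L2sq (\<lambda>x. trunc R f x - f x) < ennreal (e / 4)"
      using e by (intro order_tendstoD(2)) auto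
    then obtain R0 where R0: "\<And>R. R \<ge> R0 \<Longrightarrow> L2sq (\<lambda>x. trunc R f x - f x) < ennreal (e / 4)"
      by (auto simp: eventually_at_top_linorder)
    show "\<exists>R0. \<forall>R\<ge>R0. \<forall>S\<ge>R0. L2sq (\<lambda>x. ft \<sigma> (trunc R f) x - ft \<sigma> (trunc S f) x) \<le> ennreal e"
    proof (intro exI allI impI)
      fix R S assume RS: "R0 \<le> R" "R0 \<le> S"
      have "L2sq (\<lambda>x. ft \<sigma> (trunc R f) x - ft \<sigma> (trunc S f) x) = L2sq (ft \<sigma> (\<lambda>x. trunc R f x - trunc S f x))"
        by (simp add: ft_diff integrable_trunc f)
      also have "\<dots> \<le> L2sq (\<lambda>x. trunc R f x - trunc S f x)"
        using f by (intro Bessel \<sigma> Bochner_Integration.integrable_diff integrable_trunc)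
      also have "\<dots> = L2sq (\<lambda>x. (trunc R f x - f x) + (f x - trunc S f x))" by simp
      also have "\<dots> \<le> 2 * L2sq (\<lambda>x. trunc R f x - f x) + 2 * L2sq (\<lambda>x. f x - trunc S f x)"
        by (rule L2sq_add_le) measurable
      also have "L2sq (\<lambda>x. f x - trunc S f x) = L2sq (\<lambda>x. trunc S f x - f x)" by (simp add: norm_minus_commute)
      also have "2 * L2sq (\<lambda>x. trunc R f x - f x) + 2 * L2sq (\<lambda>x. trunc S f x - f x) \<le> 2 * ennreal (e/4) + 2 * ennreal (e/4)"
        using R0[OF RS(1)] R0[OF RS(2)] by (intro add_mono mult_left_mono) auto
      also have "\<dots> = ennreal e"
        using ennreal_mult[of 2 "e/4"] ennreal_plus[of "e/2" "e/2"] e by simp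
      finally show "L2sq (\<lambda>x. ft \<sigma> (trunc R f) x - ft \<sigma> (trunc S f) x) \<le> ennreal e" .
    qed
  qed
  then show ?thesis unfolding FT_def L2_limit_def by (rule someI_ex)
qed

lemma square_integrable_FT:
  "square_integrable f \<Longrightarrow> \<bar>\<sigma>\<bar> = 1 \<Longrightarrow> square_integrable (FT \<sigma> f)"
  using FT_is_L2_limit by (auto simp: is_L2_limit_def)

lemma square_integrable_ft_trunc:
  "square_integrable f \<Longrightarrow> \<bar>\<sigma>\<bar> = 1 \<Longrightarrow> square_integrable (ft \<sigma> (trunc R f))"
  by (intro square_integrable_ft integrable_trunc square_integrable_trunc)

text \<open>Pairing the limit \<open>F\<close> with its approximations gives \<open>\<parallel>F\<parallel>\<^sup>2 \<le> (\<parallel>F\<parallel>\<^sup>2 + \<parallel>f\<parallel>\<^sup>2) / 2\<close>.\<close>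

lemma FT_L2_le:
  assumes f: "square_integrable f" and \<sigma>: "\<bar>\<sigma>\<bar> = 1"
  shows "(\<integral>x. (norm (FT \<sigma> f x))\<^sup>2 \<partial>lborel) \<le> (\<integral>x. (norm (f x))\<^sup>2 \<partial>lborel)" (is "?F \<le> ?f")
proof -
  let ?G = "\<lambda>R. ft \<sigma> (trunc R f)"
  have G: "square_integrable (?G R)" for R by (rule square_integrable_ft_trunc[OF f \<sigma>])
  have F: "square_integrable (FT \<sigma> f)" by (rule square_integrable_FT[OF f \<sigma>])
  then have cF: "square_integrable (\<lambda>x. cnj (FT \<sigma> f x))" unfolding square_integrable_def by (auto intro: measurable_compose[OF _ borel_measurable_cnj])
  have Gle: "(\<integral>x. (norm (?G R x))\<^sup>2 \<partial>lborel) \<le> ?f" for R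
  proof -
    have "L2sq (?G R) \<le> L2sq (trunc R f)" by (intro Bessel \<sigma> integrable_trunc f)
    also have "\<dots> \<le> L2sq f" by (intro nn_integral_mono ennreal_leI power_mono norm_trunc_le) auto
    finally have "ennreal ((L2_norm (?G R))\<^sup>2) \<le> ennreal ((L2_norm f)\<^sup>2)" using L2sq_eq[OF G] L2sq_eq[OF f] by simp
    then show ?thesis by (simp add: L2_norm_def)
  qed
  have "((\<lambda>R. \<integral>x. cnj (FT \<sigma> f x) * ?G R x \<partial>lborel) \<longlongrightarrow> (\<integral>x. cnj (FT \<sigma> f x) * FT \<sigma> f x \<partial>lborel)) at_top"
    by (rule L2_pairing_tendsto[OF FT_is_L2_limit[OF f \<sigma>] G cF])
  then have "((\<lambda>R. norm (\<integral>x. cnj (FT \<sigma> f x) * ?G R x \<partial>lborel)) \<longlongrightarrow> norm (\<integral>x. cnj (FT \<sigma> f x) * FT \<sigma> f x \<partial>lborel)) at_top"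
    by (rule tendsto_norm)
  moreover have "norm (\<integral>x. cnj (FT \<sigma> f x) * ?G R x \<partial>lborel) \<le> (?F + ?f) / 2" for R
  proof -
    have "norm (\<integral>x. cnj (FT \<sigma> f x) * ?G R x \<partial>lborel) \<le> (\<integral>x. norm (cnj (FT \<sigma> f x) * ?G R x) \<partial>lborel)"
      by (rule integral_norm_bound)
    also have "\<dots> \<le> (\<integral>x. ((norm (FT \<sigma> f x))\<^sup>2 + (norm (?G R x))\<^sup>2) / 2 \<partial>lborel)"
    proof (rule integral_mono)
      show "integrable lborel (\<lambda>x. norm (cnj (FT \<sigma> f x) * ?G R x))"
        by (intro integrable_norm integrable_mult_square_integrable cF G)
      show "integrable lborel (\<lambda>x. ((norm (FT \<sigma> f x))\<^sup>2 + (norm (?G R x))\<^sup>2) / 2)"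
        using F G by (simp add: square_integrable_def)
      show "norm (cnj (FT \<sigma> f x) * ?G R x) \<le> ((norm (FT \<sigma> f x))\<^sup>2 + (norm (?G R x))\<^sup>2) / 2" for x
        using sum_squares_bound[of "norm (FT \<sigma> f x)" "norm (?G R x)"] by (simp add: norm_mult)
    qed
    also have "\<dots> = (?F + (\<integral>x. (norm (?G R x))\<^sup>2 \<partial>lborel)) / 2"
      using F G[of R] by (simp add: square_integrable_def)
    also have "\<dots> \<le> (?F + ?f) / 2" using Gle[of R] by (intro divide_right_mono add_left_mono) auto
    finally show ?thesis .
  qed
  ultimately have "norm (\<integral>x. cnj (FT \<sigma> f x) * FT \<sigma> f x \<partial>lborel) \<le> (?F + ?f) / 2"
    by (intro tendsto_upperbound[of _ _ at_top]) auto
  moreover have "(\<lambda>x. cnj (FT \<sigma> f x) * FT \<sigma> f x) = (\<lambda>x. complex_of_real ((norm (FT \<sigma> f x))\<^sup>2))"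
    by (auto simp: fun_eq_iff complex_norm_square[symmetric] mult.commute simp del: of_real_power)
  moreover have "norm (\<integral>x. complex_of_real ((norm (FT \<sigma> f x))\<^sup>2) \<partial>lborel) = ?F"
    by (simp only: integral_complex_of_real norm_of_real) simp
  ultimately show ?thesis by simp
qed

text \<open>The multiplication formula passes to the limit on both sides, because truncation converges in the mean.\<close>

lemma FT_pairing:
  assumes f: "square_integrable f" and \<psi>: "integrable lborel \<psi>" "square_integrable \<psi>" and \<sigma>: "\<bar>\<sigma>\<bar> = 1"
  shows "(\<integral>x. \<psi> x * FT \<sigma> f x \<partial>lborel) = (\<integral>x. ft \<sigma> \<psi> x * f x \<partial>lborel)"
proof -
  have "((\<lambda>R. \<integral>x. \<psi> x * ft \<sigma> (trunc R f) x \<partial>lborel) \<longlongrightarrow> (\<integral>x. \<psi> x * FT \<sigma> f x \<partial>lborel)) at_top"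
    by (rule L2_pairing_tendsto[OF FT_is_L2_limit[OF f \<sigma>] square_integrable_ft_trunc[OF f \<sigma>] \<psi>(2)])
  moreover have "(\<integral>x. \<psi> x * ft \<sigma> (trunc R f) x \<partial>lborel) = (\<integral>x. ft \<sigma> \<psi> x * trunc R f x \<partial>lborel)" for R
    by (rule ft_mult_formula[OF \<psi>(1) integrable_trunc[OF f]])
  moreover have "((\<lambda>R. \<integral>x. ft \<sigma> \<psi> x * trunc R f x \<partial>lborel) \<longlongrightarrow> (\<integral>x. ft \<sigma> \<psi> x * f x \<partial>lborel)) at_top"
    by (rule L2_pairing_tendsto[OF trunc_is_L2_limit[OF f] square_integrable_trunc[OF f] square_integrable_ft[OF \<psi> \<sigma>]])
  ultimately show ?thesis using tendsto_unique[OF trivial_limit_at_top_linorder] by force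
qed

lemma FT_eq_ft:
  assumes f: "integrable lborel f" "square_integrable f" and \<sigma>: "\<bar>\<sigma>\<bar> = 1"
  shows "AE x in lborel. FT \<sigma> f x = ft \<sigma> f x"
proof (rule is_L2_limit_unique[OF FT_is_L2_limit[OF f(2) \<sigma>]])
  show "is_L2_limit (\<lambda>R. ft \<sigma> (trunc R f)) (ft \<sigma> f)"
    unfolding is_L2_limit_def
  proof
    have lim: "((\<lambda>R. L2sq (\<lambda>x. trunc R f x - f x)) \<longlongrightarrow> 0) at_top"
      using trunc_is_L2_limit[OF f(2)] by (simp add: is_L2_limit_def)
    have le: "L2sq (\<lambda>x. ft \<sigma> (trunc R f) x - ft \<sigma> f x) \<le> L2sq (\<lambda>x. trunc R f x - f x)" for R
    proof -
      have "L2sq (\<lambda>x. ft \<sigma> (trunc R f) x - ft \<sigma> f x) = L2sq (ft \<sigma> (\<lambda>x. trunc R f x - f x))"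
        by (simp add: ft_diff integrable_trunc f)
      then show ?thesis using Bessel[OF _ \<sigma>, of "\<lambda>x. trunc R f x - f x"] f by (simp add: integrable_trunc)
    qed
    show "((\<lambda>R. L2sq (\<lambda>x. ft \<sigma> (trunc R f) x - ft \<sigma> f x)) \<longlongrightarrow> 0) at_top"
      by (rule tendsto_sandwich[OF _ _ tendsto_const lim]) (auto simp: le)
  qed (rule square_integrable_ft[OF f \<sigma>])
  show "ft \<sigma> (trunc R f) \<in> borel_measurable borel" for R
    using square_integrable_borel[OF f(2)] by measurable
qed

lemma test_function_complex:
  assumes "test_function \<phi>"
  shows "integrable lborel (\<lambda>x. complex_of_real ((deriv ^^ n) \<phi> x))"
    and "square_integrable (\<lambda>x. complex_of_real ((deriv ^^ n) \<phi> x))"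
    and "\<exists>B. \<forall>x. \<bar>(deriv ^^ n) \<phi> x\<bar> \<le> B"
    and "isCont ((deriv ^^ n) \<phi>) x"
proof -
  obtain M where M: "M > 0" "\<And>n x. x \<notin> {-M..M} \<Longrightarrow> (deriv ^^ n) \<phi> x = 0"
    "\<And>n x. ((deriv ^^ n) \<phi> has_real_derivative (deriv ^^ Suc n) \<phi> x) (at x)"
    using test_function_cases[OF assms] by blast
  have cont: "isCont ((deriv ^^ n) \<phi>) x" for x using M(3) DERIV_isCont by blast
  then show "isCont ((deriv ^^ n) \<phi>) x" .
  have c: "continuous_on UNIV ((deriv ^^ n) \<phi>)" using cont continuous_at_imp_continuous_on by blast
  then have [measurable]: "(deriv ^^ n) \<phi> \<in> borel_measurable borel" by (rule borel_measurable_continuous_onI)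
  have "compact ((deriv ^^ n) \<phi> ` {-M..M})" using c by (intro compact_continuous_image) (auto intro: continuous_on_subset)
  then obtain B where B: "\<And>x. x \<in> {-M..M} \<Longrightarrow> norm ((deriv ^^ n) \<phi> x) \<le> B"
    using compact_imp_bounded bounded_iff by (metis image_eqI)
  have "\<bar>(deriv ^^ n) \<phi> x\<bar> \<le> max B 0" for x
    using B[of x] M(2)[of x n] by (cases "x \<in> {-M..M}") auto
  then show "\<exists>B. \<forall>x. \<bar>(deriv ^^ n) \<phi> x\<bar> \<le> B" by blast
  have li: "locally_integrable (\<lambda>x::real. 1::complex)" "locally_integrable (\<lambda>x. complex_of_real ((deriv ^^ n) \<phi> x))"
    unfolding locally_integrable_def set_integrable_def
    using c by (auto intro!: borel_integrable_compact continuous_intros elim: continuous_on_subset)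
  show "integrable lborel (\<lambda>x. complex_of_real ((deriv ^^ n) \<phi> x))"
    using test_function_integrable[OF assms li(1), of n] by (simp add: scaleR_conv_of_real)
  have "integrable lborel (\<lambda>x. norm ((deriv ^^ n) \<phi> x *\<^sub>R complex_of_real ((deriv ^^ n) \<phi> x)))"
    by (intro integrable_norm test_function_integrable assms li)
  then show "square_integrable (\<lambda>x. complex_of_real ((deriv ^^ n) \<phi> x))"
    by (simp add: square_integrable_def power2_eq_square norm_mult)
qed

text \<open>The derivative of \<open>cis (\<sigma>\<xi>x) \<phi>\<^sup>(\<^sup>n\<^sup>)(x)\<close> has integral zero, since the function vanishes outside a bounded interval.\<close>

lemma ft_deriv:
  assumes "test_function \<phi>"
  shows "ft \<sigma> (\<lambda>x. complex_of_real ((deriv ^^ Suc n) \<phi> x)) \<xi>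
     = - (\<i> * of_real (\<sigma> * \<xi>)) * ft \<sigma> (\<lambda>x. complex_of_real ((deriv ^^ n) \<phi> x)) \<xi>"
proof -
  obtain M where M: "M > 0" "\<And>n x. x \<notin> {-M..M} \<Longrightarrow> (deriv ^^ n) \<phi> x = 0"
    "\<And>n x. ((deriv ^^ n) \<phi> has_real_derivative (deriv ^^ Suc n) \<phi> x) (at x)"
    using test_function_cases[OF assms] by blast
  define p where "p n x = complex_of_real ((deriv ^^ n) \<phi> x)" for n x
  define E where "E x = cis (\<sigma> * \<xi> * x)" for x
  let ?z = "\<i> * complex_of_real (\<sigma> * \<xi>)"
  let ?F' = "\<lambda>x. E x * p (Suc n) x + ?z * E x * p n x"
  have E': "(E has_vector_derivative ?z * E x) (at x)" for x
  proof -
    have "((\<lambda>w. exp (?z * w)) has_field_derivative ?z * exp (?z * of_real x)) (at (of_real x))"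
      by (auto intro!: derivative_eq_intros)
    from has_vector_derivative_real_field[OF this]
    show ?thesis by (simp add: E_def[abs_def] cis_conv_exp ac_simps)
  qed
  have p': "(p n has_vector_derivative p (Suc n) x) (at x)" for n x
    unfolding p_def using M(3)[of n x] by (intro has_vector_derivative_of_real) (simp add: has_real_derivative_iff_has_vector_derivative)
  have F: "((\<lambda>x. E x * p n x) has_vector_derivative ?F' x) (at x)" for x
    by (rule has_vector_derivative_mult[OF E' p'])
  have cE: "continuous_on UNIV E" unfolding E_def by (intro continuous_intros)
  have cp: "continuous_on UNIV (p n)" for n unfolding p_def
    using test_function_complex(4)[OF assms] by (intro continuous_intros continuous_at_imp_continuous_on) auto
  have "(\<integral>x. indicator {-(M+1)..M+1} x *\<^sub>R ?F' x \<partial>lborel) = E (M+1) * p n (M+1) - E (-(M+1)) * p n (-(M+1))"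
    using M(1) by (intro integral_FTC_Icc has_vector_derivative_at_within[OF F])
      (auto intro!: continuous_intros continuous_on_subset[OF cE] continuous_on_subset[OF cp])
  also have "\<dots> = 0" using M(2) by (simp add: p_def)
  also have "(\<lambda>x. indicator {-(M+1)..M+1} x *\<^sub>R ?F' x) = ?F'"
    using M(2) by (auto simp: fun_eq_iff indicator_def p_def simp del: funpow.simps)
  finally have "(\<integral>x. ?F' x \<partial>lborel) = 0" .
  moreover have "integrable lborel (\<lambda>x. E x * p n x)" for n
    unfolding E_def p_def by (intro integrable_cis_mult test_function_complex assms)
  ultimately have "(\<integral>x. E x * p (Suc n) x \<partial>lborel) + ?z * (\<integral>x. E x * p n x \<partial>lborel) = 0"
    by (simp add: mult.assoc)
  then have "(\<integral>x. E x * p (Suc n) x \<partial>lborel) = - ?z * (\<integral>x. E x * p n x \<partial>lborel)"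
    by (simp add: add_eq_0_iff)
  then show ?thesis unfolding ft_def p_def E_def by (simp add: mult.assoc)
qed

lemma ft_deriv_pow:
  assumes "test_function \<phi>"
  shows "ft \<sigma> (\<lambda>x. complex_of_real ((deriv ^^ n) \<phi> x)) \<xi>
     = (- (\<i> * of_real (\<sigma> * \<xi>))) ^ n * ft \<sigma> (\<lambda>x. complex_of_real (\<phi> x)) \<xi>"
proof (induction n)
  case (Suc n)
  then show ?case unfolding ft_deriv[OF assms] by (simp only: power_Suc mult.assoc)
qed simp

text \<open>The transforms of \<open>\<phi>\<close> and of its second derivative are bounded, so the transform of \<open>\<phi>\<close> is \<open>O(1 / (1 + \<xi>\<^sup>2))\<close>.\<close>

lemma integrable_ft_test:
  assumes t: "test_function \<phi>" and \<sigma>: "\<bar>\<sigma>\<bar> = 1"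
  shows "integrable lborel (ft \<sigma> (\<lambda>x. complex_of_real (\<phi> x)))"
proof -
  let ?p = "\<lambda>x. complex_of_real (\<phi> x)"
  have ip: "integrable lborel ?p" using test_function_complex(1)[OF t, of 0] by simp
  obtain B0 where B0: "\<And>x. norm (ft \<sigma> ?p x) \<le> B0" using bounded_ft[OF ip] by blast
  obtain B2 where B2: "\<And>x. norm (ft \<sigma> (\<lambda>x. complex_of_real ((deriv ^^ 2) \<phi> x)) x) \<le> B2"
    using bounded_ft[OF test_function_complex(1)[OF t, of 2]] by blast
  have bound: "norm (ft \<sigma> ?p x) \<le> (B0 + B2) * inverse (1 + x\<^sup>2)" for x
  proof -
    have "norm (- (\<i> * complex_of_real (\<sigma> * x))) = \<bar>x\<bar>" using \<sigma> by (simp add: norm_mult abs_mult)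
    then have "x\<^sup>2 * norm (ft \<sigma> ?p x) \<le> B2"
      using B2[of x] unfolding ft_deriv_pow[OF t] by (simp only: norm_mult norm_power power2_abs)
    then have "(1 + x\<^sup>2) * norm (ft \<sigma> ?p x) \<le> B0 + B2" using B0[of x] by (simp add: algebra_simps)
    moreover have "1 + x\<^sup>2 > 0" by (simp add: add_pos_nonneg)
    ultimately show ?thesis by (simp add: field_simps)
  qed
  have "integrable lborel (\<lambda>x::real. inverse (1 + x\<^sup>2))"
    using integrable_inverse_1_plus_square by (simp add: set_integrable_def)
  then have "integrable lborel (\<lambda>x. (B0 + B2) * inverse (1 + x\<^sup>2))" by simp
  then show ?thesis
  proof (rule Bochner_Integration.integrable_bound)
    show "ft \<sigma> ?p \<in> borel_measurable lborel" using ip by (simp add: measurable_ft)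
    show "AE x in lborel. norm (ft \<sigma> ?p x) \<le> norm ((B0 + B2) * inverse (1 + x\<^sup>2))"
      by (intro always_eventually allI order_trans[OF bound]) simp
  qed
qed

text \<open>Moving both transforms onto a test function reduces the claim to the pointwise inversion formula for test functions.\<close>

lemma FT_inversion:
  assumes f: "square_integrable f" and \<sigma>: "\<bar>\<sigma>\<bar> = 1"
  shows "AE x in lborel. FT (-\<sigma>) (FT \<sigma> f) x = f x"
proof -
  have \<sigma>': "\<bar>-\<sigma>\<bar> = 1" using \<sigma> by simp
  let ?g = "FT (-\<sigma>) (FT \<sigma> f)"
  have F: "square_integrable (FT \<sigma> f)" by (rule square_integrable_FT[OF f \<sigma>])
  have g: "square_integrable ?g" by (rule square_integrable_FT[OF F \<sigma>'])
  have "AE x in lborel. ?g x - f x = 0"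
  proof (rule du_Bois_Reymond)
    show "locally_integrable (\<lambda>x. ?g x - f x)"
      by (intro square_integrable_imp_locally_integrable square_integrable_diff g f)
    fix \<phi> assume t: "test_function \<phi>"
    let ?p = "\<lambda>x. complex_of_real (\<phi> x)"
    have ip: "integrable lborel ?p" and sp: "square_integrable ?p"
      using test_function_complex(1,2)[OF t, of 0] by simp_all
    have "(\<integral>x. ?p x * ?g x \<partial>lborel) = (\<integral>x. ft (-\<sigma>) ?p x * FT \<sigma> f x \<partial>lborel)"
      by (rule FT_pairing[OF F ip sp \<sigma>'])
    also have "\<dots> = (\<integral>x. ft \<sigma> (ft (-\<sigma>) ?p) x * f x \<partial>lborel)"
      by (rule FT_pairing[OF f integrable_ft_test[OF t \<sigma>'] square_integrable_ft[OF ip sp \<sigma>'] \<sigma>])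
    also have "ft \<sigma> (ft (-\<sigma>) ?p) = ?p"
    proof
      fix x
      obtain B where "\<And>x. \<bar>\<phi> x\<bar> \<le> B" using test_function_complex(3)[OF t, of 0] by auto
      then have "norm (?p x) \<le> B" for x by simp
      moreover have "isCont ?p x" for x
        using test_function_complex(4)[OF t, where n=0 and x=x] by (intro continuous_intros) simp
      ultimately show "ft \<sigma> (ft (-\<sigma>) ?p) x = ?p x"
        using ft_inversion[OF ip _ _ integrable_ft_test[OF t \<sigma>'] \<sigma>', of B x] by simp
    qed
    finally have "(\<integral>x. ?p x * ?g x \<partial>lborel) = (\<integral>x. ?p x * f x \<partial>lborel)" .
    then show "(\<integral>x. \<phi> x *\<^sub>R (?g x - f x) \<partial>lborel) = 0"
      using integrable_mult_square_integrable[OF sp g] integrable_mult_square_integrable[OF sp f]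
      by (simp add: scaleR_conv_of_real right_diff_distrib)
  qed
  then show ?thesis by simp
qed

text \<open>Neither the transform nor its inverse increases the norm, so neither can decrease it.\<close>

lemma FT_isometry:
  assumes f: "square_integrable f" and \<sigma>: "\<bar>\<sigma>\<bar> = 1"
  shows "(\<integral>x. (norm (FT \<sigma> f x))\<^sup>2 \<partial>lborel) = (\<integral>x. (norm (f x))\<^sup>2 \<partial>lborel)"
proof (rule antisym[OF FT_L2_le[OF f \<sigma>]])
  have F: "square_integrable (FT \<sigma> f)" by (rule square_integrable_FT[OF f \<sigma>])
  have \<sigma>': "\<bar>-\<sigma>\<bar> = 1" using \<sigma> by simp
  have [measurable]: "f \<in> borel_measurable borel" "FT (-\<sigma>) (FT \<sigma> f) \<in> borel_measurable borel"
    using f square_integrable_FT[OF F \<sigma>'] by (auto simp: square_integrable_borel)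
  have "(\<integral>x. (norm (f x))\<^sup>2 \<partial>lborel) = (\<integral>x. (norm (FT (-\<sigma>) (FT \<sigma> f) x))\<^sup>2 \<partial>lborel)"
    using FT_inversion[OF f \<sigma>] by (intro integral_cong_AE) auto
  also have "\<dots> \<le> (\<integral>x. (norm (FT \<sigma> f x))\<^sup>2 \<partial>lborel)" by (rule FT_L2_le[OF F \<sigma>'])
  finally show "(\<integral>x. (norm (f x))\<^sup>2 \<partial>lborel) \<le> (\<integral>x. (norm (FT \<sigma> f x))\<^sup>2 \<partial>lborel)" .
qed

text \<open>The derivatives fall on the test function, where the transform turns them into powers of \<open>\<xi>\<close>.\<close>

lemma FT_weak_derivative:
  assumes k: "square_integrable k" and kl: "square_integrable (\<lambda>\<xi>. (\<i> * complex_of_real (\<sigma> * \<xi>)) ^ l * k \<xi>)" and \<sigma>: "\<bar>\<sigma>\<bar> = 1"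
  shows "has_weak_derivative l (FT \<sigma> k) (FT \<sigma> (\<lambda>\<xi>. (\<i> * complex_of_real (\<sigma> * \<xi>)) ^ l * k \<xi>))"
  unfolding has_weak_derivative_def
proof (intro conjI allI impI)
  show "locally_integrable (FT \<sigma> k)" "locally_integrable (FT \<sigma> (\<lambda>\<xi>. (\<i> * complex_of_real (\<sigma> * \<xi>)) ^ l * k \<xi>))"
    by (intro square_integrable_imp_locally_integrable square_integrable_FT k kl \<sigma>)+
  fix \<phi> assume t: "test_function \<phi>"
  let ?p = "\<lambda>x. complex_of_real (\<phi> x)"
  have ip: "integrable lborel ?p" and sp: "square_integrable ?p"
    using test_function_complex(1,2)[OF t, of 0] by simp_all
  have "(\<integral>x. (deriv ^^ l) \<phi> x *\<^sub>R FT \<sigma> k x \<partial>lborel) = (\<integral>x. complex_of_real ((deriv ^^ l) \<phi> x) * FT \<sigma> k x \<partial>lborel)"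
    by (simp add: scaleR_conv_of_real)
  also have "\<dots> = (\<integral>x. ft \<sigma> (\<lambda>x. complex_of_real ((deriv ^^ l) \<phi> x)) x * k x \<partial>lborel)"
    by (rule FT_pairing[OF k test_function_complex(1,2)[OF t] \<sigma>])
  also have "\<dots> = (\<integral>x. (-1)^l *\<^sub>R (ft \<sigma> ?p x * ((\<i> * complex_of_real (\<sigma> * x)) ^ l * k x)) \<partial>lborel)"
    unfolding ft_deriv_pow[OF t] power_minus[of "\<i> * _"] by (simp add: scaleR_conv_of_real ac_simps)
  also have "\<dots> = (-1)^l *\<^sub>R (\<integral>x. ft \<sigma> ?p x * ((\<i> * complex_of_real (\<sigma> * x)) ^ l * k x) \<partial>lborel)"
    by (rule integral_scaleR_right)
  also have "(\<integral>x. ft \<sigma> ?p x * ((\<i> * complex_of_real (\<sigma> * x)) ^ l * k x) \<partial>lborel) = (\<integral>x. ?p x * FT \<sigma> (\<lambda>\<xi>. (\<i> * complex_of_real (\<sigma> * \<xi>)) ^ l * k \<xi>) x \<partial>lborel)"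
    by (rule FT_pairing[OF kl ip sp \<sigma>, symmetric])
  finally show "(\<integral>x. (deriv ^^ l) \<phi> x *\<^sub>R FT \<sigma> k x \<partial>lborel) = (-1) ^ l *\<^sub>R (\<integral>x. \<phi> x *\<^sub>R FT \<sigma> (\<lambda>\<xi>. (\<i> * complex_of_real (\<sigma> * \<xi>)) ^ l * k \<xi>) x \<partial>lborel)"
    by (simp add: scaleR_conv_of_real)
qed

section \<open>The energy inequality for the symmetrized system\<close>

text \<open>Young's inequality in the form used to absorb mixed terms.\<close>

lemma young: "0 < d \<Longrightarrow> x * y \<le> d * x\<^sup>2 + y\<^sup>2 / (4 * d)" for x y d :: real
proof -
  assume d: "0 < d"
  have "0 \<le> (2 * d * x - y)\<^sup>2" by simp
  then have "4 * d * (x * y) \<le> 4 * d * (d * x\<^sup>2) + y\<^sup>2" by (simp add: power2_eq_square algebra_simps)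
  then show ?thesis using d by (simp add: field_simps)
qed

definition nsq :: "complex \<Rightarrow> complex \<Rightarrow> complex \<Rightarrow> complex \<Rightarrow> real" where
  "nsq r u h n = (cmod r)\<^sup>2 + (cmod u)\<^sup>2 + (cmod h)\<^sup>2 + (cmod n)\<^sup>2"

lemma nsq_nonneg: "0 \<le> nsq r u h n" by (simp add: nsq_def)

text \<open>The parameter \<open>s\<close> stands for \<open>\<xi> / (1 + \<xi>\<^sup>2)\<close>; the two mixed terms are the compensating ones.\<close>

definition energy :: "real \<Rightarrow> real \<Rightarrow> real \<Rightarrow> complex \<Rightarrow> complex \<Rightarrow> complex \<Rightarrow> complex \<Rightarrow> real" where
  "energy \<alpha> \<gamma> s r u h n = nsq r u h n + \<alpha> * s * (Im (h * cnj u) + \<gamma> * Im (u * cnj r))"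

text \<open>The time derivative of the energy when \<open>r', u', h', n'\<close> are the derivatives of \<open>r, u, h, n\<close>.\<close>

definition denergy :: "real \<Rightarrow> real \<Rightarrow> real \<Rightarrow> complex \<Rightarrow> complex \<Rightarrow> complex \<Rightarrow> complex \<Rightarrow> complex \<Rightarrow> complex \<Rightarrow> complex \<Rightarrow> complex \<Rightarrow> real" where
  "denergy \<alpha> \<gamma> s r u h n r' u' h' n' =
     2 * Re (cnj r * r') + 2 * Re (cnj u * u') + 2 * Re (cnj h * h') + 2 * Re (cnj n * n')
     + \<alpha> * s * (Im (h' * cnj u) + Im (h * cnj u') + \<gamma> * (Im (u' * cnj r) + Im (u * cnj r')))"

text \<open>The symmetrized system at frequency \<open>\<xi>\<close>, for density \<open>r\<close>, velocity \<open>u\<close>, temperature \<open>h\<close> and radiation \<open>n\<close>, each scaled so that the coefficient matrix of the time derivative is the identity. \<open>U\<close> is the velocity of the background state. The relaxation is the rank-one matrix with vector \<open>(0, 0, m\<^sub>1, - m\<^sub>2)\<close>, and \<open>\<beta>\<close> is the radiation diffusion.\<close>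

locale rad_system =
  fixes U a b c m1 m2 \<beta> :: real
  assumes pos: "a > 0" "b > 0" "m1 > 0" "\<beta> > 0"
begin

definition rhs1 :: "real \<Rightarrow> complex \<Rightarrow> complex \<Rightarrow> complex \<Rightarrow> complex \<Rightarrow> complex" where
  "rhs1 \<xi> r u h n = - \<i> * of_real \<xi> * (of_real U * r + of_real a * u)"
definition rhs2 :: "real \<Rightarrow> complex \<Rightarrow> complex \<Rightarrow> complex \<Rightarrow> complex \<Rightarrow> complex" where
  "rhs2 \<xi> r u h n = - \<i> * of_real \<xi> * (of_real U * u + of_real a * r + of_real b * h + of_real c * n)"
definition rhs3 :: "real \<Rightarrow> complex \<Rightarrow> complex \<Rightarrow> complex \<Rightarrow> complex \<Rightarrow> complex" where
  "rhs3 \<xi> r u h n = - \<i> * of_real \<xi> * (of_real U * h + of_real b * u) - of_real m1 * (of_real m1 * h - of_real m2 * n)"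
definition rhs4 :: "real \<Rightarrow> complex \<Rightarrow> complex \<Rightarrow> complex \<Rightarrow> complex \<Rightarrow> complex" where
  "rhs4 \<xi> r u h n = - \<i> * of_real \<xi> * (of_real U * n + of_real c * u) + of_real m2 * (of_real m1 * h - of_real m2 * n) - of_real (\<beta> * \<xi>\<^sup>2) * n"

lemmas rhs_defs = rhs1_def rhs2_def rhs3_def rhs4_def

text \<open>The transport by \<open>U\<close> drops out of all terms, because each is a product of one component with the conjugate of another.\<close>

lemma denergy_eq:
  "denergy \<alpha> \<gamma> s r u h n (rhs1 \<xi> r u h n + g1) (rhs2 \<xi> r u h n + g2) (rhs3 \<xi> r u h n + g3) (rhs4 \<xi> r u h n + g4)
   = - 2 * (cmod (of_real m1 * h - of_real m2 * n))\<^sup>2 - 2 * \<beta> * \<xi>\<^sup>2 * (cmod n)\<^sup>2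
     + \<alpha> * (s * \<xi>) * (- b * (cmod u)\<^sup>2 + a * Re (h * cnj r) + b * (cmod h)\<^sup>2 + c * Re (h * cnj n)
         + \<gamma> * (- a * (cmod r)\<^sup>2 - b * Re (h * cnj r) - c * Re (n * cnj r) + a * (cmod u)\<^sup>2))
     - \<alpha> * s * m1 * Im ((of_real m1 * h - of_real m2 * n) * cnj u)
     + (2 * Re (cnj r * g1) + 2 * Re (cnj u * g2) + 2 * Re (cnj h * g3) + 2 * Re (cnj n * g4)
     + \<alpha> * s * (Im (g3 * cnj u) + Im (h * cnj g2) + \<gamma> * (Im (g2 * cnj r) + Im (u * cnj g1))))"
  unfolding denergy_def rhs_defs cmod_power2
  by (simp add: power2_eq_square) (simp add: algebra_simps)

text \<open>The factor \<open>\<rho> = \<xi>\<^sup>2 / (1 + \<xi>\<^sup>2)\<close> is the dissipation rate. The mixed term with \<open>h\<close> and \<open>u\<close> produces \<open>- \<rho> b \<bar>u\<bar>\<^sup>2\<close>, the one with \<open>u\<close> and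
  \<open>r\<close> produces \<open>- \<gamma> \<rho> a \<bar>r\<bar>\<^sup>2 + \<gamma> \<rho> a \<bar>u\<bar>\<^sup>2\<close>, so \<open>\<gamma> a < b\<close> makes both negative. What remains is controlled by
  \<open>\<bar>h\<bar>\<^sup>2\<close> and \<open>\<bar>n\<bar>\<^sup>2\<close>, which the relaxation and the diffusion control up to the factor \<open>\<rho>\<close>; a small \<open>\<alpha>\<close> absorbs it.
  The free parameter \<open>d\<close> splits the contribution of the source.\<close>

lemma energy_inequality:
  "\<exists>\<alpha>>0. \<exists>\<gamma>>0. \<exists>k>0. \<forall>\<xi> s \<rho> r u h n. s = \<xi> / (1 + \<xi>\<^sup>2) \<longrightarrow> \<rho> = \<xi>\<^sup>2 / (1 + \<xi>\<^sup>2) \<longrightarrow>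
     nsq r u h n \<le> 2 * energy \<alpha> \<gamma> s r u h n \<and> energy \<alpha> \<gamma> s r u h n \<le> 2 * nsq r u h n \<and>
     (\<forall>g1 g2 g3 g4 d. d > 0 \<longrightarrow>
      denergy \<alpha> \<gamma> s r u h n (rhs1 \<xi> r u h n + g1) (rhs2 \<xi> r u h n + g2) (rhs3 \<xi> r u h n + g3) (rhs4 \<xi> r u h n + g4)
      \<le> - k * \<rho> * nsq r u h n + d * nsq r u h n + 3 / d * nsq g1 g2 g3 g4)"
proof -
  (* With this choice \<gamma> a = b / 2. *)
  define \<gamma> where "\<gamma> = b / (2 * a)"
  define C1 where "C1 = (2 / b) * (a - \<gamma> * b)\<^sup>2 + (2 / b) * (\<gamma> * c)\<^sup>2 + b + \<bar>c\<bar>"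
  define C4 where "C4 = 2 / m1\<^sup>2 + (2 * m2\<^sup>2 / m1\<^sup>2 + 1) / \<beta>"
  define C5 where "C5 = C1 * C4 + m1\<^sup>2 / b"
  define \<alpha> where "\<alpha> = min (1 / C5) (min 1 (1 / \<gamma>))"
  define k where "k = min (1 / C4) (\<alpha> * b / 4)"
  have \<gamma>: "\<gamma> > 0" "\<gamma> * a = b / 2" using pos by (auto simp: \<gamma>_def)
  have C1: "C1 > 0" unfolding C1_def using pos by (intro add_pos_nonneg add_nonneg_pos) auto
  have C4: "C4 > 0" unfolding C4_def using pos by (intro add_pos_nonneg) auto
  have C5: "C5 > 0" unfolding C5_def using pos C1 C4 by (intro add_pos_pos mult_pos_pos) auto
  have \<alpha>: "\<alpha> > 0" "\<alpha> \<le> 1" "\<alpha> * \<gamma> \<le> 1" "\<alpha> * C5 \<le> 1"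
    using \<gamma> C5 by (auto simp: \<alpha>_def min_def field_simps)
  have k: "k > 0" "k \<le> 1 / C4" "k \<le> \<alpha> * b / 4" using C4 \<alpha> pos by (auto simp: k_def)
  show ?thesis
  proof (rule exI[of _ \<alpha>], intro conjI \<alpha>(1), rule exI[of _ \<gamma>], intro conjI \<gamma>(1), rule exI[of _ k], intro conjI k(1), intro allI impI)
    fix \<xi> s \<rho> :: real and r u h n :: complex
    assume s: "s = \<xi> / (1 + \<xi>\<^sup>2)" and \<rho>: "\<rho> = \<xi>\<^sup>2 / (1 + \<xi>\<^sup>2)"
    have p1: "1 + \<xi>\<^sup>2 > 0" by (simp add: add_pos_nonneg)
    have s2: "\<bar>s\<bar> \<le> 1 / 2"
    proof -
      have "2 * \<bar>\<xi>\<bar> \<le> 1 + \<xi>\<^sup>2" using sum_squares_bound[of 1 "\<bar>\<xi>\<bar>"] by simp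
      then show ?thesis using p1 by (simp add: s field_simps)
    qed
    have \<rho>0: "0 \<le> \<rho>" and \<rho>1: "\<rho> \<le> 1" and \<rho>2: "\<rho> \<le> \<xi>\<^sup>2" and s\<xi>: "s * \<xi> = \<rho>" and ss: "s\<^sup>2 \<le> \<rho>"
    proof -
      show "0 \<le> \<rho>" "\<rho> \<le> 1" using p1 by (auto simp: \<rho> field_simps)
      show "\<rho> \<le> \<xi>\<^sup>2" unfolding \<rho> using p1 by (simp add: divide_le_eq algebra_simps)
      show "s * \<xi> = \<rho>" by (simp add: s \<rho> power2_eq_square)
      have "s\<^sup>2 = \<rho> / (1 + \<xi>\<^sup>2)" by (simp add: s \<rho> power_divide power2_eq_square[of "1 + \<xi>\<^sup>2"])
      also have "\<dots> \<le> \<rho>" using \<open>0 \<le> \<rho>\<close> p1 by (simp add: divide_le_eq algebra_simps)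
      finally show "s\<^sup>2 \<le> \<rho>" .
    qed
    let ?r = "cmod r" and ?u = "cmod u" and ?h = "cmod h" and ?n = "cmod n"
    let ?N = "nsq r u h n"
    have comp: "\<bar>\<alpha> * s * (Im (h * cnj u) + \<gamma> * Im (u * cnj r))\<bar> \<le> ?N / 2"
    proof -
      have 1: "\<bar>Im (h * cnj u)\<bar> \<le> ?h * ?u" "\<bar>Im (u * cnj r)\<bar> \<le> ?u * ?r"
        using abs_Im_le_cmod[of "h * cnj u"] abs_Im_le_cmod[of "u * cnj r"] by (simp_all add: norm_mult)
      have "\<bar>\<alpha> * s * (Im (h * cnj u) + \<gamma> * Im (u * cnj r))\<bar> = \<bar>s\<bar> * \<bar>\<alpha> * Im (h * cnj u) + (\<alpha> * \<gamma>) * Im (u * cnj r)\<bar>"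
        by (simp add: abs_mult[symmetric] algebra_simps)
      also have "\<dots> \<le> 1/2 * (1 * (?h * ?u) + 1 * (?u * ?r))"
      proof (intro mult_mono s2)
        have "\<bar>\<alpha> * Im (h * cnj u) + (\<alpha> * \<gamma>) * Im (u * cnj r)\<bar> \<le> \<alpha> * \<bar>Im (h * cnj u)\<bar> + (\<alpha> * \<gamma>) * \<bar>Im (u * cnj r)\<bar>"
          using abs_triangle_ineq[of "\<alpha> * Im (h * cnj u)" "(\<alpha> * \<gamma>) * Im (u * cnj r)"] \<alpha> \<gamma> by (simp add: abs_mult)
        also have "\<dots> \<le> 1 * (?h * ?u) + 1 * (?u * ?r)"
          using \<alpha> \<gamma> by (intro add_mono mult_mono 1) auto
        finally show "\<bar>\<alpha> * Im (h * cnj u) + (\<alpha> * \<gamma>) * Im (u * cnj r)\<bar> \<le> 1 * (?h * ?u) + 1 * (?u * ?r)" .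
      qed auto
      also have "\<dots> \<le> ?N / 2"
      proof -
        have gen: "1/2 * (1 * x + 1 * y) \<le> (r2 + u2 + h2 + n2) / 2"
          if "x \<le> 1/2 * h2 + u2 / (4 * (1/2))" "y \<le> 1/2 * u2 + r2 / (4 * (1/2))" "0 \<le> r2" "0 \<le> h2" "0 \<le> n2" for x y r2 u2 h2 n2 :: real
          using that by simp
        show ?thesis unfolding nsq_def by (intro gen young) auto
      qed
      finally show ?thesis .
    qed
    show "?N \<le> 2 * energy \<alpha> \<gamma> s r u h n \<and> energy \<alpha> \<gamma> s r u h n \<le> 2 * ?N \<and>
     (\<forall>g1 g2 g3 g4 d. d > 0 \<longrightarrow>
      denergy \<alpha> \<gamma> s r u h n (rhs1 \<xi> r u h n + g1) (rhs2 \<xi> r u h n + g2) (rhs3 \<xi> r u h n + g3) (rhs4 \<xi> r u h n + g4)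
      \<le> - k * \<rho> * ?N + d * ?N + 3 / d * nsq g1 g2 g3 g4)"
    proof (intro conjI allI impI)
      show "?N \<le> 2 * energy \<alpha> \<gamma> s r u h n" "energy \<alpha> \<gamma> s r u h n \<le> 2 * ?N"
      proof -
        define X where "X = \<alpha> * s * (Im (h * cnj u) + \<gamma> * Im (u * cnj r))"
        have "\<bar>X\<bar> \<le> ?N / 2" "energy \<alpha> \<gamma> s r u h n = ?N + X" using comp by (simp_all add: X_def energy_def)
        then show "?N \<le> 2 * energy \<alpha> \<gamma> s r u h n" "energy \<alpha> \<gamma> s r u h n \<le> 2 * ?N"
          using nsq_nonneg[of r u h n] by linarith+
      qed
    next
      fix g1 g2 g3 g4 :: complex and d :: real assume d: "d > 0"
      define w where "w = of_real m1 * h - of_real m2 * n"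
      let ?w = "cmod w"
      define D where "D = ?w\<^sup>2 + \<beta> * \<xi>\<^sup>2 * ?n\<^sup>2"
      have D0: "D \<ge> 0" using pos by (simp add: D_def)
      define P where "P = Re (h * cnj r)"
      define Q where "Q = Re (h * cnj n)"
      define Q' where "Q' = Re (n * cnj r)"
      have PQ: "\<bar>P\<bar> \<le> ?h * ?r" "\<bar>Q\<bar> \<le> ?h * ?n" "\<bar>Q'\<bar> \<le> ?n * ?r"
        unfolding P_def Q_def Q'_def
        using abs_Re_le_cmod[of "h * cnj r"] abs_Re_le_cmod[of "h * cnj n"] abs_Re_le_cmod[of "n * cnj r"] by (simp_all add: norm_mult)
      define B where "B = - b * ?u\<^sup>2 + a * P + b * ?h\<^sup>2 + c * Q + \<gamma> * (- a * ?r\<^sup>2 - b * P - c * Q' + a * ?u\<^sup>2)"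
      have B: "B \<le> - (b / 2) * ?u\<^sup>2 - (b / 4) * ?r\<^sup>2 + C1 * (?h\<^sup>2 + ?n\<^sup>2)"
      proof -
        have 1: "(a - \<gamma> * b) * P \<le> (b / 8) * ?r\<^sup>2 + (2 / b) * (a - \<gamma> * b)\<^sup>2 * ?h\<^sup>2"
        proof -
          have "(a - \<gamma> * b) * P \<le> \<bar>a - \<gamma> * b\<bar> * \<bar>P\<bar>" by (metis abs_ge_self abs_mult)
          also have "\<dots> \<le> \<bar>a - \<gamma> * b\<bar> * (?h * ?r)" by (intro mult_left_mono PQ) auto
          also have "\<dots> \<le> (b / 8) * ?r\<^sup>2 + (2 / b) * (a - \<gamma> * b)\<^sup>2 * ?h\<^sup>2"
            using young[of "b / 8" ?r "\<bar>a - \<gamma> * b\<bar> * ?h"] pos by (simp add: power_mult_distrib ac_simps)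
          finally show ?thesis .
        qed
        have 2: "- (\<gamma> * c) * Q' \<le> (b / 8) * ?r\<^sup>2 + (2 / b) * (\<gamma> * c)\<^sup>2 * ?n\<^sup>2"
        proof -
          have "- (\<gamma> * c) * Q' \<le> \<bar>\<gamma> * c\<bar> * \<bar>Q'\<bar>" by (metis abs_ge_self abs_minus_cancel abs_mult)
          also have "\<dots> \<le> \<bar>\<gamma> * c\<bar> * (?n * ?r)" by (intro mult_left_mono PQ) auto
          also have "\<dots> \<le> (b / 8) * ?r\<^sup>2 + (2 / b) * (\<gamma> * c)\<^sup>2 * ?n\<^sup>2"
            using young[of "b / 8" ?r "\<bar>\<gamma> * c\<bar> * ?n"] pos by (simp add: power_mult_distrib ac_simps)
          finally show ?thesis .
        qed
        have 3: "c * Q \<le> \<bar>c\<bar> * (?h\<^sup>2 + ?n\<^sup>2)"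
        proof -
          have "c * Q \<le> \<bar>c\<bar> * \<bar>Q\<bar>" by (metis abs_ge_self abs_mult)
          also have "\<dots> \<le> \<bar>c\<bar> * (?h * ?n)" by (intro mult_left_mono PQ) auto
          also have "\<dots> \<le> \<bar>c\<bar> * (?h\<^sup>2 + ?n\<^sup>2)"
            by (intro mult_left_mono order_trans[OF young[of 1 ?h ?n]]) auto
          finally show ?thesis .
        qed
        have "B = - (b / 2) * ?u\<^sup>2 - (b / 2) * ?r\<^sup>2 + (a - \<gamma> * b) * P + b * ?h\<^sup>2 + c * Q + - (\<gamma> * c) * Q'"
        proof -
          have "B = - b * ?u\<^sup>2 + (\<gamma> * a) * ?u\<^sup>2 - (\<gamma> * a) * ?r\<^sup>2 + (a - \<gamma> * b) * P + b * ?h\<^sup>2 + c * Q + - (\<gamma> * c) * Q'"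
            unfolding B_def by (simp add: algebra_simps)
          then show ?thesis unfolding \<gamma>(2) by simp
        qed
        also have "\<dots> \<le> - (b / 2) * ?u\<^sup>2 - (b / 2) * ?r\<^sup>2 + ((b / 8) * ?r\<^sup>2 + (2 / b) * (a - \<gamma> * b)\<^sup>2 * ?h\<^sup>2) + b * ?h\<^sup>2
           + \<bar>c\<bar> * (?h\<^sup>2 + ?n\<^sup>2) + ((b / 8) * ?r\<^sup>2 + (2 / b) * (\<gamma> * c)\<^sup>2 * ?n\<^sup>2)"
          by (intro add_mono order_refl 1 2 3)
        also have "\<dots> \<le> - (b / 2) * ?u\<^sup>2 - (b / 4) * ?r\<^sup>2 + C1 * (?h\<^sup>2 + ?n\<^sup>2)"
        proof -
          have "0 \<le> (2 / b) * (a - \<gamma> * b)\<^sup>2 * ?n\<^sup>2" "0 \<le> (2 / b) * (\<gamma> * c)\<^sup>2 * ?h\<^sup>2" "0 \<le> b * ?n\<^sup>2"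
            using pos by auto
          then show ?thesis unfolding C1_def by (simp add: algebra_simps add_divide_distrib)
        qed
        finally show ?thesis .
      qed
      have hn: "\<rho> * (?h\<^sup>2 + ?n\<^sup>2) \<le> C4 * D"
      proof -
        have "of_real m1 * h = w + of_real m2 * n" by (simp add: w_def)
        then have "m1 * ?h \<le> ?w + \<bar>m2\<bar> * ?n"
          using norm_triangle_ineq[of w "of_real m2 * n"] pos by (metis abs_of_pos norm_mult norm_of_real)
        then have "(m1 * ?h)\<^sup>2 \<le> (?w + \<bar>m2\<bar> * ?n)\<^sup>2" using pos by (intro power_mono) auto
        also have "\<dots> \<le> 2 * ?w\<^sup>2 + 2 * (m2\<^sup>2 * ?n\<^sup>2)"
          using young[of "1/2" ?w "\<bar>m2\<bar> * ?n"] by (simp add: power2_sum power_mult_distrib)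
        finally have "?h\<^sup>2 \<le> (2 / m1\<^sup>2) * ?w\<^sup>2 + (2 * m2\<^sup>2 / m1\<^sup>2) * ?n\<^sup>2"
          using pos by (simp add: power_mult_distrib field_simps)
        then have "?h\<^sup>2 + ?n\<^sup>2 \<le> (2 / m1\<^sup>2) * ?w\<^sup>2 + (2 * m2\<^sup>2 / m1\<^sup>2 + 1) * ?n\<^sup>2"
          by (simp add: algebra_simps)
        then have "\<rho> * (?h\<^sup>2 + ?n\<^sup>2) \<le> \<rho> * ((2 / m1\<^sup>2) * ?w\<^sup>2 + (2 * m2\<^sup>2 / m1\<^sup>2 + 1) * ?n\<^sup>2)"
          using \<rho>0 by (rule mult_left_mono)
        also have "\<dots> = \<rho> * ((2 / m1\<^sup>2) * ?w\<^sup>2) + \<rho> * ((2 * m2\<^sup>2 / m1\<^sup>2 + 1) * ?n\<^sup>2)"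
          by (rule distrib_left)
        also have "\<dots> \<le> 1 * ((2 / m1\<^sup>2) * ?w\<^sup>2) + \<xi>\<^sup>2 * ((2 * m2\<^sup>2 / m1\<^sup>2 + 1) * ?n\<^sup>2)"
          by (intro add_mono mult_right_mono \<rho>1 \<rho>2) auto
        also have "\<dots> = (2 / m1\<^sup>2) * ?w\<^sup>2 + ((2 * m2\<^sup>2 / m1\<^sup>2 + 1) / \<beta>) * (\<beta> * \<xi>\<^sup>2 * ?n\<^sup>2)"
          using pos by simp
        also have "\<dots> \<le> C4 * ?w\<^sup>2 + C4 * (\<beta> * \<xi>\<^sup>2 * ?n\<^sup>2)"
          unfolding C4_def using pos by (intro add_mono mult_right_mono) auto
        finally show ?thesis by (simp add: D_def distrib_left)
      qed
      have cross: "- \<alpha> * s * m1 * Im (w * cnj u) \<le> \<alpha> * (\<rho> * (b / 4) * ?u\<^sup>2) + \<alpha> * (m1\<^sup>2 / b) * D"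
      proof -
        have "- \<alpha> * s * m1 * Im (w * cnj u) \<le> \<bar>- \<alpha> * s * m1 * Im (w * cnj u)\<bar>" by (rule abs_ge_self)
        also have "\<dots> = \<alpha> * (\<bar>s\<bar> * m1 * \<bar>Im (w * cnj u)\<bar>)" using \<alpha> pos by (simp add: abs_mult)
        also have "\<dots> \<le> \<alpha> * (\<bar>s\<bar> * m1 * (?w * ?u))"
          using abs_Im_le_cmod[of "w * cnj u"] \<alpha> pos by (intro mult_left_mono) (auto simp: norm_mult)
        also have "\<dots> = \<alpha> * ((\<bar>s\<bar> * ?u) * (m1 * ?w))" by simp
        also have "\<dots> \<le> \<alpha> * ((b / 4) * (\<bar>s\<bar> * ?u)\<^sup>2 + (m1 * ?w)\<^sup>2 / (4 * (b / 4)))"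
          using \<alpha> pos by (intro mult_left_mono young) auto
        also have "\<dots> = \<alpha> * (s\<^sup>2 * ((b / 4) * ?u\<^sup>2) + m1\<^sup>2 / b * ?w\<^sup>2)" by (simp add: power_mult_distrib)
        also have "\<dots> \<le> \<alpha> * (\<rho> * ((b / 4) * ?u\<^sup>2) + m1\<^sup>2 / b * D)"
          using \<alpha> pos ss by (intro mult_left_mono add_mono mult_right_mono) (auto simp: D_def)
        finally show ?thesis by (simp add: algebra_simps)
      qed
      define S where "S = 2 * Re (cnj r * g1) + 2 * Re (cnj u * g2) + 2 * Re (cnj h * g3) + 2 * Re (cnj n * g4)
         + \<alpha> * s * (Im (g3 * cnj u) + Im (h * cnj g2) + \<gamma> * (Im (g2 * cnj r) + Im (u * cnj g1)))"
      have S: "S \<le> d * ?N + 3 / d * nsq g1 g2 g3 g4"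
      proof -
        have re: "2 * Re (cnj x * y) \<le> (d / 2) * (cmod x)\<^sup>2 + (2 / d) * (cmod y)\<^sup>2" for x y
        proof -
          have "2 * Re (cnj x * y) \<le> 2 * (cmod x * cmod y)" using complex_Re_le_cmod[of "cnj x * y"] by (simp add: norm_mult)
          also have "\<dots> \<le> 2 * (d / 4 * (cmod x)\<^sup>2 + (cmod y)\<^sup>2 / (4 * (d / 4)))"
            using d by (intro mult_left_mono young) auto
          finally show ?thesis using d by (simp add: field_simps)
        qed
        have im: "t * Im (x * cnj y) \<le> (d / 8) * (cmod x)\<^sup>2 + (1 / (2 * d)) * (cmod y)\<^sup>2"
           "t * Im (y * cnj x) \<le> (d / 8) * (cmod x)\<^sup>2 + (1 / (2 * d)) * (cmod y)\<^sup>2" if t: "\<bar>t\<bar> \<le> 1 / 2" for t x y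
        proof -
          have *: "t * z \<le> (d / 8) * (cmod x)\<^sup>2 + (1 / (2 * d)) * (cmod y)\<^sup>2" if "\<bar>z\<bar> \<le> cmod x * cmod y" for z
          proof -
            have "t * z \<le> \<bar>t\<bar> * \<bar>z\<bar>" by (metis abs_ge_self abs_mult)
            also have "\<dots> \<le> 1/2 * (cmod x * cmod y)" using t that by (intro mult_mono) auto
            also have "\<dots> \<le> 1/2 * (d / 4 * (cmod x)\<^sup>2 + (cmod y)\<^sup>2 / (4 * (d / 4)))"
              using d by (intro mult_left_mono young) auto
            finally show ?thesis using d by (simp add: field_simps)
          qed
          show "t * Im (x * cnj y) \<le> (d / 8) * (cmod x)\<^sup>2 + (1 / (2 * d)) * (cmod y)\<^sup>2"
           "t * Im (y * cnj x) \<le> (d / 8) * (cmod x)\<^sup>2 + (1 / (2 * d)) * (cmod y)\<^sup>2"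
            using abs_Im_le_cmod[of "x * cnj y"] abs_Im_le_cmod[of "y * cnj x"]
            unfolding norm_mult complex_mod_cnj by (intro * , simp only: mult.commute[of "cmod x"])+
        qed
        have t: "\<bar>\<alpha> * s\<bar> \<le> 1/2" "\<bar>\<alpha> * \<gamma> * s\<bar> \<le> 1/2"
          using mult_mono[of \<alpha> 1 "\<bar>s\<bar>" "1/2"] mult_mono[of "\<alpha> * \<gamma>" 1 "\<bar>s\<bar>" "1/2"] \<alpha> \<gamma> s2 by (simp_all add: abs_mult)
        have "S = 2 * Re (cnj r * g1) + 2 * Re (cnj u * g2) + 2 * Re (cnj h * g3) + 2 * Re (cnj n * g4)
         + (\<alpha> * s) * Im (g3 * cnj u) + (\<alpha> * s) * Im (h * cnj g2) + (\<alpha> * \<gamma> * s) * Im (g2 * cnj r) + (\<alpha> * \<gamma> * s) * Im (u * cnj g1)"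
          unfolding S_def by (simp add: algebra_simps)
        also have "\<dots> \<le> ((d / 2) * ?r\<^sup>2 + (2 / d) * (cmod g1)\<^sup>2) + ((d / 2) * ?u\<^sup>2 + (2 / d) * (cmod g2)\<^sup>2)
           + ((d / 2) * ?h\<^sup>2 + (2 / d) * (cmod g3)\<^sup>2) + ((d / 2) * ?n\<^sup>2 + (2 / d) * (cmod g4)\<^sup>2)
           + ((d / 8) * ?u\<^sup>2 + (1 / (2 * d)) * (cmod g3)\<^sup>2) + ((d / 8) * ?h\<^sup>2 + (1 / (2 * d)) * (cmod g2)\<^sup>2)
           + ((d / 8) * ?r\<^sup>2 + (1 / (2 * d)) * (cmod g2)\<^sup>2) + ((d / 8) * ?u\<^sup>2 + (1 / (2 * d)) * (cmod g1)\<^sup>2)"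
          by (intro add_mono re im t)
        also have "\<dots> \<le> d * ?N + 3 / d * nsq g1 g2 g3 g4"
        proof -
          define A B C1 C2 where "A = d * ?r\<^sup>2" and "B = d * ?u\<^sup>2" and "C1 = d * ?h\<^sup>2" and "C2 = d * ?n\<^sup>2"
          define G1 G2 G3 G4 where "G1 = (cmod g1)\<^sup>2 / d" and "G2 = (cmod g2)\<^sup>2 / d" and "G3 = (cmod g3)\<^sup>2 / d" and "G4 = (cmod g4)\<^sup>2 / d"
          have "0 \<le> A" "0 \<le> B" "0 \<le> C1" "0 \<le> C2" "0 \<le> G1" "0 \<le> G2" "0 \<le> G3" "0 \<le> G4"
            using d by (auto simp: A_def B_def C1_def C2_def G1_def G2_def G3_def G4_def)
          then have "A/2 + 2*G1 + (B/2 + 2*G2) + (C1/2 + 2*G3) + (C2/2 + 2*G4) + (B/8 + G3/2) + (C1/8 + G2/2) + (A/8 + G2/2) + (B/8 + G1/2)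
            \<le> A + B + C1 + C2 + 3 * G1 + 3 * G2 + 3 * G3 + 3 * G4" by linarith
          then show ?thesis unfolding A_def B_def C1_def C2_def G1_def G2_def G3_def G4_def nsq_def
            by (simp add: algebra_simps)
        qed
        finally show ?thesis .
      qed
      have "denergy \<alpha> \<gamma> s r u h n (rhs1 \<xi> r u h n + g1) (rhs2 \<xi> r u h n + g2) (rhs3 \<xi> r u h n + g3) (rhs4 \<xi> r u h n + g4)
         = - 2 * D + (\<alpha> * \<rho>) * B + - \<alpha> * s * m1 * Im (w * cnj u) + S"
        unfolding denergy_eq s\<xi> D_def B_def w_def[symmetric] S_def P_def Q_def Q'_def by (simp add: algebra_simps)
      also have "(\<alpha> * \<rho>) * B \<le> (\<alpha> * \<rho>) * (- (b / 2) * ?u\<^sup>2 - (b / 4) * ?r\<^sup>2 + C1 * (?h\<^sup>2 + ?n\<^sup>2))"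
        using \<alpha> \<rho>0 by (intro mult_left_mono B) auto
      also have "\<dots> = - (\<alpha> * (\<rho> * (b / 2) * ?u\<^sup>2)) - (\<alpha> * b / 4) * (\<rho> * ?r\<^sup>2) + \<alpha> * C1 * (\<rho> * (?h\<^sup>2 + ?n\<^sup>2))"
        by (simp add: algebra_simps)
      also have "\<alpha> * C1 * (\<rho> * (?h\<^sup>2 + ?n\<^sup>2)) \<le> \<alpha> * C1 * (C4 * D)"
        using \<alpha> C1 by (intro mult_left_mono hn) auto
      also note cross
      also have "- 2 * D + (- (\<alpha> * (\<rho> * (b / 2) * ?u\<^sup>2)) - (\<alpha> * b / 4) * (\<rho> * ?r\<^sup>2) + \<alpha> * C1 * (C4 * D))
         + (\<alpha> * (\<rho> * (b / 4) * ?u\<^sup>2) + \<alpha> * (m1\<^sup>2 / b) * D) + S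
         = - 2 * D + (\<alpha> * C5) * D - (\<alpha> * b / 4) * (\<rho> * (?u\<^sup>2 + ?r\<^sup>2)) + S"
        by (simp add: C5_def algebra_simps)
      also have "\<dots> \<le> - 2 * D + 1 * D - (\<alpha> * b / 4) * (\<rho> * (?u\<^sup>2 + ?r\<^sup>2)) + S"
        using mult_right_mono[OF \<alpha>(4) D0] by simp
      also have "\<dots> \<le> - k * (\<rho> * (?h\<^sup>2 + ?n\<^sup>2)) - k * (\<rho> * (?u\<^sup>2 + ?r\<^sup>2)) + S"
      proof -
        have "k * (\<rho> * (?h\<^sup>2 + ?n\<^sup>2)) \<le> 1 / C4 * (C4 * D)"
          using k \<rho>0 C4 by (intro mult_mono[OF k(2) hn]) auto
        also have "\<dots> = D" using C4 by simp
        finally have "k * (\<rho> * (?h\<^sup>2 + ?n\<^sup>2)) \<le> D" .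
        moreover have "k * (\<rho> * (?u\<^sup>2 + ?r\<^sup>2)) \<le> (\<alpha> * b / 4) * (\<rho> * (?u\<^sup>2 + ?r\<^sup>2))"
          using k \<rho>0 by (intro mult_right_mono) auto
        ultimately show ?thesis by linarith
      qed
      also have "\<dots> = - k * \<rho> * ?N + S" by (simp add: nsq_def algebra_simps)
      finally show "denergy \<alpha> \<gamma> s r u h n (rhs1 \<xi> r u h n + g1) (rhs2 \<xi> r u h n + g2) (rhs3 \<xi> r u h n + g3) (rhs4 \<xi> r u h n + g4)
        \<le> - k * \<rho> * ?N + d * ?N + 3 / d * nsq g1 g2 g3 g4" using S by linarith
    qed
  qed
qed

end

lemma energy_has_derivative:
  assumes "(r has_vector_derivative r') (at t)" "(u has_vector_derivative u') (at t)"
    "(h has_vector_derivative h') (at t)" "(n has_vector_derivative n') (at t)"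
  shows "((\<lambda>t. energy \<alpha> \<gamma> s (r t) (u t) (h t) (n t)) has_real_derivative denergy \<alpha> \<gamma> s (r t) (u t) (h t) (n t) r' u' h' n') (at t)"
proof -
  have ReIm: "((\<lambda>t. Re (f t)) has_real_derivative Re f') (at t)" "((\<lambda>t. Im (f t)) has_real_derivative Im f') (at t)"
    if "(f has_vector_derivative f') (at t)" for f f'
    using bounded_linear.has_vector_derivative[OF bounded_linear_Re that] bounded_linear.has_vector_derivative[OF bounded_linear_Im that]
    by (simp_all add: has_real_derivative_iff_has_vector_derivative)
  have im: "Im (x * cnj y) = Im x * Re y - Re x * Im y" for x y by simp
  note d = ReIm[OF assms(1)] ReIm[OF assms(2)] ReIm[OF assms(3)] ReIm[OF assms(4)]
  show ?thesis
    unfolding energy_def denergy_def nsq_def cmod_power2 im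
    by (rule d refl derivative_eq_intros)+ (simp add: algebra_simps)
qed

lemma exp_decay:
  fixes f :: "real \<Rightarrow> real"
  assumes d: "\<And>t. (f has_real_derivative f' t) (at t)" and le: "\<And>t. f' t \<le> - k * f t" and t: "0 \<le> t"
  shows "f t \<le> exp (- k * t) * f 0"
proof -
  have "f t * exp (k * t) \<le> f 0 * exp (k * 0)"
  proof (rule DERIV_nonpos_imp_nonincreasing[OF t], intro exI conjI)
    fix x :: real
    show "((\<lambda>t. f t * exp (k * t)) has_real_derivative (f' x + k * f x) * exp (k * x)) (at x)"
      using d[of x] by (auto intro!: derivative_eq_intros simp: algebra_simps)
    show "(f' x + k * f x) * exp (k * x) \<le> 0"
      using le[of x] by (intro mult_nonpos_nonneg) auto
  qed
  then show ?thesis by (simp add: exp_minus field_simps)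
qed

text \<open>The integrating factor contains \<open>(2/l) e\<^sup>-\<^sup>l\<^sup>t\<close>, whose derivative cancels the growth term \<open>2 e\<^sup>-\<^sup>l\<^sup>t f\<close>; this growth term is integrable in time and costs only the constant \<open>exp (2/l)\<close>.\<close>

lemma sourced_decay:
  fixes f :: "real \<Rightarrow> real"
  assumes d: "\<And>t. (f has_real_derivative f' t) (at t)"
    and le: "\<And>t. t \<ge> 0 \<Longrightarrow> f' t \<le> - k * f t + 2 * exp (- l * t) * f t + A * exp (- l * t)"
    and f0: "f 0 = 0" and l: "l > 0" and kl: "2 * k \<le> l" and A: "A \<ge> 0" and t: "0 \<le> t" and ft: "f t \<ge> 0"
  shows "f t \<le> (2 / l) * exp (2 / l) * A * exp (- k * t)"
proof -
  define m where "m t = exp (k * t + (2 / l) * exp (- l * t))" for t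
  have m': "(m has_real_derivative (k - 2 * exp (- l * t)) * m t) (at t)" for t
    unfolding m_def using l by (auto intro!: derivative_eq_intros simp: algebra_simps)
  have m0: "m t \<ge> 0" for t by (simp add: m_def)
  define B where "B = A * exp (2 / l)"
  (* The second summand is the integral from t to infinity of the bound for the derivative of the first,
     so Y decreases. *)
  define Y where "Y t = m t * f t + B * ((2 / l) * exp (- (l / 2) * t))" for t
  have "Y t \<le> Y 0"
  proof (rule DERIV_nonpos_imp_nonincreasing[OF t], intro exI conjI)
    fix x :: real assume x: "0 \<le> x"
    show "(Y has_real_derivative ((k - 2 * exp (- l * x)) * m x * f x + m x * f' x - B * exp (- (l / 2) * x))) (at x)"
      unfolding Y_def using d[of x] m'[of x] l
      by (auto intro!: derivative_eq_intros simp: algebra_simps)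
    have "m x * f' x \<le> m x * (- k * f x + 2 * exp (- l * x) * f x + A * exp (- l * x))"
      by (intro mult_left_mono le x m0)
    also have "\<dots> = - ((k - 2 * exp (- l * x)) * m x * f x) + A * (m x * exp (- l * x))"
      by (simp add: algebra_simps)
    also have "m x * exp (- l * x) \<le> exp (2 / l) * exp (- (l / 2) * x)"
    proof -
      have "k * x \<le> (l / 2) * x" using kl x by (intro mult_right_mono) auto
      moreover have "(2 / l) * exp (- l * x) \<le> (2 / l) * 1" using l x by (intro mult_left_mono) auto
      ultimately have "k * x + (2 / l) * exp (- l * x) + - l * x \<le> 2 / l + - (l / 2) * x" by (simp add: algebra_simps)
      then show ?thesis unfolding m_def exp_add[symmetric] by simp
    qed
    then have "A * (m x * exp (- l * x)) \<le> B * exp (- (l / 2) * x)"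
      unfolding B_def using A by (simp add: mult_left_mono mult.assoc)
    finally show "(k - 2 * exp (- l * x)) * m x * f x + m x * f' x - B * exp (- (l / 2) * x) \<le> 0" by simp
  qed
  then have "m t * f t \<le> B * (2 / l)"
  proof -
    have "0 \<le> B * ((2 / l) * exp (- (l / 2) * t))" using A l by (simp add: B_def)
    then show ?thesis using \<open>Y t \<le> Y 0\<close> f0 by (simp add: Y_def)
  qed
  moreover have "exp (k * t) * f t \<le> m t * f t"
    using l ft by (intro mult_right_mono) (auto simp: m_def)
  ultimately have "exp (k * t) * f t \<le> B * (2 / l)" by linarith
  then have "f t \<le> B * (2 / l) / exp (k * t)" by (subst pos_le_divide_eq) (simp_all add: mult.commute)
  then show ?thesis by (simp add: B_def exp_minus divide_inverse ac_simps)
qed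

lemma nsq_add_le: "nsq (r + r') (u + u') (h + h') (n + n') \<le> 2 * nsq r u h n + 2 * nsq r' u' h' n'"
proof -
  have *: "(cmod (x + y))\<^sup>2 \<le> 2 * (cmod x)\<^sup>2 + 2 * (cmod y)\<^sup>2" for x y
  proof -
    have "(cmod (x + y))\<^sup>2 \<le> (cmod x + cmod y)\<^sup>2" by (intro power_mono norm_triangle_ineq) auto
    then show ?thesis using sum_squares_bound[of "cmod x" "cmod y"] by (simp add: power2_sum)
  qed
  show ?thesis using *[of r r'] *[of u u'] *[of h h'] *[of n n'] by (simp add: nsq_def)
qed

context rad_system
begin

text \<open>For \<open>\<bar>\<xi>\<bar> > 1\<close> the energy inequality without source suffices. For \<open>\<bar>\<xi>\<bar> \<le> 1\<close> it is applied to the difference between the solution and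
  \<open>e\<^sup>-\<^sup>l\<^sup>t z (0, 0, m\<^sub>1, - m\<^sub>2)\<close>, the solution for \<open>\<xi> = 0\<close>: this difference vanishes initially, and its source is of order \<open>\<bar>\<xi>\<bar>\<close>.\<close>

lemma frequency_decay:
  "\<exists>C>0. \<exists>k>0. \<forall>\<xi> z r u h n.
     (\<forall>t. (r has_vector_derivative rhs1 \<xi> (r t) (u t) (h t) (n t)) (at t)) \<longrightarrow>
     (\<forall>t. (u has_vector_derivative rhs2 \<xi> (r t) (u t) (h t) (n t)) (at t)) \<longrightarrow>
     (\<forall>t. (h has_vector_derivative rhs3 \<xi> (r t) (u t) (h t) (n t)) (at t)) \<longrightarrow>
     (\<forall>t. (n has_vector_derivative rhs4 \<xi> (r t) (u t) (h t) (n t)) (at t)) \<longrightarrow>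
     r 0 = 0 \<longrightarrow> u 0 = 0 \<longrightarrow> h 0 = of_real m1 * z \<longrightarrow> n 0 = - of_real m2 * z \<longrightarrow>
     (\<forall>t\<ge>0. nsq (r t) (u t) (h t) (n t) \<le> C * (cmod z)\<^sup>2 * (exp (- k * t) + (if \<bar>\<xi>\<bar> \<le> 1 then \<xi>\<^sup>2 * exp (- k * \<xi>\<^sup>2 * t) else 0)))"
proof -
  obtain \<alpha> \<gamma> k where k: "k > 0" and E_all: "\<forall>\<xi> s \<rho> r u h n. s = \<xi> / (1 + \<xi>\<^sup>2) \<longrightarrow> \<rho> = \<xi>\<^sup>2 / (1 + \<xi>\<^sup>2) \<longrightarrow>
     nsq r u h n \<le> 2 * energy \<alpha> \<gamma> s r u h n \<and> energy \<alpha> \<gamma> s r u h n \<le> 2 * nsq r u h n \<and>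
     (\<forall>g1 g2 g3 g4 d. d > 0 \<longrightarrow>
      denergy \<alpha> \<gamma> s r u h n (rhs1 \<xi> r u h n + g1) (rhs2 \<xi> r u h n + g2) (rhs3 \<xi> r u h n + g3) (rhs4 \<xi> r u h n + g4)
      \<le> - k * \<rho> * nsq r u h n + d * nsq r u h n + 3 / d * nsq g1 g2 g3 g4)"
    using energy_inequality by (elim exE conjE) (rule that; assumption)
  define l where "l = m1\<^sup>2 + m2\<^sup>2"
  have l: "l > 0" using pos by (simp add: l_def add_pos_nonneg)
  (* The energy is at most twice the squared norm, which halves k; the bound l / 2 keeps the source integrable
     after multiplication by the growing exponential. *)
  define q where "q = min (k / 2) (l / 2)"
  have q: "q > 0" "q \<le> k / 2" "q \<le> l / 2" using k l by (auto simp: q_def)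
  define G where "G = (b * m1 - c * m2)\<^sup>2 + (U * m1)\<^sup>2 + (2 * (U * m2)\<^sup>2 + 2 * (\<beta> * m2)\<^sup>2)"
  have G: "G \<ge> 0" by (simp add: G_def)
  define C where "C = max (4 * l) (max (2 * l) (4 * ((2 / l) * exp (2 / l) * (3 * G))))"
  have C: "C > 0" "4 * l \<le> C" "2 * l \<le> C" "4 * ((2 / l) * exp (2 / l) * (3 * G)) \<le> C"
    using l by (auto simp: C_def)
  have q2: "q / 2 > 0" using q by simp
  show ?thesis
  proof (rule exI[of _ C], intro conjI C(1), rule exI[of _ "q / 2"], intro conjI q2, intro allI impI)
    fix \<xi> :: real and z :: complex and r u h n :: "real \<Rightarrow> complex" and t :: real
    assume dr: "\<forall>t. (r has_vector_derivative rhs1 \<xi> (r t) (u t) (h t) (n t)) (at t)"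
      and du: "\<forall>t. (u has_vector_derivative rhs2 \<xi> (r t) (u t) (h t) (n t)) (at t)"
      and dh: "\<forall>t. (h has_vector_derivative rhs3 \<xi> (r t) (u t) (h t) (n t)) (at t)"
      and dn: "\<forall>t. (n has_vector_derivative rhs4 \<xi> (r t) (u t) (h t) (n t)) (at t)"
      and i: "r 0 = 0" "u 0 = 0" "h 0 = of_real m1 * z" "n 0 = - of_real m2 * z" and t: "t \<ge> 0"
    define s where "s = \<xi> / (1 + \<xi>\<^sup>2)"
    define \<rho> where "\<rho> = \<xi>\<^sup>2 / (1 + \<xi>\<^sup>2)"
    note E_at = E_all[rule_format, OF s_def \<rho>_def]
    have E: "nsq x1 x2 x3 x4 \<le> 2 * energy \<alpha> \<gamma> s x1 x2 x3 x4 \<and> energy \<alpha> \<gamma> s x1 x2 x3 x4 \<le> 2 * nsq x1 x2 x3 x4"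
      for x1 x2 x3 x4 by (intro conjI E_at[THEN conjunct1] E_at[THEN conjunct2, THEN conjunct1])
    note E_diss = E_at[THEN conjunct2, THEN conjunct2, rule_format]
    have p1: "1 + \<xi>\<^sup>2 > 0" by (simp add: add_pos_nonneg)
    have \<rho>: "0 \<le> \<rho>" "\<rho> \<le> 1" using p1 by (auto simp: \<rho>_def field_simps)
    have Ediss: "- k * \<rho> * nsq x1 x2 x3 x4 \<le> - (q * \<rho>) * energy \<alpha> \<gamma> s x1 x2 x3 x4" for x1 x2 x3 x4
    proof -
      have "energy \<alpha> \<gamma> s x1 x2 x3 x4 \<ge> 0" using E[of x1 x2 x3 x4] nsq_nonneg[of x1 x2 x3 x4] by linarith
      then have "(q * \<rho>) * energy \<alpha> \<gamma> s x1 x2 x3 x4 \<le> (k / 2 * \<rho>) * (2 * nsq x1 x2 x3 x4)"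
        using E[of x1 x2 x3 x4] q \<rho> by (intro mult_mono) auto
      then show ?thesis by simp
    qed
    have nsqz: "nsq 0 0 (of_real m1 * z) (- of_real m2 * z) = l * (cmod z)\<^sup>2"
      by (simp add: nsq_def l_def norm_mult power_mult_distrib algebra_simps)
    show "nsq (r t) (u t) (h t) (n t) \<le> C * (cmod z)\<^sup>2 * (exp (- (q / 2) * t) + (if \<bar>\<xi>\<bar> \<le> 1 then \<xi>\<^sup>2 * exp (- (q / 2) * \<xi>\<^sup>2 * t) else 0))"
    proof (cases "\<bar>\<xi>\<bar> \<le> 1")
      case False
      then have "\<xi>\<^sup>2 \<ge> 1" using one_le_power[of "\<bar>\<xi>\<bar>" 2] by simp
      then have \<rho>h: "1 / 2 \<le> \<rho>" using p1 by (simp add: \<rho>_def field_simps)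
      define F where "F t = energy \<alpha> \<gamma> s (r t) (u t) (h t) (n t)" for t
      define F' where "F' t = denergy \<alpha> \<gamma> s (r t) (u t) (h t) (n t) (rhs1 \<xi> (r t) (u t) (h t) (n t))
         (rhs2 \<xi> (r t) (u t) (h t) (n t)) (rhs3 \<xi> (r t) (u t) (h t) (n t)) (rhs4 \<xi> (r t) (u t) (h t) (n t))" for t
      have F0: "F t \<ge> 0" for t using E[of "r t" "u t" "h t" "n t"] nsq_nonneg[of "r t" "u t" "h t" "n t"] unfolding F_def by linarith
      have FF: "(F has_real_derivative F' t) (at t)" for t
        unfolding F_def F'_def using dr du dh dn by (intro energy_has_derivative) auto
      have Fle: "F' t \<le> - (q / 2) * F t" for t
      proof -
        let ?N = "nsq (r t) (u t) (h t) (n t)"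
        have "F' t \<le> - k * \<rho> * ?N + e" if e: "e > 0" for e
        proof -
          (* Without source the free parameter may tend to zero. *)
          define d where "d = e / (?N + 1)"
          have N: "?N + 1 > 0" using nsq_nonneg[of "r t" "u t" "h t" "n t"] by simp
          have d: "d > 0" using e N by (simp add: d_def)
          have "F' t \<le> - k * \<rho> * ?N + d * ?N + 3 / d * nsq 0 0 0 0"
            using E_diss[OF d, of "r t" "u t" "h t" "n t" 0 0 0 0] unfolding F'_def by simp
          also have "d * ?N \<le> e" using e N by (simp add: d_def field_simps)
          finally show ?thesis by (simp add: nsq_def)
        qed
        then have "F' t \<le> - k * \<rho> * ?N" by (rule field_le_epsilon)
        also have "\<dots> \<le> - (q * \<rho>) * F t" unfolding F_def by (rule Ediss)
        also have "\<dots> \<le> - (q / 2) * F t"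
        proof -
          have "q / 2 * F t \<le> (q * \<rho>) * F t" using q \<rho>h F0 by (intro mult_right_mono) auto
          then show ?thesis by simp
        qed
        finally show ?thesis .
      qed
      have "F t \<le> exp (- (q / 2) * t) * F 0" by (rule exp_decay[OF FF Fle t])
      moreover have "F 0 \<le> 2 * (l * (cmod z)\<^sup>2)" using E[of "r 0" "u 0" "h 0" "n 0"] unfolding F_def i nsqz by simp
      ultimately have "F t \<le> exp (- (q / 2) * t) * (2 * (l * (cmod z)\<^sup>2))"
        by (meson exp_ge_zero mult_left_mono order_trans)
      then have "2 * F t \<le> 2 * (exp (- (q / 2) * t) * (2 * (l * (cmod z)\<^sup>2)))" by (rule mult_left_mono) simp
      moreover have "nsq (r t) (u t) (h t) (n t) \<le> 2 * F t" using E[of "r t" "u t" "h t" "n t"] by (simp add: F_def)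
      ultimately have "nsq (r t) (u t) (h t) (n t) \<le> 2 * (exp (- (q / 2) * t) * (2 * (l * (cmod z)\<^sup>2)))" by (rule order_trans[rotated])
      also have "\<dots> = (4 * l) * ((cmod z)\<^sup>2 * exp (- (q / 2) * t))" by simp
      also have "\<dots> \<le> C * ((cmod z)\<^sup>2 * exp (- (q / 2) * t))" by (intro mult_right_mono C) auto
      finally show ?thesis using False by (simp add: ac_simps)
    next
      case True
      then have \<xi>1: "\<xi>\<^sup>2 \<le> 1" by (simp add: abs_square_le_1)
      have \<rho>l: "\<xi>\<^sup>2 / 2 \<le> \<rho>"
        unfolding \<rho>_def using \<xi>1 p1 by (intro divide_left_mono) auto
      define e where "e t = exp (- l * t)" for t
      have e': "((\<lambda>t. complex_of_real (e t)) has_vector_derivative of_real (- l * e t)) (at t)" for t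
      proof -
        have "(e has_real_derivative - l * e t) (at t)"
          unfolding e_def by (auto intro!: derivative_eq_intros)
        then show ?thesis
          by (intro has_vector_derivative_of_real) (simp add: has_real_derivative_iff_has_vector_derivative)
      qed
      (* H and N are the last two components of the difference; the first two do not change. The sources g2, g3, g4
         are the terms with a factor \<xi> that the subtracted function leaves over. *)
      define H where "H t = h t - of_real m1 * z * of_real (e t)" for t
      define N where "N t = n t + of_real m2 * z * of_real (e t)" for t
      define g2 where "g2 t = - \<i> * of_real \<xi> * z * of_real (e t * (b * m1 - c * m2))" for t
      define g3 where "g3 t = - \<i> * of_real \<xi> * z * of_real (e t * (U * m1))" for t
      define g4 where "g4 t = (\<i> * of_real (\<xi> * (U * m2)) + of_real (\<xi>\<^sup>2 * (\<beta> * m2))) * z * of_real (e t)" for t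
      have dr': "(r has_vector_derivative rhs1 \<xi> (r t) (u t) (H t) (N t) + 0) (at t)" for t
        using dr by (simp add: rhs1_def)
      have du': "(u has_vector_derivative rhs2 \<xi> (r t) (u t) (H t) (N t) + g2 t) (at t)" for t
      proof -
        have "rhs2 \<xi> (r t) (u t) (H t) (N t) + g2 t = rhs2 \<xi> (r t) (u t) (h t) (n t)"
          by (simp add: rhs2_def H_def N_def g2_def algebra_simps)
        then show ?thesis using du by simp
      qed
      have dH: "(H has_vector_derivative rhs3 \<xi> (r t) (u t) (H t) (N t) + g3 t) (at t)" for t
      proof -
        have "(H has_vector_derivative rhs3 \<xi> (r t) (u t) (h t) (n t) - of_real m1 * z * of_real (- l * e t)) (at t)"
          unfolding H_def using dh by (intro has_vector_derivative_diff has_vector_derivative_mult_right e') auto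
        moreover have "rhs3 \<xi> (r t) (u t) (h t) (n t) - of_real m1 * z * of_real (- l * e t) = rhs3 \<xi> (r t) (u t) (H t) (N t) + g3 t"
          by (simp add: rhs3_def H_def N_def g3_def l_def power2_eq_square algebra_simps)
        ultimately show ?thesis by simp
      qed
      have dN: "(N has_vector_derivative rhs4 \<xi> (r t) (u t) (H t) (N t) + g4 t) (at t)" for t
      proof -
        have "(N has_vector_derivative rhs4 \<xi> (r t) (u t) (h t) (n t) + of_real m2 * z * of_real (- l * e t)) (at t)"
          unfolding N_def using dn by (intro has_vector_derivative_add has_vector_derivative_mult_right e') auto
        moreover have "rhs4 \<xi> (r t) (u t) (h t) (n t) + of_real m2 * z * of_real (- l * e t) = rhs4 \<xi> (r t) (u t) (H t) (N t) + g4 t"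
          by (simp add: rhs4_def H_def N_def g4_def l_def power2_eq_square algebra_simps)
        ultimately show ?thesis by simp
      qed
      have g: "nsq 0 (g2 t) (g3 t) (g4 t) \<le> G * \<xi>\<^sup>2 * (cmod z)\<^sup>2 * (e t)\<^sup>2" for t
      proof -
        have "(cmod (g2 t))\<^sup>2 = (b * m1 - c * m2)\<^sup>2 * (\<xi>\<^sup>2 * (cmod z)\<^sup>2 * (e t)\<^sup>2)"
          "(cmod (g3 t))\<^sup>2 = (U * m1)\<^sup>2 * (\<xi>\<^sup>2 * (cmod z)\<^sup>2 * (e t)\<^sup>2)"
          unfolding g2_def g3_def norm_mult norm_of_real norm_minus_cancel norm_ii power_mult_distrib power2_abs by simp_all
        moreover have "(cmod (g4 t))\<^sup>2 \<le> (2 * (U * m2)\<^sup>2 + 2 * (\<beta> * m2)\<^sup>2) * (\<xi>\<^sup>2 * (cmod z)\<^sup>2 * (e t)\<^sup>2)"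
        proof -
          have "(cmod (\<i> * of_real (\<xi> * (U * m2)) + of_real (\<xi>\<^sup>2 * (\<beta> * m2))))\<^sup>2 = \<xi>\<^sup>2 * (U * m2)\<^sup>2 + \<xi>\<^sup>2 * (\<xi>\<^sup>2 * (\<beta> * m2)\<^sup>2)"
          proof -
            have "(cmod (\<i> * of_real x + of_real y))\<^sup>2 = x\<^sup>2 + y\<^sup>2" for x y
              by (simp add: cmod_power2)
            then show ?thesis by (simp only: power_mult_distrib) (simp add: power2_eq_square)
          qed
          also have "\<dots> \<le> \<xi>\<^sup>2 * (2 * (U * m2)\<^sup>2) + \<xi>\<^sup>2 * (1 * (2 * (\<beta> * m2)\<^sup>2))"
            using \<xi>1 by (intro add_mono mult_left_mono mult_mono) auto
          finally have "(cmod (\<i> * of_real (\<xi> * (U * m2)) + of_real (\<xi>\<^sup>2 * (\<beta> * m2))))\<^sup>2 \<le> (2 * (U * m2)\<^sup>2 + 2 * (\<beta> * m2)\<^sup>2) * \<xi>\<^sup>2"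
            by (simp add: algebra_simps)
          then have "(cmod (\<i> * of_real (\<xi> * (U * m2)) + of_real (\<xi>\<^sup>2 * (\<beta> * m2))))\<^sup>2 * ((cmod z)\<^sup>2 * (e t)\<^sup>2) \<le> ((2 * (U * m2)\<^sup>2 + 2 * (\<beta> * m2)\<^sup>2) * \<xi>\<^sup>2) * ((cmod z)\<^sup>2 * (e t)\<^sup>2)"
            by (intro mult_right_mono) auto
          then show ?thesis unfolding g4_def norm_mult[of _ "of_real (e t)"] norm_mult[of _ z] norm_of_real power_mult_distrib power2_abs
            by (simp add: mult.assoc)
        qed
        ultimately have "nsq 0 (g2 t) (g3 t) (g4 t) \<le> (b * m1 - c * m2)\<^sup>2 * (\<xi>\<^sup>2 * (cmod z)\<^sup>2 * (e t)\<^sup>2) + (U * m1)\<^sup>2 * (\<xi>\<^sup>2 * (cmod z)\<^sup>2 * (e t)\<^sup>2)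
            + (2 * (U * m2)\<^sup>2 + 2 * (\<beta> * m2)\<^sup>2) * (\<xi>\<^sup>2 * (cmod z)\<^sup>2 * (e t)\<^sup>2)" by (simp add: nsq_def)
        then show ?thesis unfolding G_def by (simp add: distrib_right mult.assoc)
      qed
      define F where "F t = energy \<alpha> \<gamma> s (r t) (u t) (H t) (N t)" for t
      define F' where "F' t = denergy \<alpha> \<gamma> s (r t) (u t) (H t) (N t) (rhs1 \<xi> (r t) (u t) (H t) (N t) + 0)
         (rhs2 \<xi> (r t) (u t) (H t) (N t) + g2 t) (rhs3 \<xi> (r t) (u t) (H t) (N t) + g3 t) (rhs4 \<xi> (r t) (u t) (H t) (N t) + g4 t)" for t
      have F0: "F t \<ge> 0" for t using E[of "r t" "u t" "H t" "N t"] nsq_nonneg[of "r t" "u t" "H t" "N t"] unfolding F_def by linarith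
      have FF: "(F has_real_derivative F' t) (at t)" for t
        unfolding F_def F'_def using dr' du' dH dN by (intro energy_has_derivative) auto
      (* The energy inequality with d = e t: the source is then of order e t, and so is the growth rate. *)
      have Fle: "F' t \<le> - (q * \<rho>) * F t + 2 * exp (- l * t) * F t + (3 * (G * \<xi>\<^sup>2 * (cmod z)\<^sup>2)) * exp (- l * t)" for t
      proof -
        let ?N = "nsq (r t) (u t) (H t) (N t)"
        have "e t > 0" by (simp add: e_def)
        then have "F' t \<le> - k * \<rho> * ?N + e t * ?N + 3 / e t * nsq 0 (g2 t) (g3 t) (g4 t)"
          unfolding F'_def by (rule E_diss)
        also have "\<dots> \<le> - (q * \<rho>) * F t + e t * (2 * F t) + 3 / e t * (G * \<xi>\<^sup>2 * (cmod z)\<^sup>2 * (e t)\<^sup>2)"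
          using \<open>e t > 0\<close> E[of "r t" "u t" "H t" "N t"] unfolding F_def by (intro add_mono Ediss mult_left_mono g) auto
        also have "3 / e t * (G * \<xi>\<^sup>2 * (cmod z)\<^sup>2 * (e t)\<^sup>2) = (3 * (G * \<xi>\<^sup>2 * (cmod z)\<^sup>2)) * e t"
          using \<open>e t > 0\<close> by (simp add: power2_eq_square)
        finally show ?thesis by (simp add: e_def ac_simps)
      qed
      have "F 0 = 0" unfolding F_def H_def N_def i by (simp add: e_def energy_def nsq_def)
      have "F t \<le> (2 / l) * exp (2 / l) * (3 * (G * \<xi>\<^sup>2 * (cmod z)\<^sup>2)) * exp (- (q * \<rho>) * t)"
      proof (rule sourced_decay[OF FF Fle \<open>F 0 = 0\<close> l _ _ t F0])
        show "2 * (q * \<rho>) \<le> l" using mult_mono[of q "l / 2" \<rho> 1] q \<rho> l by simp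
        show "0 \<le> 3 * (G * \<xi>\<^sup>2 * (cmod z)\<^sup>2)" using G by simp
      qed
      also have "\<dots> \<le> (2 / l) * exp (2 / l) * (3 * (G * \<xi>\<^sup>2 * (cmod z)\<^sup>2)) * exp (- (q / 2) * \<xi>\<^sup>2 * t)"
      proof (intro mult_left_mono)
        have "(q / 2) * \<xi>\<^sup>2 * t \<le> (q * \<rho>) * t"
          using \<rho>l q t by (intro mult_right_mono) auto
        then show "exp (- (q * \<rho>) * t) \<le> exp (- (q / 2) * \<xi>\<^sup>2 * t)" by simp
      qed (use G l in auto)
      finally have Fb: "F t \<le> (2 / l) * exp (2 / l) * (3 * (G * \<xi>\<^sup>2 * (cmod z)\<^sup>2)) * exp (- (q / 2) * \<xi>\<^sup>2 * t)" .
      have "nsq (r t) (u t) (h t) (n t) = nsq (r t + 0) (u t + 0) (H t + of_real m1 * z * of_real (e t)) (N t + - of_real m2 * z * of_real (e t))"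
        by (simp add: H_def N_def)
      also have "\<dots> \<le> 2 * nsq (r t) (u t) (H t) (N t) + 2 * nsq 0 0 (of_real m1 * z * of_real (e t)) (- of_real m2 * z * of_real (e t))"
        by (rule nsq_add_le)
      also have "nsq 0 0 (of_real m1 * z * of_real (e t)) (- of_real m2 * z * of_real (e t)) = l * (cmod z)\<^sup>2 * (e t)\<^sup>2"
        by (simp add: nsq_def l_def norm_mult power_mult_distrib algebra_simps)
      also have "(e t)\<^sup>2 \<le> exp (- (q / 2) * t)"
      proof -
        have "q / 2 * t \<le> (2 * l) * t" using q l t by (intro mult_right_mono) auto
        then have "- l * t + - l * t \<le> - (q / 2) * t" by simp
        then show ?thesis unfolding e_def power2_eq_square exp_add[symmetric] by simp
      qed
      also have "nsq (r t) (u t) (H t) (N t) \<le> 2 * F t" using E[of "r t" "u t" "H t" "N t"] by (simp add: F_def)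
      also note Fb
      finally have "nsq (r t) (u t) (h t) (n t) \<le> 2 * (2 * ((2 / l) * exp (2 / l) * (3 * (G * \<xi>\<^sup>2 * (cmod z)\<^sup>2)) * exp (- (q / 2) * \<xi>\<^sup>2 * t))) + 2 * (l * (cmod z)\<^sup>2 * exp (- (q / 2) * t))"
        using l by (simp add: mult_left_mono)
      also have "\<dots> = (4 * ((2 / l) * exp (2 / l) * (3 * G))) * ((cmod z)\<^sup>2 * (\<xi>\<^sup>2 * exp (- (q / 2) * \<xi>\<^sup>2 * t))) + (2 * l) * ((cmod z)\<^sup>2 * exp (- (q / 2) * t))"
        by (simp add: ac_simps)
      also have "\<dots> \<le> C * ((cmod z)\<^sup>2 * (\<xi>\<^sup>2 * exp (- (q / 2) * \<xi>\<^sup>2 * t))) + C * ((cmod z)\<^sup>2 * exp (- (q / 2) * t))"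
        by (intro add_mono mult_right_mono C) auto
      finally show ?thesis using True by (simp add: algebra_simps)
    qed
  qed
qed

end

section \<open>The matrix exponential\<close>

lemma sums_vecI:
  fixes f :: "nat \<Rightarrow> 'a::real_normed_vector ^ 'n"
  assumes "\<And>i. (\<lambda>k. f k $ i) sums (s $ i)"
  shows "f sums s"
  unfolding sums_def
proof (rule vec_tendstoI)
  fix i show "(\<lambda>n. (\<Sum>k<n. f k) $ i) \<longlonglongrightarrow> s $ i"
    using assms[of i] by (simp add: sums_def)
qed

lemma mat_power_bound:
  fixes A :: "complex^'n^'n"
  shows "cmod (mat_power A k $ i $ j) \<le> (\<Sum>i\<in>UNIV. \<Sum>j\<in>UNIV. cmod (A $ i $ j)) ^ k"
proof (induction k arbitrary: i j)
  case 0 then show ?case by (simp add: mat_def)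
next
  case (Suc k)
  let ?K = "\<Sum>i\<in>UNIV. \<Sum>j\<in>UNIV. cmod (A $ i $ j)"
  have "cmod (mat_power A (Suc k) $ i $ j) = cmod (\<Sum>l\<in>UNIV. A $ i $ l * mat_power A k $ l $ j)"
    by (simp add: matrix_matrix_mult_def)
  also have "\<dots> \<le> (\<Sum>l\<in>UNIV. cmod (A $ i $ l) * ?K ^ k)"
    by (intro order_trans[OF norm_sum] sum_mono) (auto simp: norm_mult intro!: mult_left_mono Suc)
  also have "\<dots> = (\<Sum>l\<in>UNIV. cmod (A $ i $ l)) * ?K ^ k" by (simp add: sum_distrib_right)
  also have "\<dots> \<le> ?K * ?K ^ k"
    by (intro mult_right_mono member_le_sum[where f="\<lambda>i. \<Sum>l\<in>UNIV. cmod (A $ i $ l)"]) (auto intro!: sum_nonneg zero_le_power)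
  finally show ?case by simp
qed

lemma mat_power_scale: "mat_power (scale_mat z A) k $ i $ j = z ^ k * mat_power A k $ i $ j"
proof (induction k arbitrary: i j)
  case 0 then show ?case by simp
next
  case (Suc k)
  then show ?case by (simp add: matrix_matrix_mult_def scale_mat_def map_matrix_def sum_distrib_left ac_simps)
qed

lemma summable_mat_exp_entry:
  fixes A :: "complex^'n^'n"
  shows "summable (\<lambda>k. mat_power A k $ i $ j / fact k * z ^ k)"
proof (rule summable_comparison_test'[where N=0])
  let ?K = "\<Sum>i\<in>UNIV. \<Sum>j\<in>UNIV. cmod (A $ i $ j)"
  show "summable (\<lambda>k. inverse (fact k) * (?K * cmod z) ^ k)" by (rule summable_exp)
  fix k :: nat
  show "norm (mat_power A k $ i $ j / fact k * z ^ k) \<le> inverse (fact k) * (?K * cmod z) ^ k"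
  proof -
    have "norm (mat_power A k $ i $ j / fact k * z ^ k) = cmod (mat_power A k $ i $ j) * (cmod z ^ k / fact k)"
      by (simp add: norm_mult norm_divide norm_power)
    also have "\<dots> \<le> ?K ^ k * (cmod z ^ k / fact k)"
      by (intro mult_right_mono mat_power_bound) simp
    finally show ?thesis by (simp add: power_mult_distrib divide_inverse ac_simps)
  qed
qed

text \<open>Entrywise the exponential is a power series in \<open>z\<close>, so the library results on scalar power series apply.\<close>

lemma mat_exp_entry:
  fixes A :: "complex^'n^'n"
  shows "mat_exp (scale_mat z A) $ i $ j = (\<Sum>k. mat_power A k $ i $ j / fact k * z ^ k)"
proof -
  let ?S = "\<chi> i j. \<Sum>k. mat_power A k $ i $ j / fact k * z ^ k"
  have "(\<lambda>k. (1 / fact k) *\<^sub>R mat_power (scale_mat z A) k) sums ?S"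
  proof (intro sums_vecI)
    fix i j
    have "(\<lambda>k. mat_power A k $ i $ j / fact k * z ^ k) sums (?S $ i $ j)"
      using summable_mat_exp_entry[of A i j z] by (simp add: summable_sums)
    moreover have "((1 / fact k) *\<^sub>R mat_power (scale_mat z A) k) $ i $ j = mat_power A k $ i $ j / fact k * z ^ k" for k
      by (simp add: mat_power_scale) (simp add: scaleR_conv_of_real divide_inverse ac_simps)
    ultimately show "(\<lambda>k. ((1 / fact k) *\<^sub>R mat_power (scale_mat z A) k) $ i $ j) sums (?S $ i $ j)" by simp
  qed
  then have "mat_exp (scale_mat z A) = ?S" unfolding mat_exp_def by (rule sums_unique[symmetric])
  then show ?thesis by simp
qed

lemma mat_exp_entry_deriv:
  fixes A :: "complex^'n^'n"
  shows "((\<lambda>z. mat_exp (scale_mat z A) $ i $ j) has_field_derivative (\<Sum>l\<in>UNIV. A $ i $ l * mat_exp (scale_mat z A) $ l $ j)) (at z)"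
proof -
  let ?c = "\<lambda>i k. mat_power A k $ i $ j / fact k"
  have "((\<lambda>z. \<Sum>k. ?c i k * z ^ k) has_field_derivative (\<Sum>k. diffs (?c i) k * z ^ k)) (at z)"
    by (rule termdiffs_strong_converges_everywhere) (rule summable_mat_exp_entry)
  moreover have "diffs (?c i) k * z ^ k = (\<Sum>l\<in>UNIV. A $ i $ l * (?c l k * z ^ k))" for k
  proof -
    have "of_nat (Suc k) * (x / fact (Suc k)) = x / fact k" for x :: complex
      by (simp add: fact_Suc del: of_nat_Suc)
    then have "diffs (?c i) k = mat_power A (Suc k) $ i $ j / fact k" unfolding diffs_def by blast
    then show ?thesis
      by (simp add: matrix_matrix_mult_def sum_distrib_right sum_divide_distrib mult.assoc)
  qed
  moreover have "(\<Sum>k. \<Sum>l\<in>UNIV. A $ i $ l * (?c l k * z ^ k)) = (\<Sum>l\<in>UNIV. A $ i $ l * (\<Sum>k. ?c l k * z ^ k))"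
    by (intro sums_unique[symmetric] sums_sum sums_mult summable_sums summable_mat_exp_entry)
  ultimately show ?thesis unfolding mat_exp_entry by simp
qed

lemma mat_exp_flow:
  fixes A :: "complex^'n^'n"
  shows "((\<lambda>t. (mat_exp (scale_mat (of_real t) A) *v x) $ i) has_vector_derivative
     (A *v (mat_exp (scale_mat (of_real t) A) *v x)) $ i) (at t)"
proof -
  have "((\<lambda>t. \<Sum>j\<in>UNIV. mat_exp (scale_mat (of_real t) A) $ i $ j * x $ j) has_vector_derivative
    (\<Sum>j\<in>UNIV. (\<Sum>l\<in>UNIV. A $ i $ l * mat_exp (scale_mat (of_real t) A) $ l $ j) * x $ j)) (at t)"
    by (intro has_vector_derivative_sum has_vector_derivative_mult_left has_vector_derivative_real_field mat_exp_entry_deriv)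
  moreover have "(\<Sum>j\<in>UNIV. (\<Sum>l\<in>UNIV. A $ i $ l * mat_exp (scale_mat (of_real t) A) $ l $ j) * x $ j)
     = (A *v (mat_exp (scale_mat (of_real t) A) *v x)) $ i"
    unfolding matrix_vector_mult_def
    by (simp add: sum_distrib_left sum_distrib_right mult.assoc) (rule sum.swap)
  ultimately show ?thesis by (simp add: matrix_vector_mult_def)
qed

lemma mat_exp_0:
  fixes A :: "complex^'n^'n"
  shows "mat_exp (scale_mat 0 A) *v x = x"
proof -
  have "mat_exp (scale_mat 0 A) $ i $ j = mat 1 $ i $ j" for i j
    unfolding mat_exp_entry by (subst powser_zero) simp
  then have "mat_exp (scale_mat 0 A) = mat 1" by (simp add: vec_eq_iff)
  then show ?thesis by simp
qed

lemma measurable_mat_exp_entry: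
  fixes A :: "real \<Rightarrow> complex^'n^'n"
  assumes [measurable]: "\<And>i j. (\<lambda>\<xi>. A \<xi> $ i $ j) \<in> borel_measurable borel"
  shows "(\<lambda>\<xi>. mat_exp (scale_mat z (A \<xi>)) $ i $ j) \<in> borel_measurable borel"
proof -
  have [measurable]: "(\<lambda>\<xi>. mat_power (A \<xi>) k $ i $ j) \<in> borel_measurable borel" for k i j
  proof (induction k arbitrary: i j)
    case (Suc k)
    note [measurable] = Suc
    show ?case by (simp add: matrix_matrix_mult_def)
  qed simp
  show ?thesis unfolding mat_exp_entry by measurable
qed

lemma complex_mat_mult: "complex_mat (A ** B) = complex_mat A ** complex_mat B"
  by (simp add: complex_mat_def map_matrix_def matrix_matrix_mult_def vec_eq_iff)

lemma complex_mat_1: "complex_mat (mat 1) = mat 1"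
  by (simp add: complex_mat_def map_matrix_def mat_def vec_eq_iff)

lemma complex_mat_nth: "complex_mat A $ i $ j = complex_of_real (A $ i $ j)"
  by (simp add: complex_mat_def map_matrix_def)

lemma complex_mat_minus: "complex_mat (- A) = - complex_mat A"
  by (simp add: vec_eq_iff complex_mat_nth)

lemma scale_mat_mult_vec: "scale_mat z A *v x = z *s (A *v x)"
  by (simp add: scale_mat_def map_matrix_def matrix_vector_mult_def vec_eq_iff sum_distrib_left ac_simps)

section \<open>Thermodynamics and the change of variables\<close>

lemma has_derivative_vecI:
  fixes f :: "'a::real_normed_vector \<Rightarrow> real ^ 'n"
  assumes "\<And>i. ((\<lambda>x. f x $ i) has_derivative (\<lambda>h. f' h $ i)) (at x)"
  shows "(f has_derivative f') (at x)"
  unfolding has_derivative_componentwise_within[of f] using assms by (auto simp: Basis_vec_def inner_axis)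

lemma has_derivative_vec4I:
  fixes f :: "'a::real_normed_vector \<Rightarrow> real ^ 4"
  assumes "((\<lambda>x. f x $ 1) has_derivative (\<lambda>h. f' h $ 1)) (at x)" "((\<lambda>x. f x $ 2) has_derivative (\<lambda>h. f' h $ 2)) (at x)"
    "((\<lambda>x. f x $ 3) has_derivative (\<lambda>h. f' h $ 3)) (at x)" "((\<lambda>x. f x $ 4) has_derivative (\<lambda>h. f' h $ 4)) (at x)"
  shows "(f has_derivative f') (at x)"
proof (rule has_derivative_vecI)
  fix i :: 4
  show "((\<lambda>x. f x $ i) has_derivative (\<lambda>h. f' h $ i)) (at x)"
    using assms exhaust_4[of i] by auto
qed

text \<open>Links the partial derivatives \<open>d_rho\<close> and \<open>d_theta\<close>, defined one variable at a time, to the total derivative.\<close>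

lemma partial_derivatives:
  fixes f :: "real \<times> real \<Rightarrow> real"
  assumes "f differentiable (at (\<rho>, \<theta>))"
  shows "(f has_derivative (\<lambda>(x, y). d_rho f \<rho> \<theta> * x + d_theta f \<rho> \<theta> * y)) (at (\<rho>, \<theta>))"
    and "((\<lambda>t. f (\<rho>, t)) has_real_derivative d_theta f \<rho> \<theta>) (at \<theta>)"
proof -
  obtain D where D: "(f has_derivative D) (at (\<rho>, \<theta>))" using assms differentiable_def by blast
  then have lin: "linear D" by (rule has_derivative_linear)
  have 1: "((\<lambda>r. f (r, \<theta>)) has_derivative (\<lambda>x. D (x, 0))) (at \<rho>)"
    by (rule has_derivative_compose[where g=f and f="\<lambda>r. (r, \<theta>)" and f'="\<lambda>r. (r, 0)", OF _ D]) (intro has_derivative_Pair has_derivative_ident has_derivative_const)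
  have 2: "((\<lambda>t. f (\<rho>, t)) has_derivative (\<lambda>y. D (0, y))) (at \<theta>)"
    by (rule has_derivative_compose[where g=f and f="\<lambda>r. (\<rho>, r)" and f'="\<lambda>r. (0, r)", OF _ D]) (intro has_derivative_Pair has_derivative_ident has_derivative_const)
  have e1: "D (x, 0) = D (1, 0) * x" and e2: "D (0, x) = D (0, 1) * x" for x
    using linear_cmul[OF lin, of x "(1, 0)"] linear_cmul[OF lin, of x "(0, 1)"] by simp_all
  have d1: "((\<lambda>r. f (r, \<theta>)) has_real_derivative D (1, 0)) (at \<rho>)"
  proof -
    have "(\<lambda>x. D (x, 0)) = (*) (D (1, 0))" by (rule ext) (rule e1)
    then show ?thesis using 1 unfolding has_field_derivative_def by metis
  qed
  have d2: "((\<lambda>t. f (\<rho>, t)) has_real_derivative D (0, 1)) (at \<theta>)"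
  proof -
    have "(\<lambda>x. D (0, x)) = (*) (D (0, 1))" by (rule ext) (rule e2)
    then show ?thesis using 2 unfolding has_field_derivative_def by metis
  qed
  have r: "d_rho f \<rho> \<theta> = D (1, 0)" "d_theta f \<rho> \<theta> = D (0, 1)"
    using d1 d2 by (auto simp: d_rho_def d_theta_def DERIV_imp_deriv)
  have "D = (\<lambda>(x, y). d_rho f \<rho> \<theta> * x + d_theta f \<rho> \<theta> * y)"
  proof
    fix z :: "real \<times> real"
    obtain x y where z: "z = (x, y)" by (cases z)
    have "D z = D (x, 0) + D (0, y)" using linear_add[OF lin, of "(x, 0)" "(0, y)"] by (simp add: z)
    then show "D z = (case z of (x, y) \<Rightarrow> d_rho f \<rho> \<theta> * x + d_theta f \<rho> \<theta> * y)"
      using e1[of x] e2[of y] by (simp add: z r)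
  qed
  then show "(f has_derivative (\<lambda>(x, y). d_rho f \<rho> \<theta> * x + d_theta f \<rho> \<theta> * y)) (at (\<rho>, \<theta>))" using D by simp
  show "((\<lambda>t. f (\<rho>, t)) has_real_derivative d_theta f \<rho> \<theta>) (at \<theta>)" using d2 r by simp
qed

lemma vec4_nth [simp]:
  "(vector [a, b, c, d] :: 'a::zero ^ 4) $ 1 = a" "(vector [a, b, c, d] :: 'a::zero ^ 4) $ 2 = b"
  "(vector [a, b, c, d] :: 'a::zero ^ 4) $ 3 = c" "(vector [a, b, c, d] :: 'a::zero ^ 4) $ 4 = d"
  unfolding vector_def by simp_all

locale fluid =
  fixes p e s :: "real \<times> real \<Rightarrow> real" and \<sigma>a \<sigma>s :: real
  assumes laws: "thermodynamic_laws p e s" and \<sigma>a: "\<sigma>a > 0" and \<sigma>s: "\<sigma>s > 0"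
begin

lemma smooth_differentiable:
  assumes "smooth_on f thermo_domain" "\<rho> > 0" "\<theta> > 0"
  shows "f differentiable (at (\<rho>, \<theta>))"
  using assms(1)[unfolded smooth_on_def, rule_format, of "Suc 0"] assms(2,3) by (auto simp: thermo_domain_def)

lemma thermo_differentiable:
  assumes "\<rho> > 0" "\<theta> > 0"
  shows "p differentiable (at (\<rho>, \<theta>))" "e differentiable (at (\<rho>, \<theta>))" "s differentiable (at (\<rho>, \<theta>))"
  using laws smooth_differentiable[OF _ assms] by (auto simp: thermodynamic_laws_def)

lemma thermodynamic_relations:
  assumes "\<rho> > 0" "\<theta> > 0"
  shows "d_rho p \<rho> \<theta> > 0" "d_theta p \<rho> \<theta> > 0" "d_theta e \<rho> \<theta> > 0"
    "d_rho e \<rho> \<theta> = (p (\<rho>, \<theta>) - \<theta> * d_theta p \<rho> \<theta>) / \<rho>\<^sup>2"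
    "d_rho s \<rho> \<theta> = - d_theta p \<rho> \<theta> / \<rho>\<^sup>2" "d_theta s \<rho> \<theta> = d_theta e \<rho> \<theta> / \<theta>"
proof -
  have "(\<rho>, \<theta>) \<in> thermo_domain" using assms by (simp add: thermo_domain_def)
  moreover have "\<forall>(\<rho>, \<theta>) \<in> thermo_domain.
        p (\<rho>, \<theta>) > 0 \<and> d_rho p \<rho> \<theta> > 0 \<and> d_theta p \<rho> \<theta> > 0 \<and> d_theta e \<rho> \<theta> > 0 \<and>
        d_rho e \<rho> \<theta> = (p (\<rho>, \<theta>) - \<theta> * d_theta p \<rho> \<theta>) / \<rho>\<^sup>2 \<and>
        d_rho s \<rho> \<theta> = - d_theta p \<rho> \<theta> / \<rho>\<^sup>2 \<and>
        d_theta s \<rho> \<theta> = d_theta e \<rho> \<theta> / \<theta>"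
    using laws unfolding thermodynamic_laws_def by blast
  ultimately show "d_rho p \<rho> \<theta> > 0" "d_theta p \<rho> \<theta> > 0" "d_theta e \<rho> \<theta> > 0"
    "d_rho e \<rho> \<theta> = (p (\<rho>, \<theta>) - \<theta> * d_theta p \<rho> \<theta>) / \<rho>\<^sup>2"
    "d_rho s \<rho> \<theta> = - d_theta p \<rho> \<theta> / \<rho>\<^sup>2" "d_theta s \<rho> \<theta> = d_theta e \<rho> \<theta> / \<theta>" by auto
qed

lemma state_function_has_derivative:
  fixes f :: "real \<times> real \<Rightarrow> real" and V :: "real^4"
  assumes "f differentiable (at (V$1, V$3))"
  shows "((\<lambda>V. f (V$1, V$3)) has_derivative (\<lambda>v. d_rho f (V$1) (V$3) * v$1 + d_theta f (V$1) (V$3) * v$3)) (at V)"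
proof -
  have "((\<lambda>V::real^4. (V$1, V$3)) has_derivative (\<lambda>v. (v$1, v$3))) (at V)"
    by (intro derivative_intros bounded_linear_imp_has_derivative bounded_linear_vec_nth)
  from has_derivative_compose[where g=f, OF this partial_derivatives(1)[OF assms]] show ?thesis by simp
qed

lemma nth_has_derivative: "((\<lambda>V::real^4. V $ i) has_derivative (\<lambda>v. v $ i)) (at V)"
  by (rule bounded_linear_imp_has_derivative[OF bounded_linear_vec_nth])

text \<open>The derivative of the conserved variables with respect to the primitive ones at \<open>V\<close>.\<close>

definition dW :: "real^4 \<Rightarrow> real^4 \<Rightarrow> real^4" where
  "dW V v = vector [v$1, v$1 * V$2 + V$1 * v$2,
     v$1 * (e (V$1, V$3) + (V$2)\<^sup>2 / 2) + V$1 * (d_rho e (V$1) (V$3) * v$1 + d_theta e (V$1) (V$3) * v$3 + V$2 * v$2), v$4]"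

lemma V_domainD: "V \<in> V_domain \<Longrightarrow> V$1 > 0 \<and> V$3 > 0 \<and> V$4 > 0"
  by (simp add: V_domain_def)

lemma conserved_has_derivative:
  assumes "V \<in> V_domain"
  shows "(conserved e has_derivative dW V) (at V)"
proof -
  note d = nth_has_derivative state_function_has_derivative[OF thermo_differentiable(2)]
  show ?thesis
    unfolding conserved_def[abs_def]
    by (rule has_derivative_vec4I; simp add: dW_def)
      (use V_domainD[OF assms] in \<open>auto intro!: derivative_eq_intros d simp: algebra_simps\<close>)
qed

text \<open>The inverse of \<open>dW V\<close>, found by solving for the components in turn; \<open>e\<^sub>\<theta> > 0\<close> is needed for the third.\<close>

definition dV :: "real^4 \<Rightarrow> real^4 \<Rightarrow> real^4" where
  "dV V w = (let v2 = (w$2 - V$2 * w$1) / V$1 in vector [w$1, v2,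
     (w$3 - w$1 * (e (V$1, V$3) + (V$2)\<^sup>2 / 2) - V$1 * (d_rho e (V$1) (V$3) * w$1 + V$2 * v2)) / (V$1 * d_theta e (V$1) (V$3)), w$4])"

lemma vec4_eqI: "x $ 1 = y $ 1 \<Longrightarrow> x $ 2 = y $ 2 \<Longrightarrow> x $ 3 = y $ 3 \<Longrightarrow> x $ 4 = y $ 4 \<Longrightarrow> x = (y :: 'a ^ 4)"
  by (simp add: vec_eq_iff forall_4)

lemma dW_dV: "V \<in> V_domain \<Longrightarrow> dW V (dV V w) = w"
  using V_domainD[of V] thermodynamic_relations(3)[of "V$1" "V$3"]
  by (intro vec4_eqI) (auto simp: dW_def dV_def Let_def field_simps)

lemma dV_dW: "V \<in> V_domain \<Longrightarrow> dV V (dW V v) = v"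
  using V_domainD[of V] thermodynamic_relations(3)[of "V$1" "V$3"]
  by (intro vec4_eqI) (auto simp: dW_def dV_def Let_def field_simps)

lemma linear_dW: "linear (dW V)"
  by (rule linearI; rule vec4_eqI) (auto simp: dW_def algebra_simps)

lemma linear_dV: "linear (dV V)"
  by (rule linearI; rule vec4_eqI) (auto simp: dV_def Let_def add_divide_distrib diff_divide_distrib algebra_simps)

text \<open>Density, velocity and radiation are read off directly; the temperature is determined because the internal energy increases with it.\<close>

lemma inj_on_conserved: "inj_on (conserved e) V_domain"
proof (rule inj_onI)
  fix V V' :: "real^4" assume V: "V \<in> V_domain" "V' \<in> V_domain" and eq: "conserved e V = conserved e V'"
  have 1: "V$1 = V'$1" and 4: "V$4 = V'$4" using eq by (auto simp: conserved_def vec_eq_iff forall_4)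
  have 2: "V$2 = V'$2" using eq 1 V_domainD[OF V(2)] by (auto simp: conserved_def vec_eq_iff forall_4)
  have e: "e (V$1, V$3) = e (V$1, V'$3)" using eq 1 2 V_domainD[OF V(2)] by (auto simp: conserved_def vec_eq_iff forall_4)
  have inc: "e (V$1, x) < e (V$1, y)" if "0 < x" "x < y" for x y
  proof (rule DERIV_pos_imp_increasing[OF that(2)], intro exI conjI)
    fix t assume "x \<le> t"
    then have t: "t > 0" "V$1 > 0" using that V_domainD[OF V(1)] by auto
    show "((\<lambda>t. e (V$1, t)) has_real_derivative d_theta e (V$1) t) (at t)"
      by (rule partial_derivatives(2)[OF thermo_differentiable(2)]) (use t in auto)
    show "0 < d_theta e (V$1) t" by (rule thermodynamic_relations(3)) (use t in auto)
  qed
  have "V$3 = V'$3"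
    using e inc[of "V$3" "V'$3"] inc[of "V'$3" "V$3"] V_domainD[OF V(1)] V_domainD[OF V(2)]
    by (metis less_irrefl linorder_neqE_linordered_idom)
  then show "V = V'" using 1 2 4 by (intro vec4_eqI) auto
qed

lemma open_V_domain: "open V_domain"
proof -
  have "V_domain = {V::real^4. 0 < V$1} \<inter> {V. 0 < V$3} \<inter> {V. 0 < V$4}" by (auto simp: V_domain_def)
  moreover have "open {V::real^4. 0 < V $ i}" for i by (intro open_Collect_less continuous_intros)
  ultimately show ?thesis by (metis open_Int)
qed

lemma continuous_on_conserved: "continuous_on V_domain (conserved e)"
  using conserved_has_derivative by (meson continuous_at_imp_continuous_on has_derivative_continuous)

lemma open_W_domain: "open (W_domain e)"
  unfolding W_domain_def by (rule invariance_of_domain[OF continuous_on_conserved open_V_domain inj_on_conserved])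

lemma primitive_conserved: "V \<in> V_domain \<Longrightarrow> primitive e (conserved e V) = V"
  unfolding primitive_def by (rule inv_into_f_f[OF inj_on_conserved])

lemma primitive_mem: "W \<in> W_domain e \<Longrightarrow> primitive e W \<in> V_domain \<and> conserved e (primitive e W) = W"
  unfolding W_domain_def using primitive_conserved by auto

lemma primitive_has_derivative:
  assumes "W \<in> W_domain e"
  shows "(primitive e has_derivative dV (primitive e W)) (at W)"
proof -
  have V: "primitive e W \<in> V_domain" and W: "conserved e (primitive e W) = W" using primitive_mem[OF assms] by auto
  have "(primitive e has_derivative dV (primitive e W)) (at (conserved e (primitive e W)))"
    by (rule has_derivative_inverse_strong[OF open_V_domain V continuous_on_conserved primitive_conserved conserved_has_derivative[OF V]])
      (auto simp: fun_eq_iff dW_dV[OF V])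
  then show ?thesis by (simp add: W)
qed

text \<open>Functions of the conserved variables are explicit only through the primitive ones; they are differentiated by the chain rule with \<open>dV\<close> as the derivative of the inverse map.\<close>

lemma conserved_form_has_derivative:
  assumes W: "W \<in> W_domain e" and F: "\<And>W. W \<in> W_domain e \<Longrightarrow> F W = Fv (primitive e W)"
    and d: "(Fv has_derivative Fv') (at (primitive e W))"
  shows "(F has_derivative (\<lambda>w. Fv' (dV (primitive e W) w))) (at W)"
proof (rule has_derivative_transform_within_open[OF _ open_W_domain W])
  show "((\<lambda>W. Fv (primitive e W)) has_derivative (\<lambda>w. Fv' (dV (primitive e W) w))) (at W)"
    by (rule has_derivative_compose[OF primitive_has_derivative[OF W] d])
qed (simp add: F)

lemma jacobian_mult:
  assumes "(F has_derivative F') (at W)" shows "jacobian F W *v w = F' w"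
proof -
  have "frechet_derivative F (at W) = F'" using assms by (rule frechet_derivative_at[symmetric])
  then show ?thesis unfolding jacobian_def using has_derivative_linear[OF assms] by (simp add: matrix_works)
qed

text \<open>The entropy variables, as functions of the primitive variables.\<close>

definition Uv :: "real^4 \<Rightarrow> real^4" where
  "Uv V = vector [(e (V$1, V$3) - V$3 * s (V$1, V$3) + p (V$1, V$3) / V$1 - (V$2)\<^sup>2 / 2) / V$3,
      V$2 / V$3, - 1 / V$3, - (V$4 powr (-1/4))]"

text \<open>With \<open>pt\<close> and \<open>et\<close> the temperature derivatives of pressure and energy, this is \<open>d(- \<rho> s - 4/3 \<eta>\<^sup>3\<^sup>/\<^sup>4) = U \<bullet> dW\<close> after inserting the Gibbs relation.\<close>

lemma gibbs_identity:
  fixes \<rho> \<theta> :: real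
  assumes "\<rho> > 0" "\<theta> > 0"
  shows "- (v1 * S + \<rho> * (- pt / \<rho>\<^sup>2 * v1 + et / \<theta> * v3)) - q * v4
   = (E - \<theta> * S + P / \<rho> - u\<^sup>2 / 2) / \<theta> * v1 + u / \<theta> * (v1 * u + \<rho> * v2)
     + - 1 / \<theta> * (v1 * (E + u\<^sup>2 / 2) + \<rho> * ((P - \<theta> * pt) / \<rho>\<^sup>2 * v1 + et * v3 + u * v2)) + - q * v4"
proof -
  have *: "- (v1 * S + \<rho> * (- pt * (j * j) * v1 + et * i * v3)) - q * v4
   = (E - \<theta> * S + P * j - k) * i * v1 + u * i * (v1 * u + \<rho> * v2)
     + - i * (v1 * (E + k) + \<rho> * ((P - \<theta> * pt) * (j * j) * v1 + et * v3 + u * v2)) + - q * v4"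
    if "\<theta> * i = 1" "\<rho> * j = 1" "2 * k = u * u" for i j k
    using that by algebra
  from *[of "1 / \<theta>" "1 / \<rho>" "u\<^sup>2 / 2"] assms show ?thesis
    by (simp add: power2_eq_square)
qed

lemma gradient_entropy:
  assumes W: "W \<in> W_domain e"
  shows "gradient (entropy e s) W = Uv (primitive e W)"
proof -
  let ?V = "primitive e W"
  let ?S = "\<lambda>V::real^4. - (V$1 * s (V$1, V$3)) - 4/3 * (V$4) powr (3/4)"
  have V: "?V \<in> V_domain" using primitive_mem[OF W] by blast
  then have V': "?V$1 > 0" "?V$3 > 0" "?V$4 > 0" by (auto simp: V_domainD)
  note d = nth_has_derivative state_function_has_derivative[OF thermo_differentiable(3)]
  have "(?S has_derivative (\<lambda>v. Uv ?V \<bullet> dW ?V v)) (at ?V)"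
  proof -
    have "(?S has_derivative (\<lambda>v. - (v$1 * s (?V$1, ?V$3) + ?V$1 * (d_rho s (?V$1) (?V$3) * v$1 + d_theta s (?V$1) (?V$3) * v$3))
        - ?V$4 powr (-1/4) * v$4)) (at ?V)"
    proof -
      have "((\<lambda>V::real^4. (V$4) powr (3/4)) has_derivative (\<lambda>v. v$4 * (3/4 * ?V$4 powr (3/4 - 1)))) (at ?V)"
        by (rule DERIV_compose_FDERIV[OF has_real_derivative_powr[OF V'(3)] nth_has_derivative])
      then have "(?S has_derivative (\<lambda>v. - (?V$1 * (d_rho s (?V$1) (?V$3) * v$1 + d_theta s (?V$1) (?V$3) * v$3) + v$1 * s (?V$1, ?V$3))
        - 4/3 * (v$4 * (3/4 * ?V$4 powr (3/4 - 1))))) (at ?V)"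
        by (intro has_derivative_diff has_derivative_minus has_derivative_mult has_derivative_mult_right d V')
      then show ?thesis by (rule has_derivative_eq_rhs) (auto simp: fun_eq_iff)
    qed
    moreover have "- (v$1 * s (?V$1, ?V$3) + ?V$1 * (d_rho s (?V$1) (?V$3) * v$1 + d_theta s (?V$1) (?V$3) * v$3))
        - ?V$4 powr (-1/4) * v$4 = Uv ?V \<bullet> dW ?V v" for v
      unfolding inner_vec_def sum_4 Uv_def dW_def vec4_nth thermodynamic_relations(4,5,6)[OF V'(1,2)] inner_real_def
      by (rule gibbs_identity[OF V'(1,2)])
    ultimately show ?thesis by simp
  qed
  then have "(entropy e s has_derivative (\<lambda>w. Uv ?V \<bullet> dW ?V (dV ?V w))) (at W)"
  proof (rule conserved_form_has_derivative[OF W, rotated])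
    fix W' assume "W' \<in> W_domain e"
    then have "conserved e (primitive e W') = W'" using primitive_mem by blast
    then have "W'$1 = primitive e W'$1" "W'$4 = primitive e W'$4" by (metis conserved_def vec4_nth(1), metis conserved_def vec4_nth(4))
    then show "entropy e s W' = ?S (primitive e W')" by (simp add: entropy_def temperature_def)
  qed
  then have "frechet_derivative (entropy e s) (at W) = (\<lambda>w. Uv ?V \<bullet> w)"
    unfolding dW_dV[OF V] by (rule frechet_derivative_at[symmetric])
  then show ?thesis by (simp add: gradient_def vec_eq_iff inner_axis)
qed

end

section \<open>Linearization at an equilibrium\<close>

lemma matrix_inv_eqI:
  fixes A B :: "real^'n^'n"
  assumes "A ** B = mat 1"
  shows "matrix_inv A = B"
proof -
  have BA: "B ** A = mat 1" using assms matrix_left_right_inverse by blast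
  have "\<exists>B. A ** B = mat 1 \<and> B ** A = mat 1" using assms BA by blast
  then have "A ** matrix_inv A = mat 1 \<and> matrix_inv A ** A = mat 1"
    unfolding matrix_inv_def by (rule someI_ex)
  then have "matrix_inv A = (B ** A) ** matrix_inv A" using BA by simp
  also have "\<dots> = B" using \<open>A ** matrix_inv A = mat 1 \<and> _\<close> by (simp add: matrix_mul_assoc[symmetric])
  finally show ?thesis .
qed

text \<open>Real matrices below are known through the linear map that they represent; this gives their action on complex vectors.\<close>

lemma complex_mat_mult_vec:
  assumes "\<And>v. K *v v = \<kappa> v"
  shows "(complex_mat K *v y) $ i = (\<Sum>j\<in>UNIV. complex_of_real (\<kappa> (axis j 1) $ i) * y $ j)"
proof -
  have "K $ i $ j = \<kappa> (axis j 1) $ i" for j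
    unfolding assms[symmetric] by (simp add: matrix_vector_mul_component inner_axis)
  then show ?thesis by (simp add: matrix_vector_mult_def complex_mat_nth)
qed

lemma matrix_mult_linear: "linear f \<Longrightarrow> matrix f *v x = f x" for f :: "real^'n \<Rightarrow> real^'m"
  by (simp add: matrix_works linear_matrix_vector_mul_eq)

lemma matrix_eq_linear:
  fixes A B :: "real^'n^'m"
  assumes "\<And>x. A *v x = B *v x" shows "A = B"
  using assms by (simp add: matrix_eq)

lemmas has_derivative_divide_const = bounded_linear.has_derivative[OF bounded_linear_divide]

locale equilibrium = fluid +
  fixes W :: "real^4"
  assumes W: "W \<in> W_domain e" and equilibrium: "W $ 4 = temperature e W ^ 4"
begin

definition "V = primitive e W"
definition "\<rho> = V $ 1"
definition "u = V $ 2"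
definition "\<theta> = V $ 3"
definition "pr = d_rho p \<rho> \<theta>"
definition "pt = d_theta p \<rho> \<theta>"
definition "er = d_rho e \<rho> \<theta>"
definition "et = d_theta e \<rho> \<theta>"
definition "E = e (\<rho>, \<theta>) + u\<^sup>2 / 2"

lemma V: "V \<in> V_domain" "conserved e V = W"
  using primitive_mem[OF W] by (auto simp: V_def)

lemma W_eq: "W$1 = \<rho>" "W$2 = \<rho> * u" "W$3 = \<rho> * E" "W$4 = V$4"
proof -
  have "W = vector [V$1, V$1 * V$2, V$1 * (e (V$1, V$3) + (V$2)\<^sup>2 / 2), V$4]" using V(2) by (simp add: conserved_def)
  from arg_cong[where f="\<lambda>x. x $ 1", OF this] arg_cong[where f="\<lambda>x. x $ 2", OF this]
    arg_cong[where f="\<lambda>x. x $ 3", OF this] arg_cong[where f="\<lambda>x. x $ 4", OF this]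
  show "W$1 = \<rho>" "W$2 = \<rho> * u" "W$3 = \<rho> * E" "W$4 = V$4" by (simp_all add: \<rho>_def u_def \<theta>_def E_def)
qed

lemma V4: "V $ 4 = \<theta> ^ 4"
  using equilibrium W_eq(4) by (simp add: temperature_def \<theta>_def V_def)

lemma pos: "\<rho> > 0" "\<theta> > 0" "pr > 0" "pt > 0" "et > 0"
proof -
  show 1: "\<rho> > 0" "\<theta> > 0" using V_domainD[OF V(1)] by (auto simp: \<rho>_def \<theta>_def)
  show "pr > 0" "pt > 0" "et > 0" using thermodynamic_relations[OF 1] by (auto simp: pr_def pt_def et_def)
qed

lemmas V_nth = \<rho>_def[symmetric] u_def[symmetric] \<theta>_def[symmetric] V4

lemma dW_V: "dW V v = vector [v$1, v$1 * u + \<rho> * v$2, v$1 * E + \<rho> * (er * v$1 + et * v$3 + u * v$2), v$4]"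
  by (simp add: dW_def V_nth er_def et_def E_def)

abbreviation "H \<equiv> hessian (entropy e s) W"

definition "\<tau> = (pt / \<rho> - s (\<rho>, \<theta>)) / \<theta> - (e (\<rho>, \<theta>) - \<theta> * s (\<rho>, \<theta>) + p (\<rho>, \<theta>) / \<rho> - u\<^sup>2 / 2) / \<theta>\<^sup>2"

text \<open>The derivative of the entropy variables at the equilibrium. It is triangular with positive diagonal, hence invertible. The last entry is \<open>\<eta>\<^sup>-\<^sup>5\<^sup>/\<^sup>4 / 4\<close> with \<open>\<eta> = \<theta>\<^sup>4\<close>.\<close>

definition dU :: "real^4 \<Rightarrow> real^4" where
  "dU v = vector [pr / (\<rho> * \<theta>) * v$1 - u / \<theta> * v$2 + \<tau> * v$3, v$2 / \<theta> - u / \<theta>\<^sup>2 * v$3, v$3 / \<theta>\<^sup>2, v$4 / (4 * \<theta> ^ 5)]"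

text \<open>The Gibbs relation removes the pressure and its temperature derivative from the density derivative, leaving only \<open>p\<^sub>\<rho> / (\<rho> \<theta>)\<close>.\<close>

lemma first_entropy_variable_derivative:
  fixes r t :: real
  assumes "r > 0" "t > 0"
  shows "((((P - t * pt') / r\<^sup>2 * v1 + et' * v3) - (t * (- pt' / r\<^sup>2 * v1 + et' / t * v3) + v3 * S) + ((pr' * v1 + pt' * v3) * r - P * v1) / (r * r) - w * v2) * t
     - N * v3) / (t * t) = pr' / (r * t) * v1 - w / t * v2 + ((pt' / r - S) / t - N / t\<^sup>2) * v3"
proof -
  have *: "((((P - t * pt') * (j * j) * v1 + et' * v3) - (t * (- pt' * (j * j) * v1 + et' * i * v3) + v3 * S) + ((pr' * v1 + pt' * v3) * r - P * v1) * (j * j) - w * v2) * t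
     - N * v3) * (i * i) = pr' * (j * i) * v1 - w * i * v2 + ((pt' * j - S) * i - N * (i * i)) * v3"
    if "t * i = 1" "r * j = 1" for i j
    using that by algebra
  from *[of "1 / t" "1 / r"] assms show ?thesis by (simp add: power2_eq_square)
qed

lemma Uv_has_derivative: "(Uv has_derivative dU) (at V)"
proof -
  have g: "V$1 > 0" "V$3 > 0" "V$4 > 0" "V$1 \<noteq> 0" "V$3 \<noteq> 0" using V_domainD[OF V(1)] by auto
  note d = nth_has_derivative state_function_has_derivative[OF thermo_differentiable(1)[OF g(1,2)]]
    state_function_has_derivative[OF thermo_differentiable(2)[OF g(1,2)]] state_function_has_derivative[OF thermo_differentiable(3)[OF g(1,2)]]
  note t = thermodynamic_relations(4,5,6)[OF pos(1,2)]
  show ?thesis unfolding Uv_def[abs_def]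
  proof (rule has_derivative_vec4I, unfold vec4_nth dU_def)
    let ?N = "\<lambda>V::real^4. e (V$1, V$3) - V$3 * s (V$1, V$3) + p (V$1, V$3) / V$1 - (V$2)\<^sup>2 / 2"
    have N: "(?N has_derivative (\<lambda>v. (er * v$1 + et * v$3) - (\<theta> * (d_rho s \<rho> \<theta> * v$1 + d_theta s \<rho> \<theta> * v$3) + v$3 * s (\<rho>, \<theta>))
       + ((pr * v$1 + pt * v$3) * \<rho> - p (\<rho>, \<theta>) * v$1) / (\<rho> * \<rho>) - u * v$2)) (at V)"
    proof -
      have sq: "((\<lambda>V::real^4. (V$2)\<^sup>2 / 2) has_derivative (\<lambda>v. V$2 * v$2)) (at V)"
        by (rule has_derivative_eq_rhs[OF has_derivative_divide_const[OF has_derivative_power[OF nth_has_derivative]]]) (simp add: fun_eq_iff)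
      show ?thesis
        using has_derivative_diff[OF has_derivative_add[OF has_derivative_diff[OF d(3) has_derivative_mult[OF d(1)[of 3] d(4)]] has_derivative_divide'[OF d(2) d(1)[of 1] g(4)]] sq]
        by (simp add: V_nth er_def et_def pr_def pt_def)
    qed
    show "((\<lambda>V. ?N V / V$3) has_derivative (\<lambda>v. pr / (\<rho> * \<theta>) * v$1 - u / \<theta> * v$2 + \<tau> * v$3)) (at V)"
      by (rule has_derivative_eq_rhs[OF has_derivative_divide'[OF N nth_has_derivative g(5)]])
        (unfold fun_eq_iff V_nth er_def t \<tau>_def et_def[symmetric] pt_def[symmetric], intro allI first_entropy_variable_derivative pos)
    show "((\<lambda>V::real^4. V$2 / V$3) has_derivative (\<lambda>v. v$2 / \<theta> - u / \<theta>\<^sup>2 * v$3)) (at V)"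
      by (rule has_derivative_eq_rhs[OF has_derivative_divide'[OF nth_has_derivative nth_has_derivative g(5)]])
        (use pos in \<open>auto simp: fun_eq_iff V_nth power2_eq_square field_simps\<close>)
    show "((\<lambda>V::real^4. - 1 / V$3) has_derivative (\<lambda>v. v$3 / \<theta>\<^sup>2)) (at V)"
      by (rule has_derivative_eq_rhs[OF has_derivative_divide'[OF has_derivative_const nth_has_derivative g(5)]])
        (use pos in \<open>auto simp: fun_eq_iff V_nth power2_eq_square\<close>)
    have "V$4 powr (-1/4 - 1) = 1 / \<theta> ^ 5"
    proof -
      have "V$4 = \<theta> powr 4" using pos by (simp add: V4 powr_numeral)
      then have "V$4 powr (-1/4 - 1) = \<theta> powr (- 5)" by (simp add: powr_powr)
      then show ?thesis using pos by (simp add: powr_minus powr_numeral inverse_eq_divide)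
    qed
    then show "((\<lambda>V::real^4. - (V$4 powr (-1/4))) has_derivative (\<lambda>v. v$4 / (4 * \<theta> ^ 5))) (at V)"
      using has_derivative_minus[OF DERIV_compose_FDERIV[OF has_real_derivative_powr[OF g(3)] nth_has_derivative], of "-1/4"] by simp
  qed
qed

lemma H_mult: "H *v w = dU (dV V w)"
  unfolding hessian_def
proof (rule jacobian_mult)
  show "(gradient (entropy e s) has_derivative (\<lambda>w. dU (dV V w))) (at W)"
    using conserved_form_has_derivative[where F="gradient (entropy e s)" and Fv=Uv, OF W gradient_entropy, of dU] Uv_has_derivative by (simp add: V_def)
qed

definition dU_inv :: "real^4 \<Rightarrow> real^4" where
  "dU_inv y = (let v3 = \<theta>\<^sup>2 * y$3; v2 = \<theta> * (y$2 + u / \<theta>\<^sup>2 * v3) in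
     vector [\<rho> * \<theta> / pr * (y$1 + u / \<theta> * v2 - \<tau> * v3), v2, v3, 4 * \<theta> ^ 5 * y$4])"

lemma dU_dU_inv: "dU (dU_inv y) = y"
  using pos by (intro vec4_eqI) (simp_all add: dU_def dU_inv_def Let_def)

lemma linear_dU_inv: "linear dU_inv"
  by (rule linearI; rule vec4_eqI) (auto simp: dU_inv_def Let_def algebra_simps add_divide_distrib)

text \<open>This is \<open>A\<^sup>0\<close>, the inverse of the Hessian.\<close>

definition "P = matrix (\<lambda>y. dW V (dU_inv y))"

lemma P_mult: "P *v y = dW V (dU_inv y)"
  unfolding P_def using linear_compose[OF linear_dU_inv linear_dW[of V]] by (intro matrix_mult_linear) (simp add: o_def)

lemma HP: "H ** P = mat 1" and PH: "P ** H = mat 1"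
proof -
  show "H ** P = mat 1"
    by (rule matrix_eq_linear) (simp add: matrix_vector_mul_assoc[symmetric] P_mult H_mult dV_dW[OF V(1)] dU_dU_inv)
  then show "P ** H = mat 1" using matrix_left_right_inverse by blast
qed

lemma matrix_inv_H: "matrix_inv H = P" and matrix_inv_P: "matrix_inv P = H"
  using matrix_inv_eqI HP PH by blast+

definition "Q = jacobian (source e \<sigma>a) W"
definition "F = jacobian (flux p e) W - nonconservative e W"

lemma A0_eq: "A0 e s W = P" and A1_eq: "A1 p e s W = F ** P" and Lmat_eq: "Lmat e s \<sigma>a W = - (Q ** P)"
  and Bmat_eq: "Bmat e s \<sigma>s W = diffusion \<sigma>s ** P"
  by (simp_all add: A0_def A1_def Lmat_def Bmat_def matrix_inv_H Q_def F_def)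

lemma Q_mult: "Q *v w = (let v = dV V w; q = \<sigma>a * (v$4 - 4 * \<theta> ^ 3 * v$3) in vector [0, 0, q, - q])"
proof -
  let ?Q = "\<lambda>V::real^4. vector [0, 0, \<sigma>a * (V$4 - V$3 ^ 4), - \<sigma>a * (V$4 - V$3 ^ 4)] :: real^4"
  let ?Q' = "\<lambda>v::real^4. vector [0, 0, \<sigma>a * (v$4 - 4 * \<theta> ^ 3 * v$3), - \<sigma>a * (v$4 - 4 * \<theta> ^ 3 * v$3)] :: real^4"
  have d: "((\<lambda>V::real^4. V$4 - V$3 ^ 4) has_derivative (\<lambda>v. v$4 - 4 * \<theta> ^ 3 * v$3)) (at V)"
    by (rule has_derivative_eq_rhs[OF has_derivative_diff[OF nth_has_derivative has_derivative_power[OF nth_has_derivative]]])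
      (simp add: fun_eq_iff V_nth)
  have "(?Q has_derivative ?Q') (at V)"
    by (rule has_derivative_vec4I; unfold vec4_nth; intro has_derivative_const has_derivative_mult_right d)
  then have "(source e \<sigma>a has_derivative (\<lambda>w. ?Q' (dV V w))) (at W)"
    unfolding V_def
  proof (rule conserved_form_has_derivative[OF W, rotated])
    fix W' assume "W' \<in> W_domain e"
    then have "conserved e (primitive e W') = W'" using primitive_mem by blast
    then have "W'$4 = primitive e W'$4" by (metis conserved_def vec4_nth(4))
    then show "source e \<sigma>a W' = ?Q (primitive e W')" by (simp add: source_def temperature_def)
  qed
  then show ?thesis unfolding Q_def by (simp add: jacobian_mult Let_def)
qed

lemma flux_jacobian: "jacobian (flux p e) W *v w = (let v = dV V w; P' = pr * v$1 + pt * v$3 + v$4 / 3; P0 = p (\<rho>, \<theta>) + \<theta> ^ 4 / 3 in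
   vector [v$1 * u + \<rho> * v$2, v$1 * u\<^sup>2 + 2 * \<rho> * u * v$2 + P',
     (v$1 * E + \<rho> * (er * v$1 + et * v$3 + u * v$2)) * u + \<rho> * E * v$2 + P' * u + P0 * v$2, v$4 * u + \<theta> ^ 4 * v$2])"
proof -
  let ?P = "\<lambda>V::real^4. p (V$1, V$3) + V$4 / 3"
  let ?E = "\<lambda>V::real^4. V$1 * (e (V$1, V$3) + (V$2)\<^sup>2 / 2)"
  let ?F = "\<lambda>V::real^4. vector [V$1 * V$2, V$1 * (V$2)\<^sup>2 + ?P V, ?E V * V$2 + ?P V * V$2, V$4 * V$2] :: real^4"
  let ?P' = "\<lambda>v::real^4. pr * v$1 + pt * v$3 + v$4 / 3"
  let ?E' = "\<lambda>v::real^4. v$1 * E + \<rho> * (er * v$1 + et * v$3 + u * v$2)"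
  let ?F' = "\<lambda>v::real^4. vector [v$1 * u + \<rho> * v$2, v$1 * u\<^sup>2 + 2 * \<rho> * u * v$2 + ?P' v,
     ?E' v * u + \<rho> * E * v$2 + ?P' v * u + (p (\<rho>, \<theta>) + \<theta> ^ 4 / 3) * v$2, v$4 * u + \<theta> ^ 4 * v$2] :: real^4"
  have g: "V$1 > 0" "V$3 > 0" using V_domainD[OF V(1)] by auto
  note d = nth_has_derivative[of _ V]
  have sq: "((\<lambda>V::real^4. (V$2)\<^sup>2) has_derivative (\<lambda>v. 2 * u * v$2)) (at V)"
    by (rule has_derivative_eq_rhs[OF has_derivative_power[OF d]]) (simp add: fun_eq_iff V_nth)
  have dP: "(?P has_derivative ?P') (at V)"
    by (rule has_derivative_eq_rhs[OF has_derivative_add[OF state_function_has_derivative[OF thermo_differentiable(1)[OF g]] has_derivative_divide_const[OF d]]])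
      (simp add: fun_eq_iff V_nth pr_def pt_def)
  have dE: "(?E has_derivative ?E') (at V)"
    by (rule has_derivative_eq_rhs[OF has_derivative_mult[OF d has_derivative_add[OF state_function_has_derivative[OF thermo_differentiable(2)[OF g]] has_derivative_divide_const[OF sq]]]])
      (simp add: fun_eq_iff V_nth er_def et_def E_def)
  have "(?F has_derivative ?F') (at V)"
  proof (rule has_derivative_vec4I; unfold vec4_nth)
    show "((\<lambda>V::real^4. V$1 * V$2) has_derivative (\<lambda>v. v$1 * u + \<rho> * v$2)) (at V)"
      by (rule has_derivative_eq_rhs[OF has_derivative_mult[OF d d]]) (simp add: fun_eq_iff V_nth)
    show "((\<lambda>V::real^4. V$1 * (V$2)\<^sup>2 + ?P V) has_derivative (\<lambda>v. v$1 * u\<^sup>2 + 2 * \<rho> * u * v$2 + ?P' v)) (at V)"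
      by (rule has_derivative_eq_rhs[OF has_derivative_add[OF has_derivative_mult[OF d sq] dP]]) (simp add: fun_eq_iff V_nth)
    show "((\<lambda>V::real^4. ?E V * V$2 + ?P V * V$2) has_derivative (\<lambda>v. ?E' v * u + \<rho> * E * v$2 + ?P' v * u + (p (\<rho>, \<theta>) + \<theta> ^ 4 / 3) * v$2)) (at V)"
      by (rule has_derivative_eq_rhs[OF has_derivative_add[OF has_derivative_mult[OF dE d] has_derivative_mult[OF dP d]]]) (simp add: fun_eq_iff V_nth E_def)
    show "((\<lambda>V::real^4. V$4 * V$2) has_derivative (\<lambda>v. v$4 * u + \<theta> ^ 4 * v$2)) (at V)"
      by (rule has_derivative_eq_rhs[OF has_derivative_mult[OF d d]]) (simp add: fun_eq_iff V_nth)
  qed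
  then have "(flux p e has_derivative (\<lambda>w. ?F' (dV V w))) (at W)"
    unfolding V_def
  proof (rule conserved_form_has_derivative[OF W, rotated])
    fix W' assume W': "W' \<in> W_domain e"
    let ?V = "primitive e W'"
    have "vector [?V$1, ?V$1 * ?V$2, ?V$1 * (e (?V$1, ?V$3) + (?V$2)\<^sup>2 / 2), ?V$4] = W'"
      using primitive_mem[OF W'] by (simp add: conserved_def)
    then have "W'$1 = ?V$1" "W'$3 = ?E ?V" "W'$4 = ?V$4" by (metis vec4_nth(1), metis vec4_nth(3), metis vec4_nth(4))
    then show "flux p e W' = ?F ?V" by (simp add: flux_def temperature_def velocity_def Let_def add.assoc)
  qed
  then show ?thesis by (simp add: jacobian_mult Let_def)
qed

end

lemma mv_uminus: "(- A) *v x = - (A *v x)" "A *v (- x) = - (A *v x)" for A :: "'a::ring_1 ^ 'n ^ 'm"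
  by (simp_all add: vec_eq_iff matrix_vector_mult_def sum_negf)

context equilibrium
begin

definition "dV_mat = matrix (dV V)"
definition "dW_mat = matrix (dW V)"

lemma dV_mat_mult: "dV_mat *v w = dV V w" and dW_mat_mult: "dW_mat *v w = dW V w"
  by (simp_all add: dV_mat_def dW_mat_def matrix_mult_linear linear_dV linear_dW)

lemma dW_mat_dV_mat: "dW_mat ** dV_mat = mat 1"
  by (rule matrix_eq_linear; simp add: matrix_vector_mul_assoc[symmetric] dV_mat_mult dW_mat_mult dW_dV[OF V(1)])

definition "\<kappa>0 v = (vector [0, 0, \<sigma>a / (\<rho> * et) * (v$4 - 4 * \<theta> ^ 3 * v$3), - \<sigma>a * (v$4 - 4 * \<theta> ^ 3 * v$3)] :: real^4)" for v :: "real^4"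
definition "\<kappa>1 v = (vector [u * v$1 + \<rho> * v$2, u * v$2 + (pr / \<rho> * v$1 + pt / \<rho> * v$3 + 1 / (3 * \<rho>) * v$4),
   u * v$3 + \<theta> * pt / (\<rho> * et) * v$2, u * v$4 + 4 / 3 * \<theta> ^ 4 * v$2] :: real^4)" for v :: "real^4"
definition "\<kappa>2 v = (vector [0, 0, 0, 1 / (3 * \<sigma>s) * v$4] :: real^4)" for v :: "real^4"

text \<open>Conjugating by \<open>dW\<close> turns the linearized system into the one for the primitive variables, whose coefficients are \<open>\<kappa>0\<close>, \<open>\<kappa>1\<close> and \<open>\<kappa>2\<close>. It suffices to check \<open>Q \<circ> dW = dW \<circ> \<kappa>0\<close>, which avoids computing with the inverse; the same holds for the flux and the diffusion.\<close>

lemma source_primitive: "(dV_mat ** Q ** dW_mat) *v v = \<kappa>0 v"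
proof -
  have "Q *v dW V v = dW V (\<kappa>0 v)"
    unfolding Q_mult dV_dW[OF V(1)] using pos by (intro vec4_eqI) (simp_all add: \<kappa>0_def dW_V Let_def)
  then show ?thesis by (simp add: matrix_vector_mul_assoc[symmetric] dV_mat_mult dW_mat_mult dV_dW[OF V(1)])
qed

lemma nonconservative_mult: "nonconservative e W *v dW V v = vector [0, 0, \<theta> ^ 4 / 3 * v$2, - (\<theta> ^ 4 / 3 * v$2)]"
proof -
  have "velocity e W = u" by (simp add: velocity_def u_def V_def)
  then show ?thesis
    using pos by (intro vec4_eqI)
      (simp_all add: nonconservative_def Let_def matrix_vector_mult_def sum_4 dW_V W_eq V4 field_simps)
qed

lemma flux_primitive: "(dV_mat ** F ** dW_mat) *v v = \<kappa>1 v"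
proof -
  have er: "er = (p (\<rho>, \<theta>) - \<theta> * pt) / \<rho>\<^sup>2" unfolding er_def pt_def by (rule thermodynamic_relations(4)[OF pos(1,2)])
  have er': "\<rho> * (\<rho> * er) = p (\<rho>, \<theta>) - \<theta> * pt" using pos er by (simp add: power2_eq_square)
  have "F *v dW V v = dW V (\<kappa>1 v)"
    unfolding F_def matrix_vector_mult_diff_rdistrib nonconservative_mult flux_jacobian dV_dW[OF V(1)] Let_def
  proof (rule vec4_eqI; unfold vec4_nth vector_minus_component dW_V \<kappa>1_def)
    show "v$1 * u + \<rho> * v$2 - 0 = u * v$1 + \<rho> * v$2" by simp
    show "v$1 * u\<^sup>2 + 2 * \<rho> * u * v$2 + (pr * v$1 + pt * v$3 + v$4 / 3) - 0
      = (u * v$1 + \<rho> * v$2) * u + \<rho> * (u * v$2 + (pr / \<rho> * v$1 + pt / \<rho> * v$3 + 1 / (3 * \<rho>) * v$4))"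
      using pos by (simp add: distrib_left power2_eq_square algebra_simps)
    show "v$4 * u + \<theta> ^ 4 * v$2 - - (\<theta> ^ 4 / 3 * v$2) = u * v$4 + 4 / 3 * \<theta> ^ 4 * v$2" by simp
    have *: "(v1 * E' + \<rho> * (er * v1 + et * v3 + u * v2)) * u + \<rho> * E' * v2 + (pr * v1 + pt * v3 + v4 / 3) * u + (P0 + t4 / 3) * v2 - t4 / 3 * v2
       = (u * v1 + \<rho> * v2) * E' + \<rho> * (er * (u * v1 + \<rho> * v2) + et * (u * v3 + \<theta> * pt / (\<rho> * et) * v2) + u * (u * v2 + (pr / \<rho> * v1 + pt / \<rho> * v3 + 1 / (3 * \<rho>) * v4)))"
      if "\<rho> * (\<rho> * er) = P0 - \<theta> * pt" for v1 v2 v3 v4 E' P0 t4 :: real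
    proof -
      have gen: "(v1 * E' + \<rho> * (er * v1 + et * v3 + u * v2)) * u + \<rho> * E' * v2 + (pr * v1 + pt * v3 + w4) * u + (P0 + w5) * v2 - w5 * v2
         = (u * v1 + \<rho> * v2) * E' + \<rho> * (er * (u * v1 + \<rho> * v2) + et * (u * v3 + q1 * v2) + u * (u * v2 + q2))"
        if "\<rho> * (\<rho> * er) = P0 - \<theta> * pt" "\<rho> * et * q1 = \<theta> * pt" "\<rho> * q2 = pr * v1 + pt * v3 + w4" for w4 w5 q1 q2
        using that by algebra
      have 1: "\<rho> * et * (\<theta> * pt / (\<rho> * et)) = \<theta> * pt" using pos by simp
      have 2: "\<rho> * (pr / \<rho> * v1 + pt / \<rho> * v3 + 1 / (3 * \<rho>) * v4) = pr * v1 + pt * v3 + v4 / 3"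
        using pos by (simp add: distrib_left)
      show ?thesis by (rule gen[OF that 1 2])
    qed
    show "(v$1 * E + \<rho> * (er * v$1 + et * v$3 + u * v$2)) * u + \<rho> * E * v$2 + (pr * v$1 + pt * v$3 + v$4 / 3) * u + (p (\<rho>, \<theta>) + \<theta> ^ 4 / 3) * v$2 - \<theta> ^ 4 / 3 * v$2
       = (u * v$1 + \<rho> * v$2) * E + \<rho> * (er * (u * v$1 + \<rho> * v$2) + et * (u * v$3 + \<theta> * pt / (\<rho> * et) * v$2) + u * (u * v$2 + (pr / \<rho> * v$1 + pt / \<rho> * v$3 + 1 / (3 * \<rho>) * v$4)))"
      by (rule *[OF er'])
  qed
  then show ?thesis by (simp add: matrix_vector_mul_assoc[symmetric] dV_mat_mult dW_mat_mult dV_dW[OF V(1)])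
qed

lemma diffusion_primitive: "(dV_mat ** diffusion \<sigma>s ** dW_mat) *v v = \<kappa>2 v"
proof -
  have "diffusion \<sigma>s *v dW V v = dW V (\<kappa>2 v)"
    by (intro vec4_eqI) (simp_all add: \<kappa>2_def dW_V diffusion_def matrix_vector_mult_def sum_4)
  then show ?thesis by (simp add: matrix_vector_mul_assoc[symmetric] dV_mat_mult dW_mat_mult dV_dW[OF V(1)])
qed

abbreviation "\<Phi> \<equiv> symbol (A0 e s W) (A1 p e s W) (Lmat e s \<sigma>a W) (Bmat e s \<sigma>s W)"

abbreviation "V_of_Z \<equiv> complex_mat (dV_mat ** P)"
abbreviation "Z_of_V \<equiv> complex_mat (H ** dW_mat)"

lemma Z_of_V_of_Z: "Z_of_V *v (V_of_Z *v z) = z"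
proof -
  have 1: "(H ** dW_mat) ** (dV_mat ** P) = mat 1"
    by (metis HP dW_mat_dV_mat matrix_mul_assoc matrix_mul_rid)
  then show ?thesis by (simp add: matrix_vector_mul_assoc complex_mat_mult[symmetric] 1 complex_mat_1)
qed

lemma symbol_primitive:
  "V_of_Z *v (\<Phi> (\<i> * of_real \<xi>) *v (Z_of_V *v y)) =
    complex_mat (dV_mat ** Q ** dW_mat) *v y - (\<i> * of_real \<xi>) *s (complex_mat (dV_mat ** F ** dW_mat) *v y)
     + (\<i> * of_real \<xi>)\<^sup>2 *s (complex_mat (dV_mat ** diffusion \<sigma>s ** dW_mat) *v y)"
proof -
  have PN: "complex_mat (A ** P) *v (Z_of_V *v y) = complex_mat A *v (complex_mat dW_mat *v y)" for A
  proof -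
    have "(A ** P) ** (H ** dW_mat) = A ** dW_mat" by (metis PH matrix_mul_assoc matrix_mul_rid)
    then show ?thesis by (simp add: matrix_vector_mul_assoc complex_mat_mult[symmetric])
  qed
  have MH: "V_of_Z *v (complex_mat H *v x) = complex_mat dV_mat *v x" for x
  proof -
    have "(dV_mat ** P) ** H = dV_mat" by (metis PH matrix_mul_assoc matrix_mul_rid)
    then show ?thesis by (simp add: matrix_vector_mul_assoc complex_mat_mult[symmetric])
  qed
  show ?thesis
    unfolding symbol_def A0_eq A1_eq Lmat_eq Bmat_eq matrix_inv_P mv_uminus matrix_vector_mul_assoc[symmetric, of "complex_mat H"] MH
      matrix_vector_mult_diff_rdistrib matrix_vector_mult_add_rdistrib scale_mat_mult_vec complex_mat_minus PN
    by (simp add: matrix_vector_mult_diff_distrib matrix_vector_right_distrib mv_uminus vector_scalar_commute complex_mat_mult matrix_vector_mul_assoc matrix_mul_assoc)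
qed

lemma primitive_evolution:
  fixes y :: "complex^4"
  assumes "y' = V_of_Z *v (\<Phi> (\<i> * of_real \<xi>) *v (Z_of_V *v y))"
  shows "y' $ 1 = - \<i> * of_real \<xi> * (of_real u * y$1 + of_real \<rho> * y$2)"
    "y' $ 2 = - \<i> * of_real \<xi> * (of_real u * y$2 + of_real (pr / \<rho>) * y$1 + of_real (pt / \<rho>) * y$3 + of_real (1 / (3 * \<rho>)) * y$4)"
    "y' $ 3 = - \<i> * of_real \<xi> * (of_real u * y$3 + of_real (\<theta> * pt / (\<rho> * et)) * y$2) + of_real (\<sigma>a / (\<rho> * et)) * (y$4 - of_real (4 * \<theta> ^ 3) * y$3)"
    "y' $ 4 = - \<i> * of_real \<xi> * (of_real u * y$4 + of_real (4 / 3 * \<theta> ^ 4) * y$2) - of_real \<sigma>a * (y$4 - of_real (4 * \<theta> ^ 3) * y$3) - of_real (\<xi>\<^sup>2 / (3 * \<sigma>s)) * y$4"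
  unfolding assms symbol_primitive vector_add_component vector_minus_component vector_smult_component
    complex_mat_mult_vec[OF source_primitive] complex_mat_mult_vec[OF flux_primitive] complex_mat_mult_vec[OF diffusion_primitive] sum_4
  by (simp_all add: \<kappa>0_def \<kappa>1_def \<kappa>2_def axis_def power2_eq_square algebra_simps)

text \<open>The null space contains the first two unit vectors and \<open>(0, 0, 1, 1)\<close>, because there the relaxation term \<open>v\<^sub>4 - 4 \<theta>\<^sup>3 v\<^sub>3\<close> of the primitive variables vanishes: in entropy variables it is a multiple of the difference of the last two components.\<close>

lemma null_space_complement:
  assumes "h \<in> orthogonal_comp (null_space (Lmat e s \<sigma>a W))"
  shows "h $ 1 = 0" "h $ 2 = 0" "h $ 4 = - h $ 3"
proof -
  have null: "y \<in> null_space (Lmat e s \<sigma>a W)" if "y $ 3 = y $ 4" for y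
  proof -
    have "Q *v (P *v y) = 0"
      unfolding P_mult Q_mult dV_dW[OF V(1)] using that
      by (intro vec4_eqI) (simp_all add: dU_inv_def Let_def power_numeral_reduce)
    then show ?thesis by (simp add: null_space_def Lmat_eq mv_uminus matrix_vector_mul_assoc[symmetric])
  qed
  have o: "y \<bullet> h = 0" if "y $ 3 = y $ 4" for y
    using assms null[OF that] by (auto simp: orthogonal_comp_def orthogonal_def)
  show "h $ 1 = 0" using o[of "axis 1 1"] by (simp add: inner_vec_def sum_4 axis_def)
  show "h $ 2 = 0" using o[of "axis 2 1"] by (simp add: inner_vec_def sum_4 axis_def)
  show "h $ 4 = - h $ 3" using o[of "vector [0, 0, 1, 1]"] by (simp add: inner_vec_def sum_4)
qed

end

section \<open>Decay at a fixed frequency\<close>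

lemma norm_vec_square: "(norm x)\<^sup>2 = (\<Sum>i\<in>UNIV. (norm (x $ i))\<^sup>2)" for x :: "'a::real_normed_vector ^ 'n"
  by (simp add: norm_vec_def L2_set_def sum_nonneg)

text \<open>Identities between quotients of square roots are proved after multiplying by a nonzero factor that makes them polynomial.\<close>

lemma cancel_factor: "k \<noteq> 0 \<Longrightarrow> k * x = k * y \<Longrightarrow> x = y" for k x y :: real
  by simp

context equilibrium
begin

lemma initial_primitive:
  assumes "w $ 1 = 0" "w $ 2 = 0" "w $ 4 = - w $ 3"
  shows "(V_of_Z *v (complex_mat H *v w)) $ 1 = 0" "(V_of_Z *v (complex_mat H *v w)) $ 2 = 0"
    "(V_of_Z *v (complex_mat H *v w)) $ 3 = of_real (1 / (\<rho> * et)) * w $ 3" "(V_of_Z *v (complex_mat H *v w)) $ 4 = - w $ 3"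
proof -
  have "(dV_mat ** P) ** H = dV_mat" by (metis PH matrix_mul_assoc matrix_mul_rid)
  then have "V_of_Z *v (complex_mat H *v w) = complex_mat dV_mat *v w"
    by (simp add: matrix_vector_mul_assoc complex_mat_mult[symmetric])
  then show "(V_of_Z *v (complex_mat H *v w)) $ 1 = 0" "(V_of_Z *v (complex_mat H *v w)) $ 2 = 0"
    "(V_of_Z *v (complex_mat H *v w)) $ 3 = of_real (1 / (\<rho> * et)) * w $ 3" "(V_of_Z *v (complex_mat H *v w)) $ 4 = - w $ 3"
    using assms by (simp_all add: complex_mat_mult_vec[OF dV_mat_mult] sum_4 dV_def Let_def axis_def V_nth et_def)
qed

text \<open>The scaling factors \<open>q1, \<dots>, q4\<close> are the square roots of the diagonal of the symmetrizer \<open>(p\<^sub>\<rho> / \<rho>, \<rho>, \<rho> e\<^sub>\<theta> / \<theta>, 1 / (4 \<theta>\<^sup>4))\<close>. The equilibrium condition \<open>\<eta> = \<theta>\<^sup>4\<close> enters through the last one and makes the coupling and the relaxation symmetric.\<close>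

lemma frequency_bound:
  "\<exists>C>0. \<exists>k>0. \<forall>\<xi> t w. t \<ge> 0 \<longrightarrow> w $ 1 = 0 \<longrightarrow> w $ 2 = 0 \<longrightarrow> w $ 4 = - w $ 3 \<longrightarrow>
     (norm (mat_exp (scale_mat (of_real t) (\<Phi> (\<i> * of_real \<xi>))) *v (complex_mat H *v w)))\<^sup>2
       \<le> C * (norm w)\<^sup>2 * (exp (- k * t) + (if \<bar>\<xi>\<bar> \<le> 1 then \<xi>\<^sup>2 * exp (- k * \<xi>\<^sup>2 * t) else 0))"
proof -
  define q1 q2 q3 q4 where "q1 = sqrt (pr / \<rho>)" and "q2 = sqrt \<rho>" and "q3 = sqrt (\<rho> * et / \<theta>)" and "q4 = 1 / (2 * \<theta>\<^sup>2)"
  have q: "q1 > 0" "q2 > 0" "q3 > 0" "q4 > 0" using pos by (auto simp: q1_def q2_def q3_def q4_def)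
  have qq: "q1 * q1 * \<rho> = pr" "q2 * q2 = \<rho>" "q3 * q3 * \<theta> = \<rho> * et" "4 * \<theta> ^ 4 * (q4 * q4) = 1"
    using pos by (simp_all add: q1_def q2_def q3_def q4_def)
  (* By symmetry each coupling constant has two expressions, one from each of the equations it couples. *)
  define a b c m1 m2 \<beta> where "a = pr / (q1 * q2)" and "b = pt / (q2 * q3)" and "c = 1 / (3 * q2 * q4)"
    and "m1 = sqrt \<sigma>a * 4 * \<theta> ^ 3 * q4 / q3" and "m2 = sqrt \<sigma>a" and "\<beta> = 1 / (3 * \<sigma>s)"
  have p: "a > 0" "b > 0" "m1 > 0" "m2 > 0" "\<beta> > 0"
    using pos q \<sigma>a \<sigma>s by (auto simp: a_def b_def m1_def m2_def \<beta>_def)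
  have ab: "a * q1 * q2 = pr" "b * q2 * q3 = pt" "3 * c * q2 * q4 = 1" "m1 * q3 = m2 * 4 * \<theta> ^ 3 * q4" "m2 * m2 = \<sigma>a"
    using q \<sigma>a by (simp_all add: a_def b_def c_def m1_def m2_def)
  define x1 x2 x3 z1 w1 where "x1 = pr / \<rho>" and "x2 = pt / \<rho>" and "x3 = 1 / (3 * \<rho>)" and "z1 = \<theta> * pt / (\<rho> * et)" and "w1 = \<sigma>a / (\<rho> * et)"
  have xz: "\<rho> * x1 = pr" "\<rho> * x2 = pt" "3 * \<rho> * x3 = 1" "\<rho> * et * z1 = \<theta> * pt" "\<rho> * et * w1 = \<sigma>a"
    using pos by (simp_all add: x1_def x2_def x3_def z1_def w1_def)
  note qq0 = qq[THEN right_minus_eq[THEN iffD2]] and ab0 = ab[THEN right_minus_eq[THEN iffD2]] and xz0 = xz[THEN right_minus_eq[THEN iffD2]]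
  have nz: "q1 \<noteq> 0" "q2 \<noteq> 0" "q3 * \<theta> \<noteq> 0" "3 * q4 \<noteq> 0" "3 * q2 \<noteq> 0" using q pos by auto
  have "q1 * (a * q2) = q1 * (q1 * \<rho>)" using qq0(1) ab0(1) by algebra
  from cancel_factor[OF nz(1) this] have R1: "a * q2 = q1 * \<rho>" .
  have "q2 * (a * q1) = q2 * (q2 * x1)" using qq0(2) ab0(1) xz0(1) by algebra
  from cancel_factor[OF nz(2) this] have R2a: "a * q1 = q2 * x1" .
  have "q2 * (b * q3) = q2 * (q2 * x2)" using qq0(2) ab0(2) xz0(2) by algebra
  from cancel_factor[OF nz(2) this] have R2b: "b * q3 = q2 * x2" .
  have "(3 * q2) * (c * q4) = (3 * q2) * (q2 * x3)" using qq0(2) ab0(3) xz0(3) by algebra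
  from cancel_factor[OF nz(5) this] have R2c: "c * q4 = q2 * x3" .
  have "(q3 * \<theta>) * (b * q2) = (q3 * \<theta>) * (q3 * z1)" using qq0(3) ab0(2) xz0(4) by algebra
  from cancel_factor[OF nz(3) this] have R3: "b * q2 = q3 * z1" .
  have "(q3 * \<theta>) * (m1 * m1 * q3) = (q3 * \<theta>) * (q3 * w1 * (4 * \<theta> ^ 3))" using qq0(3,4) ab0(4,5) xz0(5) by algebra
  from cancel_factor[OF nz(3) this] have R3': "m1 * m1 * q3 = q3 * w1 * (4 * \<theta> ^ 3)" .
  have "(q3 * \<theta>) * (m1 * m2 * q4) = (q3 * \<theta>) * (q3 * w1)" using qq0(3,4) ab0(4,5) xz0(5) by algebra
  from cancel_factor[OF nz(3) this] have R3'': "m1 * m2 * q4 = q3 * w1" .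
  have "(3 * q4) * (c * q2) = (3 * q4) * (q4 * (4 / 3 * \<theta> ^ 4))" using qq0(4) ab0(3) by algebra
  from cancel_factor[OF nz(4) this] have R4: "c * q2 = q4 * (4 / 3 * \<theta> ^ 4)" .
  have R4': "m2 * m1 * q3 = q4 * \<sigma>a * (4 * \<theta> ^ 3)" "m2 * m2 * q4 = q4 * \<sigma>a"
    using ab0(4,5) by algebra+
  interpret S: rad_system u a b c m1 m2 \<beta> using p by unfold_locales
  note C = arg_cong[where f=complex_of_real]
  note RC = R1[THEN C, unfolded of_real_mult] R2a[THEN C, unfolded of_real_mult] R2b[THEN C, unfolded of_real_mult] R2c[THEN C, unfolded of_real_mult]
    R3[THEN C, unfolded of_real_mult] R3'[THEN C, unfolded of_real_mult] R3''[THEN C, unfolded of_real_mult]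
    R4[THEN C, unfolded of_real_mult] R4'(1)[THEN C, unfolded of_real_mult] R4'(2)[THEN C, unfolded of_real_mult]
  obtain C k where C: "C > 0" and k: "k > 0" and decay: "\<forall>\<xi> z r u h n.
     (\<forall>t. (r has_vector_derivative S.rhs1 \<xi> (r t) (u t) (h t) (n t)) (at t)) \<longrightarrow>
     (\<forall>t. (u has_vector_derivative S.rhs2 \<xi> (r t) (u t) (h t) (n t)) (at t)) \<longrightarrow>
     (\<forall>t. (h has_vector_derivative S.rhs3 \<xi> (r t) (u t) (h t) (n t)) (at t)) \<longrightarrow>
     (\<forall>t. (n has_vector_derivative S.rhs4 \<xi> (r t) (u t) (h t) (n t)) (at t)) \<longrightarrow>
     r 0 = 0 \<longrightarrow> u 0 = 0 \<longrightarrow> h 0 = of_real m1 * z \<longrightarrow> n 0 = - of_real m2 * z \<longrightarrow>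
     (\<forall>t\<ge>0. nsq (r t) (u t) (h t) (n t) \<le> C * (cmod z)\<^sup>2 * (exp (- k * t) + (if \<bar>\<xi>\<bar> \<le> 1 then \<xi>\<^sup>2 * exp (- k * \<xi>\<^sup>2 * t) else 0)))"
    using S.frequency_decay by (elim exE conjE) (rule that; assumption)
  obtain K where K: "K > 0" "\<And>y. norm (Z_of_V *v y) \<le> norm y * K"
    using bounded_linear.pos_bounded[OF matrix_vector_mul_bounded_linear[of Z_of_V]] by blast
  define B where "B = 1 / q1\<^sup>2 + 1 / q2\<^sup>2 + 1 / q3\<^sup>2 + 1 / q4\<^sup>2"
  have B: "B > 0" "1 / q1\<^sup>2 \<le> B" "1 / q2\<^sup>2 \<le> B" "1 / q3\<^sup>2 \<le> B" "1 / q4\<^sup>2 \<le> B"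
    using q by (auto simp: B_def intro!: add_pos_pos add_nonneg_nonneg)
  define D where "D = K\<^sup>2 * B * C * (q4 / m2)\<^sup>2"
  have D: "D > 0" using K B C q p by (simp add: D_def)
  show ?thesis
  proof (rule exI[of _ D], intro conjI D, rule exI[of _ k], intro conjI k, intro allI impI)
    fix \<xi> t :: real and w :: "complex^4"
    assume t: "0 \<le> t" and w: "w $ 1 = 0" "w $ 2 = 0" "w $ 4 = - w $ 3"
    define Z where "Z t = mat_exp (scale_mat (of_real t) (\<Phi> (\<i> * of_real \<xi>))) *v (complex_mat H *v w)" for t
    define y where "y t = V_of_Z *v Z t" for t
    have Zy: "Z t = Z_of_V *v y t" for t by (simp add: y_def Z_of_V_of_Z)
    define y' where "y' t = V_of_Z *v (\<Phi> (\<i> * of_real \<xi>) *v (Z_of_V *v y t))" for t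
    have dy: "((\<lambda>t. y t $ i) has_vector_derivative y' t $ i) (at t)" for t i
    proof -
      have "((\<lambda>t. \<Sum>j\<in>UNIV. V_of_Z $ i $ j * Z t $ j) has_vector_derivative (\<Sum>j\<in>UNIV. V_of_Z $ i $ j * (\<Phi> (\<i> * of_real \<xi>) *v Z t) $ j)) (at t)"
        unfolding Z_def by (intro has_vector_derivative_sum has_vector_derivative_mult_right mat_exp_flow)
      moreover have "(\<lambda>t. y t $ i) = (\<lambda>t. \<Sum>j\<in>UNIV. V_of_Z $ i $ j * Z t $ j)"
        unfolding y_def matrix_vector_mult_def by (simp only: vec_lambda_beta)
      moreover have "y' t $ i = (\<Sum>j\<in>UNIV. V_of_Z $ i $ j * (\<Phi> (\<i> * of_real \<xi>) *v Z t) $ j)"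
        unfolding y'_def Zy[symmetric] by (subst matrix_vector_mult_def) (simp only: vec_lambda_beta)
      ultimately show ?thesis by (simp only:)
    qed
    note ev = primitive_evolution[OF y'_def]
    define r uu h n where "r t = of_real q1 * y t $ 1" and "uu t = of_real q2 * y t $ 2" and "h t = of_real q3 * y t $ 3" and "n t = of_real q4 * y t $ 4" for t
    have d1: "(r has_vector_derivative S.rhs1 \<xi> (r t) (uu t) (h t) (n t)) (at t)" for t
    proof -
      have "of_real q1 * y' t $ 1 = S.rhs1 \<xi> (r t) (uu t) (h t) (n t)"
        unfolding ev(1) S.rhs1_def r_def uu_def using RC(1) by algebra
      then show ?thesis unfolding r_def[abs_def] by (metis dy has_vector_derivative_mult_right)
    qed
    have d2: "(uu has_vector_derivative S.rhs2 \<xi> (r t) (uu t) (h t) (n t)) (at t)" for t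
    proof -
      have "of_real q2 * y' t $ 2 = S.rhs2 \<xi> (r t) (uu t) (h t) (n t)"
        unfolding ev(2) S.rhs2_def r_def uu_def h_def n_def x1_def[symmetric] x2_def[symmetric] x3_def[symmetric] using RC(2-4) by algebra
      then show ?thesis unfolding uu_def[abs_def] by (metis dy has_vector_derivative_mult_right)
    qed
    have d3: "(h has_vector_derivative S.rhs3 \<xi> (r t) (uu t) (h t) (n t)) (at t)" for t
    proof -
      have "of_real q3 * y' t $ 3 = S.rhs3 \<xi> (r t) (uu t) (h t) (n t)"
        unfolding ev(3) S.rhs3_def r_def uu_def h_def n_def z1_def[symmetric] w1_def[symmetric] of_real_mult using RC(5-7) by algebra
      then show ?thesis unfolding h_def[abs_def] by (metis dy has_vector_derivative_mult_right)
    qed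
    have d4: "(n has_vector_derivative S.rhs4 \<xi> (r t) (uu t) (h t) (n t)) (at t)" for t
    proof -
      have \<beta>: "\<xi>\<^sup>2 / (3 * \<sigma>s) = \<beta> * \<xi>\<^sup>2" by (simp add: \<beta>_def)
      have "of_real q4 * y' t $ 4 = S.rhs4 \<xi> (r t) (uu t) (h t) (n t)"
        unfolding ev(4) S.rhs4_def r_def uu_def h_def n_def \<beta> of_real_mult using RC(8-10) by algebra
      then show ?thesis unfolding n_def[abs_def] by (metis dy has_vector_derivative_mult_right)
    qed
    have "Z 0 = complex_mat H *v w" by (simp add: Z_def mat_exp_0)
    then have y0: "y 0 $ 1 = 0" "y 0 $ 2 = 0" "y 0 $ 3 = of_real (1 / (\<rho> * et)) * w $ 3" "y 0 $ 4 = - w $ 3"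
      by (simp_all add: y_def initial_primitive[OF w])
    define z where "z = of_real (q4 / m2) * w $ 3"
    have i3: "q3 * (1 / (\<rho> * et)) = m1 * (q4 / m2)"
    proof (rule cancel_factor[OF nz(3)])
      have "(1 / (\<rho> * et)) * (\<rho> * et) - 1 = 0" "(q4 / m2) * m2 - q4 = 0" using pos p by auto
      then show "q3 * \<theta> * (q3 * (1 / (\<rho> * et))) = q3 * \<theta> * (m1 * (q4 / m2))" using qq0(3,4) ab0(4) by algebra
    qed
    have i4: "q4 = m2 * (q4 / m2)" using p by simp
    have "r 0 = 0" "uu 0 = 0" by (simp_all add: r_def uu_def y0)
    moreover have "h 0 = of_real m1 * z"
      by (simp only: h_def y0 z_def mult.assoc[symmetric] of_real_mult[symmetric] i3)
    moreover have "n 0 = - of_real m2 * z"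
      unfolding n_def y0 z_def using p by simp
    ultimately have main: "nsq (r t) (uu t) (h t) (n t) \<le> C * (cmod z)\<^sup>2 * (exp (- k * t) + (if \<bar>\<xi>\<bar> \<le> 1 then \<xi>\<^sup>2 * exp (- k * \<xi>\<^sup>2 * t) else 0))"
      (is "_ \<le> _ * ?g") using decay[rule_format, of r \<xi> uu h n z t] d1 d2 d3 d4 t by blast
    have g: "?g \<ge> 0" by simp
    have "(norm (Z t))\<^sup>2 \<le> (norm (y t) * K)\<^sup>2" unfolding Zy by (intro power_mono K) auto
    also have "\<dots> = K\<^sup>2 * (norm (y t))\<^sup>2" by (simp add: power_mult_distrib)
    also have "\<dots> \<le> K\<^sup>2 * (B * nsq (r t) (uu t) (h t) (n t))"
    proof (intro mult_left_mono)
      have *: "(cmod x)\<^sup>2 \<le> B * (cmod (of_real s * x))\<^sup>2" if "s > 0" "1 / s\<^sup>2 \<le> B" for s and x :: complex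
      proof -
        have "(cmod x)\<^sup>2 = 1 / s\<^sup>2 * (cmod (of_real s * x))\<^sup>2" using that by (simp add: norm_mult power_mult_distrib)
        also have "\<dots> \<le> B * (cmod (of_real s * x))\<^sup>2" using that by (intro mult_right_mono) auto
        finally show ?thesis .
      qed
      have "(norm (y t))\<^sup>2 = (cmod (y t $ 1))\<^sup>2 + (cmod (y t $ 2))\<^sup>2 + (cmod (y t $ 3))\<^sup>2 + (cmod (y t $ 4))\<^sup>2"
        by (simp add: norm_vec_square sum_4)
      also have "\<dots> \<le> B * (cmod (r t))\<^sup>2 + B * (cmod (uu t))\<^sup>2 + B * (cmod (h t))\<^sup>2 + B * (cmod (n t))\<^sup>2"
        unfolding r_def uu_def h_def n_def by (intro add_mono * q B)
      finally show "(norm (y t))\<^sup>2 \<le> B * nsq (r t) (uu t) (h t) (n t)" by (simp add: nsq_def distrib_left)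
    qed simp
    also have "\<dots> \<le> K\<^sup>2 * (B * (C * (cmod z)\<^sup>2 * ?g))"
      using B(1) by (intro mult_left_mono main) simp_all
    also have "(cmod z)\<^sup>2 = (q4 / m2)\<^sup>2 * (cmod (w $ 3))\<^sup>2" using q p by (simp add: z_def norm_mult norm_divide power_mult_distrib power_divide)
    also have "K\<^sup>2 * (B * (C * ((q4 / m2)\<^sup>2 * (cmod (w $ 3))\<^sup>2) * ?g)) = D * (cmod (w $ 3))\<^sup>2 * ?g"
      by (simp add: D_def ac_simps)
    also have "\<dots> \<le> D * (norm w)\<^sup>2 * ?g"
      using D g Finite_Cartesian_Product.norm_nth_le[of w 3] by (intro mult_right_mono mult_left_mono power_mono) auto
    finally show "(norm (mat_exp (scale_mat (of_real t) (\<Phi> (\<i> * of_real \<xi>))) *v (complex_mat H *v w)))\<^sup>2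
       \<le> D * (norm w)\<^sup>2 * ?g" unfolding Z_def .
  qed
qed

end

section \<open>Vector-valued Fourier transforms and weak derivatives\<close>

lemma borel_measurable_vec_nth [measurable (raw)]:
  fixes f :: "'a \<Rightarrow> 'b::euclidean_space ^ 'n"
  assumes "f \<in> borel_measurable M"
  shows "(\<lambda>x. f x $ i) \<in> borel_measurable M"
  by (rule measurable_compose[OF assms]) (intro borel_measurable_continuous_onI continuous_intros)

lemma L2sq_vec:
  fixes f :: "real \<Rightarrow> 'a::euclidean_space ^ 'n"
  assumes [measurable]: "f \<in> borel_measurable borel"
  shows "L2sq f = (\<Sum>i\<in>UNIV. L2sq (\<lambda>x. f x $ i))"
proof -
  have "L2sq f = (\<integral>\<^sup>+x. (\<Sum>i\<in>UNIV. ennreal ((norm (f x $ i))\<^sup>2)) \<partial>lborel)"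
    by (simp add: norm_vec_square sum_ennreal)
  also have "\<dots> = (\<Sum>i\<in>UNIV. L2sq (\<lambda>x. f x $ i))"
    by (rule nn_integral_sum) simp
  finally show ?thesis .
qed

lemma square_integrable_linear:
  fixes f :: "real \<Rightarrow> 'a::euclidean_space" and T :: "'a \<Rightarrow> 'b::euclidean_space"
  assumes T: "bounded_linear T" and f: "square_integrable f"
  shows "square_integrable (\<lambda>x. T (f x))"
proof -
  obtain K where "\<And>x. norm (T x) \<le> norm x * K" using bounded_linear.bounded[OF T] by blast
  then have "norm (T (f x)) \<le> K * norm (f x)" for x by (simp add: mult.commute)
  moreover have "(\<lambda>x. T (f x)) \<in> borel_measurable borel"
    using borel_measurable_continuous_onI[OF linear_continuous_on[OF T]] square_integrable_borel[OF f] by measurable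
  ultimately show ?thesis by (rule square_integrable_bound[OF f, rotated])
qed

lemma is_L2_limit_linear:
  fixes F :: "real \<Rightarrow> real \<Rightarrow> 'a::euclidean_space" and T :: "'a \<Rightarrow> 'b::euclidean_space"
  assumes T: "bounded_linear T" and F: "is_L2_limit F g" and [measurable]: "\<And>R. F R \<in> borel_measurable borel"
  shows "is_L2_limit (\<lambda>R x. T (F R x)) (\<lambda>x. T (g x))"
  unfolding is_L2_limit_def
proof
  have g: "square_integrable g" using F by (simp add: is_L2_limit_def)
  then have [measurable]: "g \<in> borel_measurable borel" by (rule square_integrable_borel)
  show "square_integrable (\<lambda>x. T (g x))" by (rule square_integrable_linear[OF T g])
  obtain K where K: "K > 0" "\<And>x. norm (T x) \<le> norm x * K" using bounded_linear.pos_bounded[OF T] by blast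
  have le: "L2sq (\<lambda>x. T (F R x) - T (g x)) \<le> ennreal (K\<^sup>2) * L2sq (\<lambda>x. F R x - g x)" for R
  proof -
    have "L2sq (\<lambda>x. T (F R x) - T (g x)) \<le> (\<integral>\<^sup>+x. ennreal (K\<^sup>2) * ennreal ((norm (F R x - g x))\<^sup>2) \<partial>lborel)"
    proof (intro nn_integral_mono)
      fix x
      have "norm (T (F R x) - T (g x)) \<le> norm (F R x - g x) * K"
        using K(2)[of "F R x - g x"] by (simp add: linear_diff[OF bounded_linear.linear[OF T]])
      then have "(norm (T (F R x) - T (g x)))\<^sup>2 \<le> (norm (F R x - g x) * K)\<^sup>2" by (intro power_mono) auto
      also have "\<dots> = K\<^sup>2 * (norm (F R x - g x))\<^sup>2" by (simp add: power_mult_distrib)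
      finally show "ennreal ((norm (T (F R x) - T (g x)))\<^sup>2) \<le> ennreal (K\<^sup>2) * ennreal ((norm (F R x - g x))\<^sup>2)"
        by (subst ennreal_mult[symmetric]) (simp_all only: zero_le_power2 ennreal_leI)
    qed
    also have "\<dots> = ennreal (K\<^sup>2) * L2sq (\<lambda>x. F R x - g x)" by (rule nn_integral_cmult) measurable
    finally show ?thesis .
  qed
  have "((\<lambda>R. ennreal (K\<^sup>2) * L2sq (\<lambda>x. F R x - g x)) \<longlongrightarrow> ennreal (K\<^sup>2) * 0) at_top"
    using F unfolding is_L2_limit_def by (intro ennreal_tendsto_cmult) auto
  then have lim0: "((\<lambda>R. ennreal (K\<^sup>2) * L2sq (\<lambda>x. F R x - g x)) \<longlongrightarrow> 0) at_top" by simp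
  show "((\<lambda>R. L2sq (\<lambda>x. T (F R x) - T (g x))) \<longlongrightarrow> 0) at_top"
    by (rule tendsto_sandwich[OF _ _ tendsto_const lim0]; intro always_eventually allI le zero_le)
qed

text \<open>As for scalars, \<open>\<sigma> = -1\<close> and \<open>\<sigma> = 1\<close> give the Fourier transform and its inverse.\<close>

definition vft :: "real \<Rightarrow> real \<Rightarrow> (real \<Rightarrow> complex ^ 'n) \<Rightarrow> real \<Rightarrow> complex ^ 'n" where
  "vft \<sigma> R f \<xi> = (1 / sqrt (2 * pi)) *\<^sub>R (LINT x:{-R..R}|lborel. cis (\<sigma> * (\<xi> * x)) *s f x)"

definition vFT :: "real \<Rightarrow> (real \<Rightarrow> complex ^ 'n) \<Rightarrow> real \<Rightarrow> complex ^ 'n" where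
  "vFT \<sigma> f = L2_limit (\<lambda>R. vft \<sigma> R f)"

lemma fourier_eq: "fourier f = vFT (-1) f" and inverse_fourier_eq: "inverse_fourier f = vFT 1 f"
  unfolding fourier_def inverse_fourier_def vFT_def vft_def cis_conv_exp by (simp_all add: mult.commute)

lemma norm_smult: "norm (c *s x) = cmod c * norm x" for x :: "complex ^ 'n"
proof -
  have "(norm (c *s x))\<^sup>2 = (cmod c * norm x)\<^sup>2"
    by (simp add: norm_vec_square norm_mult power_mult_distrib sum_distrib_left)
  then show ?thesis by (simp add: power2_eq_iff_nonneg)
qed

lemma measurable_vec:
  fixes f :: "'a \<Rightarrow> 'b::euclidean_space ^ 'n"
  assumes "\<And>i. (\<lambda>x. f x $ i) \<in> borel_measurable M"
  shows "f \<in> borel_measurable M"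
proof (subst borel_measurable_euclidean_space, intro ballI)
  fix b :: "'b ^ 'n" assume "b \<in> Basis"
  then obtain i u where b: "b = axis i u" by (auto simp: Basis_vec_def)
  have "(\<lambda>x. f x $ i \<bullet> u) \<in> borel_measurable M" using assms[of i] by measurable
  then show "(\<lambda>x. f x \<bullet> b) \<in> borel_measurable M" by (simp add: b inner_axis)
qed

lemma integrable_vft:
  fixes f :: "real \<Rightarrow> complex ^ 'n"
  assumes f: "square_integrable f"
  shows "integrable lborel (\<lambda>x. indicator {-R..R} x *\<^sub>R (cis (a * x) *s f x))"
proof (rule Bochner_Integration.integrable_bound)
  show "integrable lborel (\<lambda>x. indicator {-R..R} x *\<^sub>R f x)"
    using square_integrable_imp_locally_integrable[OF f] compact_Icc[of "-R" R]
    unfolding locally_integrable_def set_integrable_def by blast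
  have [measurable]: "f \<in> borel_measurable borel" using f by (rule square_integrable_borel)
  show "(\<lambda>x. indicator {-R..R} x *\<^sub>R (cis (a * x) *s f x)) \<in> borel_measurable lborel"
    by (rule measurable_vec) (simp add: vector_scaleR_component)
qed (simp add: norm_smult)

lemma vft_nth:
  fixes f :: "real \<Rightarrow> complex ^ 'n"
  assumes "square_integrable f"
  shows "vft \<sigma> R f \<xi> $ i = ft \<sigma> (trunc R (\<lambda>x. f x $ i)) \<xi>"
proof -
  have "(\<integral>x. (indicator {-R..R} x *\<^sub>R (cis (\<sigma> * \<xi> * x) *s f x)) $ i \<partial>lborel) = (\<integral>x. indicator {-R..R} x *\<^sub>R (cis (\<sigma> * \<xi> * x) *s f x) \<partial>lborel) $ i"
    by (rule integral_bounded_linear[OF bounded_linear_vec_nth integrable_vft[OF assms]])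
  moreover have "(indicator {-R..R} x *\<^sub>R (cis (\<sigma> * \<xi> * x) *s f x)) $ i = cis (\<sigma> * (\<xi> * x)) * trunc R (\<lambda>x. f x $ i) x" for x
    by (simp add: trunc_def mult.assoc)
  ultimately show ?thesis unfolding vft_def ft_def set_lebesgue_integral_def by (simp add: mult.assoc)
qed

lemma square_integrable_nth: "square_integrable f \<Longrightarrow> square_integrable (\<lambda>x. f x $ i)" for f :: "real \<Rightarrow> complex ^ 'n"
  by (rule square_integrable_linear[OF bounded_linear_vec_nth])

lemma square_integrable_vecI:
  fixes f :: "real \<Rightarrow> complex ^ 'n"
  assumes "\<And>i. square_integrable (\<lambda>x. f x $ i)"
  shows "square_integrable f"
proof -
  have [measurable]: "f \<in> borel_measurable borel" using assms by (intro measurable_vec square_integrable_borel)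
  show ?thesis using assms unfolding square_integrable_iff_L2sq by (simp add: L2sq_vec)
qed

lemma measurable_vft:
  fixes f :: "real \<Rightarrow> complex ^ 'n"
  assumes "square_integrable f" shows "vft \<sigma> R f \<in> borel_measurable borel"
  by (rule measurable_vec, subst vft_nth[OF assms]) (intro measurable_ft measurable_trunc square_integrable_borel square_integrable_nth assms)

text \<open>The limits of the components assemble to a limit of the vectors, and limits are unique almost everywhere.\<close>

lemma vFT_is_L2_limit:
  fixes f :: "real \<Rightarrow> complex ^ 'n"
  assumes f: "square_integrable f" and \<sigma>: "\<bar>\<sigma>\<bar> = 1"
  shows "is_L2_limit (\<lambda>R. vft \<sigma> R f) (vFT \<sigma> f)"
    and "AE \<xi> in lborel. vFT \<sigma> f \<xi> = (\<chi> i. FT \<sigma> (\<lambda>x. f x $ i) \<xi>)"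
proof -
  let ?g = "\<lambda>\<xi>. \<chi> i. FT \<sigma> (\<lambda>x. f x $ i) \<xi>"
  have lim: "is_L2_limit (\<lambda>R. ft \<sigma> (trunc R (\<lambda>x. f x $ i))) (FT \<sigma> (\<lambda>x. f x $ i))" for i
    by (rule FT_is_L2_limit[OF square_integrable_nth[OF f] \<sigma>])
  have g: "square_integrable ?g"
    by (rule square_integrable_vecI) (simp add: square_integrable_FT square_integrable_nth f \<sigma>)
  then have [measurable]: "?g \<in> borel_measurable borel" by (rule square_integrable_borel)
  note [measurable] = measurable_vft[OF f]
  have "is_L2_limit (\<lambda>R. vft \<sigma> R f) ?g"
    unfolding is_L2_limit_def
  proof
    have "L2sq (\<lambda>x. vft \<sigma> R f x - ?g x) = (\<Sum>i\<in>UNIV. L2sq (\<lambda>x. ft \<sigma> (trunc R (\<lambda>x. f x $ i)) x - FT \<sigma> (\<lambda>x. f x $ i) x))" for R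
      by (subst L2sq_vec) (simp_all add: vft_nth[OF f])
    moreover have "((\<lambda>R. \<Sum>i\<in>UNIV. L2sq (\<lambda>x. ft \<sigma> (trunc R (\<lambda>x. f x $ i)) x - FT \<sigma> (\<lambda>x. f x $ i) x)) \<longlongrightarrow> (\<Sum>i\<in>(UNIV::'n set). 0)) at_top"
      using lim unfolding is_L2_limit_def by (intro tendsto_sum) auto
    ultimately show "((\<lambda>R. L2sq (\<lambda>x. vft \<sigma> R f x - ?g x)) \<longlongrightarrow> 0) at_top" by simp
  qed (rule g)
  moreover from this show "is_L2_limit (\<lambda>R. vft \<sigma> R f) (vFT \<sigma> f)"
    unfolding vFT_def L2_limit_def by (rule someI[where P="is_L2_limit (\<lambda>R. vft \<sigma> R f)"])
  ultimately show "AE \<xi> in lborel. vFT \<sigma> f \<xi> = ?g \<xi>"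
    by (intro is_L2_limit_unique) measurable
qed

lemma square_integrable_vFT: "square_integrable f \<Longrightarrow> \<bar>\<sigma>\<bar> = 1 \<Longrightarrow> square_integrable (vFT \<sigma> f)" for f :: "real \<Rightarrow> complex ^ 'n"
  using vFT_is_L2_limit(1) by (auto simp: is_L2_limit_def)

lemma vFT_matrix:
  fixes f :: "real \<Rightarrow> complex ^ 'n" and M :: "complex ^ 'n ^ 'n"
  assumes f: "square_integrable f" and \<sigma>: "\<bar>\<sigma>\<bar> = 1"
  shows "AE \<xi> in lborel. vFT \<sigma> (\<lambda>x. M *v f x) \<xi> = M *v vFT \<sigma> f \<xi>"
proof -
  have Mf: "square_integrable (\<lambda>x. M *v f x)"
    by (rule square_integrable_linear[OF matrix_vector_mul_bounded_linear f])
  note [measurable] = measurable_vft[OF f] measurable_vft[OF Mf]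
  have "vft \<sigma> R (\<lambda>x. M *v f x) = (\<lambda>\<xi>. M *v vft \<sigma> R f \<xi>)" for R
  proof
    fix \<xi>
    have "(\<integral>x. M *v (indicator {-R..R} x *\<^sub>R (cis (\<sigma> * \<xi> * x) *s f x)) \<partial>lborel) = M *v (\<integral>x. indicator {-R..R} x *\<^sub>R (cis (\<sigma> * \<xi> * x) *s f x) \<partial>lborel)"
      by (rule integral_bounded_linear[OF matrix_vector_mul_bounded_linear integrable_vft[OF f]])
    moreover have sc: "M *v (c *\<^sub>R x) = c *\<^sub>R (M *v x)" for c x
      by (rule linear_scale[OF bounded_linear.linear[OF matrix_vector_mul_bounded_linear]])
    moreover have "M *v (c *s x) = c *s (M *v x)" for c x by (rule vector_scalar_commute)
    ultimately show "vft \<sigma> R (\<lambda>x. M *v f x) \<xi> = M *v vft \<sigma> R f \<xi>"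
      unfolding vft_def set_lebesgue_integral_def by (simp only: mult.assoc)
  qed
  then have "is_L2_limit (\<lambda>R. vft \<sigma> R (\<lambda>x. M *v f x)) (\<lambda>\<xi>. M *v vFT \<sigma> f \<xi>)"
    using is_L2_limit_linear[OF matrix_vector_mul_bounded_linear vFT_is_L2_limit(1)[OF f \<sigma>], of M] by simp
  then show ?thesis
    by (intro is_L2_limit_unique[OF vFT_is_L2_limit(1)[OF Mf \<sigma>]]) measurable
qed

lemma vFT_zero:
  fixes f :: "real \<Rightarrow> complex ^ 'n"
  assumes f: "square_integrable f" and \<sigma>: "\<bar>\<sigma>\<bar> = 1" and z: "AE x in lborel. f x = 0"
  shows "AE \<xi> in lborel. vFT \<sigma> f \<xi> = 0"
proof -
  have "vft \<sigma> R f \<xi> = 0" for R \<xi>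
  proof -
    have "AE x in lborel. indicator {-R..R} x *\<^sub>R (cis (\<sigma> * (\<xi> * x)) *s f x) = 0"
      using z by eventually_elim (simp add: vec_eq_iff)
    then have "(\<integral>x. indicator {-R..R} x *\<^sub>R (cis (\<sigma> * (\<xi> * x)) *s f x) \<partial>lborel) = 0" by (rule integral_eq_zero_AE)
    then show ?thesis by (simp add: vft_def set_lebesgue_integral_def)
  qed
  then have "is_L2_limit (\<lambda>R. vft \<sigma> R f) (\<lambda>_. 0)" by (simp add: is_L2_limit_def square_integrable_def)
  then show ?thesis
    by (intro is_L2_limit_unique[OF vFT_is_L2_limit(1)[OF f \<sigma>]] measurable_vft f)
qed

lemma has_weak_derivative_linear:
  fixes f g :: "real \<Rightarrow> 'a::euclidean_space" and T :: "'a \<Rightarrow> 'b::euclidean_space"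
  assumes T: "bounded_linear T" and d: "has_weak_derivative l f g"
  shows "has_weak_derivative l (\<lambda>x. T (f x)) (\<lambda>x. T (g x))"
  unfolding has_weak_derivative_def
proof (intro conjI allI impI)
  have li: "locally_integrable f" "locally_integrable g" using d by (auto simp: has_weak_derivative_def)
  show "locally_integrable (\<lambda>x. T (f x))" "locally_integrable (\<lambda>x. T (g x))"
    by (rule locally_integrable_bounded_linear[OF T li(1)], rule locally_integrable_bounded_linear[OF T li(2)])
  interpret T: bounded_linear T by fact
  fix \<phi> assume t: "test_function \<phi>"
  have "(\<integral>x. (deriv ^^ l) \<phi> x *\<^sub>R T (f x) \<partial>lborel) = T (\<integral>x. (deriv ^^ l) \<phi> x *\<^sub>R f x \<partial>lborel)"
    unfolding T.scaleR[symmetric] by (rule integral_bounded_linear[OF T test_function_integrable[OF t li(1)]])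
  also have "(\<integral>x. (deriv ^^ l) \<phi> x *\<^sub>R f x \<partial>lborel) = (-1) ^ l *\<^sub>R (\<integral>x. \<phi> x *\<^sub>R g x \<partial>lborel)"
    using d t unfolding has_weak_derivative_def by blast
  also have "T \<dots> = (-1) ^ l *\<^sub>R T (\<integral>x. \<phi> x *\<^sub>R g x \<partial>lborel)" by (rule T.scaleR)
  also have "T (\<integral>x. \<phi> x *\<^sub>R g x \<partial>lborel) = (\<integral>x. \<phi> x *\<^sub>R T (g x) \<partial>lborel)"
    unfolding T.scaleR[symmetric]
    by (rule integral_bounded_linear[OF T test_function_integrable[OF t li(2), of 0, unfolded funpow_0], symmetric])
  finally show "(\<integral>x. (deriv ^^ l) \<phi> x *\<^sub>R T (f x) \<partial>lborel) = (-1) ^ l *\<^sub>R (\<integral>x. \<phi> x *\<^sub>R T (g x) \<partial>lborel)" .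
qed

lemma has_weak_derivative_cong_AE:
  fixes f g f' g' :: "real \<Rightarrow> 'a::euclidean_space"
  assumes d: "has_weak_derivative l f g" and li: "locally_integrable f'" "locally_integrable g'"
    and ae: "AE x in lborel. f' x = f x" "AE x in lborel. g' x = g x"
  shows "has_weak_derivative l f' g'"
  unfolding has_weak_derivative_def
proof (intro conjI allI impI li)
  fix \<phi> assume t: "test_function \<phi>"
  have li': "locally_integrable f" "locally_integrable g" using d by (auto simp: has_weak_derivative_def)
  note i = test_function_integrable[OF t, THEN borel_measurable_integrable]
  have "(\<integral>x. (deriv ^^ l) \<phi> x *\<^sub>R f' x \<partial>lborel) = (\<integral>x. (deriv ^^ l) \<phi> x *\<^sub>R f x \<partial>lborel)"
    by (rule integral_cong_AE[OF i[OF li(1)] i[OF li'(1)]]) (use ae(1) in eventually_elim, simp)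
  moreover have "(\<integral>x. \<phi> x *\<^sub>R g' x \<partial>lborel) = (\<integral>x. \<phi> x *\<^sub>R g x \<partial>lborel)"
    by (rule integral_cong_AE[OF i[OF li(2), of 0, unfolded funpow_0] i[OF li'(2), of 0, unfolded funpow_0]]) (use ae(2) in eventually_elim, simp)
  ultimately show "(\<integral>x. (deriv ^^ l) \<phi> x *\<^sub>R f' x \<partial>lborel) = (-1) ^ l *\<^sub>R (\<integral>x. \<phi> x *\<^sub>R g' x \<partial>lborel)"
    using d t unfolding has_weak_derivative_def by metis
qed

lemma has_weak_derivative_vecI:
  fixes f g :: "real \<Rightarrow> complex ^ 'n"
  assumes d: "\<And>i. has_weak_derivative l (\<lambda>x. f x $ i) (\<lambda>x. g x $ i)" and li: "locally_integrable f" "locally_integrable g"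
  shows "has_weak_derivative l f g"
  unfolding has_weak_derivative_def
proof (intro conjI allI impI li)
  fix \<phi> assume t: "test_function \<phi>"
  show "(\<integral>x. (deriv ^^ l) \<phi> x *\<^sub>R f x \<partial>lborel) = (-1) ^ l *\<^sub>R (\<integral>x. \<phi> x *\<^sub>R g x \<partial>lborel)"
    unfolding vec_eq_iff vector_scaleR_component
  proof
    fix i
    have "(\<integral>x. (deriv ^^ l) \<phi> x *\<^sub>R f x \<partial>lborel) $ i = (\<integral>x. ((deriv ^^ l) \<phi> x *\<^sub>R f x) $ i \<partial>lborel)"
      by (rule integral_bounded_linear[OF bounded_linear_vec_nth test_function_integrable[OF t li(1)], symmetric])
    moreover have "(\<integral>x. \<phi> x *\<^sub>R g x \<partial>lborel) $ i = (\<integral>x. (\<phi> x *\<^sub>R g x) $ i \<partial>lborel)"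
      by (rule integral_bounded_linear[OF bounded_linear_vec_nth test_function_integrable[OF t li(2), of 0, unfolded funpow_0], symmetric])
    ultimately show "(\<integral>x. (deriv ^^ l) \<phi> x *\<^sub>R f x \<partial>lborel) $ i = (-1) ^ l *\<^sub>R ((\<integral>x. \<phi> x *\<^sub>R g x \<partial>lborel) $ i)"
    proof -
      assume 1: "(\<integral>x. (deriv ^^ l) \<phi> x *\<^sub>R f x \<partial>lborel) $ i = (\<integral>x. ((deriv ^^ l) \<phi> x *\<^sub>R f x) $ i \<partial>lborel)"
        and 2: "(\<integral>x. \<phi> x *\<^sub>R g x \<partial>lborel) $ i = (\<integral>x. (\<phi> x *\<^sub>R g x) $ i \<partial>lborel)"
      show ?thesis unfolding 1 2 vector_scaleR_component using d[of i] t unfolding has_weak_derivative_def by blast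
    qed
  qed
qed

lemma L2_norm_vFT:
  fixes f :: "real \<Rightarrow> complex ^ 'n"
  assumes f: "square_integrable f" and \<sigma>: "\<bar>\<sigma>\<bar> = 1"
  shows "L2_norm (vFT \<sigma> f) = L2_norm f"
proof -
  note F = square_integrable_vFT[OF f \<sigma>]
  have ae: "AE \<xi> in lborel. \<forall>i. vFT \<sigma> f \<xi> $ i = FT \<sigma> (\<lambda>x. f x $ i) \<xi>"
    using vFT_is_L2_limit(2)[OF f \<sigma>] by eventually_elim simp
  have "L2sq (vFT \<sigma> f) = (\<Sum>i\<in>UNIV. L2sq (\<lambda>\<xi>. vFT \<sigma> f \<xi> $ i))" by (intro L2sq_vec square_integrable_borel F)
  also have "\<dots> = (\<Sum>i\<in>UNIV. L2sq (FT \<sigma> (\<lambda>x. f x $ i)))"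
    by (intro sum.cong refl nn_integral_cong_AE) (use ae in eventually_elim, simp)
  also have "\<dots> = (\<Sum>i\<in>UNIV. L2sq (\<lambda>x. f x $ i))"
  proof (intro sum.cong refl)
    fix i
    note s = square_integrable_nth[OF f, of i]
    show "L2sq (FT \<sigma> (\<lambda>x. f x $ i)) = L2sq (\<lambda>x. f x $ i)"
      unfolding L2sq_eq[OF s] L2sq_eq[OF square_integrable_FT[OF s \<sigma>]] L2_norm_def using FT_isometry[OF s \<sigma>] by simp
  qed
  also have "\<dots> = L2sq f" by (intro L2sq_vec[symmetric] square_integrable_borel f)
  finally have "ennreal ((L2_norm (vFT \<sigma> f))\<^sup>2) = ennreal ((L2_norm f)\<^sup>2)" by (simp only: L2sq_eq F f)
  moreover have "0 \<le> L2_norm f" "0 \<le> L2_norm (vFT \<sigma> f)" by (simp_all add: L2_norm_def)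
  ultimately show ?thesis by (simp add: power2_eq_iff_nonneg)
qed

lemma vFT_inversion:
  fixes f :: "real \<Rightarrow> complex ^ 'n"
  assumes f: "square_integrable f" and \<sigma>: "\<bar>\<sigma>\<bar> = 1"
  shows "AE x in lborel. vFT (-\<sigma>) (vFT \<sigma> f) x = f x"
proof -
  have \<sigma>': "\<bar>-\<sigma>\<bar> = 1" using \<sigma> by simp
  note F = square_integrable_vFT[OF f \<sigma>]
  have "AE x in lborel. FT (-\<sigma>) (\<lambda>\<xi>. vFT \<sigma> f \<xi> $ i) x = f x $ i" for i
  proof -
    note s = square_integrable_nth[OF f, of i]
    have "AE \<xi> in lborel. vFT \<sigma> f \<xi> $ i - FT \<sigma> (\<lambda>x. f x $ i) \<xi> = 0"
      using vFT_is_L2_limit(2)[OF f \<sigma>] by eventually_elim simp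
    then have ft: "ft (-\<sigma>) (trunc R (\<lambda>\<xi>. vFT \<sigma> f \<xi> $ i)) = ft (-\<sigma>) (trunc R (FT \<sigma> (\<lambda>x. f x $ i)))" for R
      unfolding ft_def fun_eq_iff using square_integrable_borel[OF square_integrable_nth[OF F, of i]] square_integrable_borel[OF square_integrable_FT[OF s \<sigma>]]
      by (intro allI arg_cong[where f="\<lambda>z. (1 / sqrt (2 * pi)) *\<^sub>R z"] integral_cong_AE) (auto simp: trunc_def elim!: eventually_mono)
    then have "FT (-\<sigma>) (\<lambda>\<xi>. vFT \<sigma> f \<xi> $ i) = FT (-\<sigma>) (FT \<sigma> (\<lambda>x. f x $ i))" unfolding FT_def[of "-\<sigma>"] by simp
    then show ?thesis using FT_inversion[OF s \<sigma>] by simp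
  qed
  then have "AE x in lborel. \<forall>i. FT (-\<sigma>) (\<lambda>\<xi>. vFT \<sigma> f \<xi> $ i) x = f x $ i" by (subst AE_all_countable) simp
  with vFT_is_L2_limit(2)[OF F \<sigma>'] show ?thesis by eventually_elim (simp add: vec_eq_iff)
qed

lemma vFT_weak_derivative:
  fixes k :: "real \<Rightarrow> complex ^ 'n"
  assumes k: "square_integrable k" and kl: "square_integrable (\<lambda>\<xi>. (\<i> * of_real \<xi>) ^ l *s k \<xi>)"
  shows "has_weak_derivative l (vFT 1 k) (vFT 1 (\<lambda>\<xi>. (\<i> * of_real \<xi>) ^ l *s k \<xi>))"
proof -
  let ?g = "\<lambda>x. \<chi> i. FT 1 (\<lambda>\<xi>. k \<xi> $ i) x" and ?gl = "\<lambda>x. \<chi> i. FT 1 (\<lambda>\<xi>. (\<i> * of_real (1 * \<xi>)) ^ l * k \<xi> $ i) x"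
  have s: "square_integrable (\<lambda>\<xi>. k \<xi> $ i)" "square_integrable (\<lambda>\<xi>. (\<i> * of_real (1 * \<xi>)) ^ l * k \<xi> $ i)" for i
    using square_integrable_nth[OF k, of i] square_integrable_nth[OF kl, of i] by simp_all
  have "has_weak_derivative l ?g ?gl"
  proof (rule has_weak_derivative_vecI)
    show "has_weak_derivative l (\<lambda>x. ?g x $ i) (\<lambda>x. ?gl x $ i)" for i
      using FT_weak_derivative[OF s] by simp
    show "locally_integrable ?g" "locally_integrable ?gl"
      by (rule square_integrable_imp_locally_integrable, rule square_integrable_vecI, simp add: square_integrable_FT s[simplified])+
  qed
  then show ?thesis
  proof (rule has_weak_derivative_cong_AE)
    show "locally_integrable (vFT 1 k)" "locally_integrable (vFT 1 (\<lambda>\<xi>. (\<i> * of_real \<xi>) ^ l *s k \<xi>))"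
      by (intro square_integrable_imp_locally_integrable square_integrable_vFT k kl; simp)+
    show "AE x in lborel. vFT 1 k x = ?g x" "AE x in lborel. vFT 1 (\<lambda>\<xi>. (\<i> * of_real \<xi>) ^ l *s k \<xi>) x = ?gl x"
      using vFT_is_L2_limit(2)[OF k, of 1] vFT_is_L2_limit(2)[OF kl, of 1] by simp_all
  qed
qed

lemma L2_norm_cong_AE:
  assumes "AE x in lborel. norm (f x) = norm (g x)" "square_integrable f" "square_integrable g"
  shows "L2_norm f = L2_norm g"
  unfolding L2_norm_def using assms
  by (intro arg_cong[where f=sqrt] integral_cong_AE) (auto simp: square_integrable_def elim!: eventually_mono)

lemma weak_derivative_of_vFT:
  fixes k :: "real \<Rightarrow> complex ^ 'n"
  assumes k: "square_integrable k" and kl: "square_integrable (\<lambda>\<xi>. (\<i> * of_real \<xi>) ^ l *s k \<xi>)"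
  defines "Z \<equiv> vFT 1 k"
  shows "has_weak_derivative l Z (weak_derivative l Z)" "square_integrable (weak_derivative l Z)"
    "L2_norm (weak_derivative l Z) = L2_norm (\<lambda>\<xi>. (\<i> * of_real \<xi>) ^ l *s k \<xi>)"
proof -
  note d = vFT_weak_derivative[OF k kl, folded Z_def]
  show w: "has_weak_derivative l Z (weak_derivative l Z)"
    unfolding weak_derivative_def by (rule someI[of "has_weak_derivative l Z", OF d])
  have ae: "AE x in lborel. weak_derivative l Z x = vFT 1 (\<lambda>\<xi>. (\<i> * of_real \<xi>) ^ l *s k \<xi>) x"
    by (rule has_weak_derivative_unique[OF w d])
  have s: "square_integrable (vFT 1 (\<lambda>\<xi>. (\<i> * of_real \<xi>) ^ l *s k \<xi>))" by (rule square_integrable_vFT[OF kl]) simp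
  have m: "weak_derivative l Z \<in> borel_measurable borel" using w by (simp add: has_weak_derivative_def locally_integrable_def)
  have "L2sq (weak_derivative l Z) = L2sq (vFT 1 (\<lambda>\<xi>. (\<i> * of_real \<xi>) ^ l *s k \<xi>))"
    by (intro nn_integral_cong_AE) (use ae in eventually_elim, simp)
  then show s': "square_integrable (weak_derivative l Z)" using s m by (simp add: square_integrable_iff_L2sq)
  have "L2_norm (weak_derivative l Z) = L2_norm (vFT 1 (\<lambda>\<xi>. (\<i> * of_real \<xi>) ^ l *s k \<xi>))"
    by (rule L2_norm_cong_AE[OF _ s' s]) (use ae in eventually_elim, simp)
  then show "L2_norm (weak_derivative l Z) = L2_norm (\<lambda>\<xi>. (\<i> * of_real \<xi>) ^ l *s k \<xi>)"
    using L2_norm_vFT[OF kl, of 1] by simp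
qed

lemma bounded_linear_complex_vec: "bounded_linear (complex_vec :: real ^ 'n \<Rightarrow> complex ^ 'n)"
  unfolding linear_conv_bounded_linear[symmetric] by (rule linearI) (simp_all add: complex_vec_def vec_eq_iff complex_eq_iff)

lemma norm_complex_vec: "norm (complex_vec v) = norm v"
  by (simp add: norm_vec_def complex_vec_def L2_set_def)

definition Re_vec :: "complex ^ 'n \<Rightarrow> real ^ 'n" where "Re_vec v = (\<chi> i. Re (v $ i))"

lemma bounded_linear_Re_vec: "bounded_linear (Re_vec :: complex ^ 'n \<Rightarrow> real ^ 'n)"
  unfolding linear_conv_bounded_linear[symmetric] by (rule linearI) (simp_all add: Re_vec_def vec_eq_iff)

lemma Re_vec_complex_vec: "Re_vec (complex_vec v) = v"
  by (simp add: Re_vec_def complex_vec_def vec_eq_iff)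

text \<open>Inversion exhibits \<open>h\<close> as an inverse transform, which provides a weak derivative with complex values. Its real part is a weak derivative of the real function \<open>h\<close>, and it agrees with the complex one by uniqueness.\<close>

lemma L2_norm_weak_derivative:
  fixes h :: "real \<Rightarrow> real ^ 'n"
  defines "hc \<equiv> \<lambda>x. complex_vec (h x)"
  assumes h: "square_integrable hc" and hl: "square_integrable (\<lambda>\<xi>. (\<i> * of_real \<xi>) ^ l *s vFT (-1) hc \<xi>)"
  shows "L2_norm (weak_derivative l h) = L2_norm (\<lambda>\<xi>. (\<i> * of_real \<xi>) ^ l *s vFT (-1) hc \<xi>)"
proof -
  let ?kl = "\<lambda>\<xi>. (\<i> * of_real \<xi>) ^ l *s vFT (-1) hc \<xi>"
  have k: "square_integrable (vFT (-1) hc)" by (rule square_integrable_vFT[OF h]) simp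
  define G where "G = vFT 1 ?kl"
  have sG: "square_integrable G" unfolding G_def by (rule square_integrable_vFT[OF hl]) simp
  have "has_weak_derivative l (vFT 1 (vFT (-1) hc)) G" unfolding G_def by (rule vFT_weak_derivative[OF k hl])
  then have dG: "has_weak_derivative l hc G"
  proof (rule has_weak_derivative_cong_AE)
    show "AE x in lborel. hc x = vFT 1 (vFT (-1) hc) x"
      using vFT_inversion[OF h, of "-1"] by (auto elim!: eventually_mono)
  qed (auto intro: square_integrable_imp_locally_integrable h sG)
  have "has_weak_derivative l (\<lambda>x. Re_vec (hc x)) (\<lambda>x. Re_vec (G x))"
    by (rule has_weak_derivative_linear[OF bounded_linear_Re_vec dG])
  then have dh: "has_weak_derivative l h (\<lambda>x. Re_vec (G x))" by (simp add: hc_def Re_vec_complex_vec)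
  then have w: "has_weak_derivative l h (weak_derivative l h)"
    unfolding weak_derivative_def by (rule someI[where P="has_weak_derivative l h"])
  have "has_weak_derivative l hc (\<lambda>x. complex_vec (weak_derivative l h x))"
    unfolding hc_def by (rule has_weak_derivative_linear[OF bounded_linear_complex_vec w])
  then have ae: "AE x in lborel. complex_vec (weak_derivative l h x) = G x"
    using has_weak_derivative_unique dG by blast
  have "L2_norm (weak_derivative l h) = L2_norm G"
    unfolding L2_norm_def
  proof (intro arg_cong[where f=sqrt] integral_cong_AE)
    have [measurable]: "weak_derivative l h \<in> borel_measurable borel" using w by (simp add: has_weak_derivative_def locally_integrable_def)
    show "(\<lambda>x. (norm (weak_derivative l h x))\<^sup>2) \<in> borel_measurable lborel" by measurable
    show "(\<lambda>x. (norm (G x))\<^sup>2) \<in> borel_measurable lborel" using square_integrable_borel[OF sG] by measurable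
    show "AE x in lborel. (norm (weak_derivative l h x))\<^sup>2 = (norm (G x))\<^sup>2"
      using ae by eventually_elim (metis norm_complex_vec)
  qed
  also have "\<dots> = L2_norm ?kl" unfolding G_def by (rule L2_norm_vFT[OF hl]) simp
  finally show ?thesis .
qed

section \<open>The decay estimate\<close>

lemma norm_fourier_le:
  fixes f :: "real \<Rightarrow> complex ^ 'n"
  assumes f: "square_integrable f" "integrable lborel f" and \<sigma>: "\<bar>\<sigma>\<bar> = 1"
  shows "AE \<xi> in lborel. norm (vFT \<sigma> f \<xi>) \<le> real CARD('n) * L1_norm f"
proof -
  have "AE \<xi> in lborel. FT \<sigma> (\<lambda>x. f x $ i) \<xi> = ft \<sigma> (\<lambda>x. f x $ i) \<xi>" for i
    by (rule FT_eq_ft[OF integrable_bounded_linear[OF bounded_linear_vec_nth f(2)] square_integrable_nth[OF f(1)] \<sigma>])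
  then have "AE \<xi> in lborel. \<forall>i. FT \<sigma> (\<lambda>x. f x $ i) \<xi> = ft \<sigma> (\<lambda>x. f x $ i) \<xi>" by (subst AE_all_countable) simp
  with vFT_is_L2_limit(2)[OF f(1) \<sigma>] show ?thesis
  proof eventually_elim
    case (elim \<xi>)
    have "norm (vFT \<sigma> f \<xi>) \<le> (\<Sum>i\<in>UNIV. norm (vFT \<sigma> f \<xi> $ i))" unfolding norm_vec_def by (rule L2_set_le_sum) simp
    also have "\<dots> \<le> (\<Sum>i\<in>(UNIV::'n set). L1_norm f)"
    proof (intro sum_mono)
      fix i
      have 1: "1 / sqrt (2 * pi) \<le> 1" using pi_gt3 by (simp add: real_le_rsqrt)
      have "norm (vFT \<sigma> f \<xi> $ i) = norm (ft \<sigma> (\<lambda>x. f x $ i) \<xi>)" using elim by simp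
      also have "\<dots> \<le> (1 / sqrt (2 * pi)) * (\<integral>x. norm (f x $ i) \<partial>lborel)" by (rule norm_ft_le)
      also have "\<dots> \<le> 1 * (\<integral>x. norm (f x $ i) \<partial>lborel)" by (intro mult_right_mono 1) simp
      also have "\<dots> \<le> L1_norm f"
        unfolding L1_norm_def mult_1 using f(2) integrable_bounded_linear[OF bounded_linear_vec_nth f(2)]
        by (intro integral_mono integrable_norm Finite_Cartesian_Product.norm_nth_le) auto
      finally show "norm (vFT \<sigma> f \<xi> $ i) \<le> L1_norm f" .
    qed
    finally show ?case by simp
  qed
qed

lemma norm_monomial_smult: "(norm ((\<i> * of_real \<xi>) ^ l *s x))\<^sup>2 = \<xi> ^ (2 * l) * (norm x)\<^sup>2" for \<xi> :: real and x :: "complex ^ 'n"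
proof -
  have "(\<bar>\<xi>\<bar> ^ l)\<^sup>2 = (\<bar>\<xi>\<bar>\<^sup>2) ^ l" unfolding power_mult[symmetric] by (simp only: mult.commute)
  also have "\<dots> = \<xi> ^ (2 * l)" unfolding power2_abs power_mult ..
  finally have *: "(\<bar>\<xi>\<bar> ^ l)\<^sup>2 = \<xi> ^ (2 * l)" .
  have "norm ((\<i> * of_real \<xi>) ^ l *s x) = \<bar>\<xi>\<bar> ^ l * norm x" by (simp add: norm_smult norm_mult norm_power)
  then show ?thesis by (simp only: power_mult_distrib *)
qed

text \<open>For \<open>\<bar>\<xi>\<bar> \<le> 1\<close> the time \<open>t\<close> may be replaced by \<open>1 + t\<close> at the cost of a factor \<open>e\<^sup>k\<close>; scaling \<open>\<xi>\<close> by \<open>(1 + t)\<^sup>1\<^sup>/\<^sup>2\<close> then reduces the integral to a Gaussian moment.\<close>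

lemma low_frequency_integral:
  assumes k: "k > 0"
  shows "\<exists>J\<ge>0. \<forall>t\<ge>0. integrable lborel (\<lambda>\<xi>. indicator {-1..1} \<xi> * (\<xi> ^ (2 * m) * exp (- k * \<xi>\<^sup>2 * t))) \<and>
     (\<integral>\<xi>. indicator {-1..1} \<xi> * (\<xi> ^ (2 * m) * exp (- k * \<xi>\<^sup>2 * t)) \<partial>lborel) \<le> J * (1 + t) powr (- (real m + 1 / 2))"
proof -
  let ?f = "\<lambda>y::real. y ^ (2 * m) * exp (- k * y\<^sup>2)"
  define s where "s = sqrt (1 / (2 * k))"
  have s: "s > 0" "s\<^sup>2 = 1 / (2 * k)" using k by (auto simp: s_def)
  have f: "integrable lborel ?f"
  proof -
    have "integrable lborel (\<lambda>x. sqrt (2 * pi * s\<^sup>2) * (normal_density 0 s x * (x - 0) ^ (2 * m)))"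
      using s by (intro integrable_mult_right integrable_normal_moment)
    moreover have "sqrt (2 * pi * s\<^sup>2) * (normal_density 0 s x * (x - 0) ^ (2 * m)) = ?f x" for x
    proof -
      have "sqrt (2 * pi * s\<^sup>2) \<noteq> 0" using s k by simp
      moreover have "x\<^sup>2 / (2 * s\<^sup>2) = k * x\<^sup>2" using k by (simp add: s(2))
      ultimately show ?thesis by (simp add: normal_density_def)
    qed
    ultimately show ?thesis by (simp only:)
  qed
  define J where "J = exp k * (\<integral>y. ?f y \<partial>lborel)"
  have I0: "(\<integral>y. ?f y \<partial>lborel) \<ge> 0" by (intro Bochner_Integration.integral_nonneg) (simp add: power_mult)
  have J: "J \<ge> 0" using I0 by (simp add: J_def)
  show ?thesis
  proof (rule exI[of _ J], intro conjI J allI impI)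
    fix t :: real assume t: "t \<ge> 0"
    define c where "c = sqrt (1 + t)"
    have c: "c > 0" "c\<^sup>2 = 1 + t" using t by (auto simp: c_def)
    let ?g = "\<lambda>\<xi>. indicator {-1..1} \<xi> * (\<xi> ^ (2 * m) * exp (- k * \<xi>\<^sup>2 * t))"
    let ?h = "\<lambda>\<xi>. exp k * ((1 / c) ^ (2 * m) * ?f (0 + c * \<xi>))"
    have h: "integrable lborel ?h"
      using c by (intro integrable_mult_right lborel_integrable_real_affine[OF f]) auto
    have le: "?g \<xi> \<le> ?h \<xi>" and g0: "0 \<le> ?g \<xi>" for \<xi>
    proof -
      show "0 \<le> ?g \<xi>" by (simp add: power_mult)
      have "exp k * ((1 / c) ^ (2 * m) * ?f (0 + c * \<xi>)) = \<xi> ^ (2 * m) * (exp k * exp (- k * (c\<^sup>2 * \<xi>\<^sup>2)))"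
        using c by (simp add: power_mult_distrib power_divide field_simps)
      also have "exp k * exp (- k * (c\<^sup>2 * \<xi>\<^sup>2)) = exp (k * (1 - \<xi>\<^sup>2)) * exp (- k * \<xi>\<^sup>2 * t)"
        unfolding exp_add[symmetric] c(2) by (simp add: algebra_simps)
      finally have h: "?h \<xi> = \<xi> ^ (2 * m) * (exp (k * (1 - \<xi>\<^sup>2)) * exp (- k * \<xi>\<^sup>2 * t))" .
      have p: "\<xi> ^ (2 * m) \<ge> 0" by (simp add: power_mult)
      show "?g \<xi> \<le> ?h \<xi>"
      proof (cases "\<xi> \<in> {-1..1}")
        case True
        then have "\<xi>\<^sup>2 \<le> 1" by (auto simp: abs_square_le_1 abs_le_iff)
        then have "1 \<le> exp (k * (1 - \<xi>\<^sup>2))" using k by simp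
        then have "1 * exp (- k * \<xi>\<^sup>2 * t) \<le> exp (k * (1 - \<xi>\<^sup>2)) * exp (- k * \<xi>\<^sup>2 * t)" by (intro mult_right_mono) auto
        then have "\<xi> ^ (2 * m) * (1 * exp (- k * \<xi>\<^sup>2 * t)) \<le> \<xi> ^ (2 * m) * (exp (k * (1 - \<xi>\<^sup>2)) * exp (- k * \<xi>\<^sup>2 * t))"
          using p by (rule mult_left_mono)
        then show ?thesis using True unfolding h by simp
      next
        case False
        then show ?thesis unfolding h using p by simp
      qed
    qed
    show g: "integrable lborel ?g"
    proof (rule Bochner_Integration.integrable_bound[OF h])
      show "AE x in lborel. norm (?g x) \<le> norm (?h x)"
      proof (intro always_eventually allI)
        fix x
        have "norm (?g x) = ?g x" unfolding real_norm_def by (rule abs_of_nonneg[OF g0])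
        also have "\<dots> \<le> ?h x" by (rule le)
        also have "\<dots> \<le> norm (?h x)" unfolding real_norm_def by (rule abs_ge_self)
        finally show "norm (?g x) \<le> norm (?h x)" .
      qed
    qed measurable
    have "(\<integral>\<xi>. ?g \<xi> \<partial>lborel) \<le> (\<integral>\<xi>. ?h \<xi> \<partial>lborel)" by (rule integral_mono[OF g h le])
    also have "\<dots> = exp k * ((1 / c) ^ (2 * m) * (\<integral>\<xi>. ?f (0 + c * \<xi>) \<partial>lborel))" by simp
    also have "(\<integral>\<xi>. ?f (0 + c * \<xi>) \<partial>lborel) = (1 / c) * (\<integral>y. ?f y \<partial>lborel)"
      using lborel_integral_real_affine[of c ?f 0] c by simp
    also have "exp k * ((1 / c) ^ (2 * m) * ((1 / c) * (\<integral>y. ?f y \<partial>lborel))) = J * (1 / c) ^ (2 * m + 1)"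
      by (simp add: J_def ac_simps)
    also have "(1 / c) ^ (2 * m + 1) = (1 + t) powr (- (real m + 1 / 2))"
    proof -
      have "c = (1 + t) powr (1 / 2)" using t by (simp add: c_def powr_half_sqrt)
      then have "1 / c = (1 + t) powr (- (1 / 2))" using t by (simp add: powr_minus inverse_eq_divide)
      then have "(1 / c) ^ (2 * m + 1) = (1 + t) powr (- (1 / 2) * real (2 * m + 1))"
        using t by (simp only: powr_powr[symmetric]) (subst powr_realpow, auto)
      also have "- (1 / 2) * real (2 * m + 1) = - (real m + 1 / 2)" by (simp add: field_simps)
      finally show ?thesis .
    qed
    finally show "(\<integral>\<xi>. ?g \<xi> \<partial>lborel) \<le> J * (1 + t) powr (- (real m + 1 / 2))" .
  qed
qed

context equilibrium
begin

definition "solution t h = solution_op \<Phi> t (\<lambda>x. complex_vec (matrix_inv (A0 e s W) *v h x))" for h :: "real \<Rightarrow> real ^ 4"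

lemma measurable_symbol: "(\<lambda>\<xi>. \<Phi> (\<i> * complex_of_real \<xi>) $ i $ j) \<in> borel_measurable borel"
  unfolding symbol_def complex_mat_def scale_mat_def map_matrix_def matrix_matrix_mult_def
  by (simp add: sum_4)

lemma complex_vec_mult: "complex_vec (M *v x) = complex_mat M *v complex_vec x"
  by (simp add: vec_eq_iff complex_vec_def complex_mat_nth matrix_vector_mult_def)

lemma sobolev_derivative:
  fixes f :: "real \<Rightarrow> complex ^ 'n"
  assumes "sobolev r f" "real l \<le> r"
  shows "square_integrable (\<lambda>\<xi>. (\<i> * of_real \<xi>) ^ l *s vFT (-1) f \<xi>)"
  unfolding square_integrable_def
proof
  have f: "square_integrable f" and i: "integrable lborel (\<lambda>\<xi>. (1 + \<xi>\<^sup>2) powr r * (norm (vFT (-1) f \<xi>))\<^sup>2)"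
    using assms by (auto simp: sobolev_def fourier_eq)
  have F: "square_integrable (vFT (-1) f)" by (rule square_integrable_vFT[OF f]) simp
  then have [measurable]: "vFT (-1) f \<in> borel_measurable borel" by (rule square_integrable_borel)
  show m: "(\<lambda>\<xi>. (\<i> * of_real \<xi>) ^ l *s vFT (-1) f \<xi>) \<in> borel_measurable lborel"
    by (rule measurable_vec) (simp add: vector_smult_component)
  show "integrable lborel (\<lambda>\<xi>. (norm ((\<i> * of_real \<xi>) ^ l *s vFT (-1) f \<xi>))\<^sup>2)"
  proof (rule Bochner_Integration.integrable_bound[OF i])
    show "(\<lambda>\<xi>. (norm ((\<i> * of_real \<xi>) ^ l *s vFT (-1) f \<xi>))\<^sup>2) \<in> borel_measurable lborel" using m by measurable
    show "AE \<xi> in lborel. norm ((norm ((\<i> * of_real \<xi>) ^ l *s vFT (-1) f \<xi>))\<^sup>2) \<le> norm ((1 + \<xi>\<^sup>2) powr r * (norm (vFT (-1) f \<xi>))\<^sup>2)"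
    proof (intro always_eventually allI)
      fix \<xi> :: real
      have "(\<xi>\<^sup>2) ^ l \<le> (1 + \<xi>\<^sup>2) ^ l" by (intro power_mono) auto
      also have "\<dots> = (1 + \<xi>\<^sup>2) powr real l" by (simp add: powr_realpow add_pos_nonneg)
      also have "\<dots> \<le> (1 + \<xi>\<^sup>2) powr r" using assms(2) by (intro powr_mono) auto
      finally have "(\<xi>\<^sup>2) ^ l * (norm (vFT (-1) f \<xi>))\<^sup>2 \<le> (1 + \<xi>\<^sup>2) powr r * (norm (vFT (-1) f \<xi>))\<^sup>2"
        by (rule mult_right_mono) simp
      moreover have "(norm ((\<i> * of_real \<xi>) ^ l *s vFT (-1) f \<xi>))\<^sup>2 = (\<xi>\<^sup>2) ^ l * (norm (vFT (-1) f \<xi>))\<^sup>2"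
        by (simp only: norm_monomial_smult power_mult)
      ultimately show "norm ((norm ((\<i> * of_real \<xi>) ^ l *s vFT (-1) f \<xi>))\<^sup>2) \<le> norm ((1 + \<xi>\<^sup>2) powr r * (norm (vFT (-1) f \<xi>))\<^sup>2)"
        by simp
    qed
  qed
qed

text \<open>The constraint on \<open>h\<close> is the vanishing of a constant matrix times \<open>h\<close>, and the transform commutes with constant matrices.\<close>

lemma fourier_complement:
  fixes h :: "real \<Rightarrow> real ^ 4"
  assumes f: "square_integrable (\<lambda>x. complex_vec (h x))"
    and orth: "AE x in lborel. h x \<in> orthogonal_comp (null_space (Lmat e s \<sigma>a W))"
  shows "AE \<xi> in lborel. vFT (-1) (\<lambda>x. complex_vec (h x)) \<xi> $ 1 = 0 \<and> vFT (-1) (\<lambda>x. complex_vec (h x)) \<xi> $ 2 = 0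
    \<and> vFT (-1) (\<lambda>x. complex_vec (h x)) \<xi> $ 4 = - vFT (-1) (\<lambda>x. complex_vec (h x)) \<xi> $ 3"
proof -
  define M :: "complex ^ 4 ^ 4" where "M = vector [vector [1, 0, 0, 0], vector [0, 1, 0, 0], vector [0, 0, 1, 1], 0]"
  have M: "M *v x = vector [x $ 1, x $ 2, x $ 3 + x $ 4, 0]" for x
    by (rule vec4_eqI) (simp_all add: M_def matrix_vector_mult_def sum_4)
  let ?f = "\<lambda>x. complex_vec (h x)"
  have "AE x in lborel. M *v ?f x = 0"
    using orth by eventually_elim (rule vec4_eqI; simp add: M complex_vec_def null_space_complement)
  then have "AE \<xi> in lborel. vFT (-1) (\<lambda>x. M *v ?f x) \<xi> = 0"
    by (intro vFT_zero square_integrable_linear[OF matrix_vector_mul_bounded_linear f]) auto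
  moreover have "AE \<xi> in lborel. vFT (-1) (\<lambda>x. M *v ?f x) \<xi> = M *v vFT (-1) ?f \<xi>"
    by (rule vFT_matrix[OF f]) simp
  ultimately show ?thesis
  proof eventually_elim
    case (elim \<xi>)
    then have z: "vector [vFT (-1) ?f \<xi> $ 1, vFT (-1) ?f \<xi> $ 2, vFT (-1) ?f \<xi> $ 3 + vFT (-1) ?f \<xi> $ 4, 0] = (0 :: complex ^ 4)" by (simp add: M)
    show ?case
      using arg_cong[where f="\<lambda>x. x $ 1", OF z] arg_cong[where f="\<lambda>x. x $ 2", OF z] arg_cong[where f="\<lambda>x. x $ 3", OF z]
      by (simp add: eq_neg_iff_add_eq_0 add.commute)
  qed
qed

text \<open>The frequency bound is multiplied by \<open>\<xi>\<^sup>2\<^sup>\<ell>\<close> and integrated. In the exponentially decaying part \<open>\<xi>\<^sup>\<ell>\<close> times the transform of \<open>h\<close> has the norm of the derivative of \<open>h\<close>; in the low-frequency part the transform of \<open>h\<close> is bounded by the \<open>L\<^sup>1\<close> norm.\<close>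

lemma decay_estimate:
  assumes r: "r \<ge> 0"
  shows "\<exists>C>0. \<exists>c1>0. \<forall>h :: real \<Rightarrow> real^4.
    sobolev r (\<lambda>x. complex_vec (h x)) \<longrightarrow> integrable lborel h \<longrightarrow>
    (AE x in lborel. h x \<in> orthogonal_comp (null_space (Lmat e s \<sigma>a W))) \<longrightarrow>
    (\<forall>(l::nat) (t::real). real l \<le> r \<longrightarrow> t \<ge> 0 \<longrightarrow>
        has_weak_derivative l (solution t h) (weak_derivative l (solution t h)) \<and>
        square_integrable (weak_derivative l (solution t h)) \<and>
        L2_norm (weak_derivative l (solution t h))
          \<le> C * exp (- c1 * t) * L2_norm (weak_derivative l h)
            + C * (1 + t) powr (- (real l / 2 + 3 / 4)) * L1_norm h)"
proof -
  obtain D k where D: "D > 0" and k: "k > 0" and freq: "\<forall>\<xi> t w. t \<ge> 0 \<longrightarrow> w $ 1 = 0 \<longrightarrow> w $ 2 = 0 \<longrightarrow> w $ 4 = - w $ 3 \<longrightarrow>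
     (norm (mat_exp (scale_mat (of_real t) (\<Phi> (\<i> * of_real \<xi>))) *v (complex_mat H *v w)))\<^sup>2
       \<le> D * (norm w)\<^sup>2 * (exp (- k * t) + (if \<bar>\<xi>\<bar> \<le> 1 then \<xi>\<^sup>2 * exp (- k * \<xi>\<^sup>2 * t) else 0))"
    using frequency_bound by (elim exE conjE) (rule that; assumption)
  have "\<forall>m. \<exists>J\<ge>0. \<forall>t\<ge>0. integrable lborel (\<lambda>\<xi>. indicator {-1..1} \<xi> * (\<xi> ^ (2 * m) * exp (- k * \<xi>\<^sup>2 * t))) \<and>
     (\<integral>\<xi>. indicator {-1..1} \<xi> * (\<xi> ^ (2 * m) * exp (- k * \<xi>\<^sup>2 * t)) \<partial>lborel) \<le> J * (1 + t) powr (- (real m + 1 / 2))"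
    using low_frequency_integral[OF k] by blast
  from choice[OF this] obtain J where J_all: "\<forall>m. 0 \<le> J m \<and> (\<forall>t\<ge>0. integrable lborel (\<lambda>\<xi>. indicator {-1..1} \<xi> * (\<xi> ^ (2 * m) * exp (- k * \<xi>\<^sup>2 * t))) \<and>
     (\<integral>\<xi>. indicator {-1..1} \<xi> * (\<xi> ^ (2 * m) * exp (- k * \<xi>\<^sup>2 * t)) \<partial>lborel) \<le> J m * (1 + t) powr (- (real m + 1 / 2)))" ..
  have J: "J m \<ge> 0" for m using J_all by blast
  note JI = J_all[rule_format, THEN conjunct2, rule_format, THEN conjunct1]
    and JB = J_all[rule_format, THEN conjunct2, rule_format, THEN conjunct2]
  (* Only finitely many orders l occur, so one constant serves them all. *)
  define C where "C = 1 + sqrt D + (\<Sum>l\<le>nat \<lfloor>r\<rfloor>. 4 * sqrt (D * J (Suc l)))"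
  have "(\<Sum>l\<le>nat \<lfloor>r\<rfloor>. 4 * sqrt (D * J (Suc l))) \<ge> 0" using D J by (intro sum_nonneg) simp
  moreover have sqrtD: "sqrt D > 0" using D by simp
  ultimately have CD: "sqrt D \<le> C" "C > 0" unfolding C_def by linarith+
  have CJ: "4 * sqrt (D * J (Suc l)) \<le> C" if "real l \<le> r" for l
  proof -
    have "l \<le> nat \<lfloor>r\<rfloor>" using that by (simp add: le_nat_floor)
    then have "4 * sqrt (D * J (Suc l)) \<le> (\<Sum>l\<le>nat \<lfloor>r\<rfloor>. 4 * sqrt (D * J (Suc l)))"
      using D J by (intro member_le_sum) auto
    then show ?thesis using sqrtD unfolding C_def by linarith
  qed
  have k2: "k / 2 > 0" using k by simp
  show ?thesis
  proof (rule exI[of _ C], intro conjI CD(2), rule exI[of _ "k / 2"], intro conjI k2, intro allI impI)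
    fix h :: "real \<Rightarrow> real ^ 4" and l :: nat and t :: real
    assume sob: "sobolev r (\<lambda>x. complex_vec (h x))" and h1: "integrable lborel h"
      and orth: "AE x in lborel. h x \<in> orthogonal_comp (null_space (Lmat e s \<sigma>a W))"
      and l: "real l \<le> r" and t: "t \<ge> 0"
    define f where "f = (\<lambda>x. complex_vec (h x))"
    have f: "square_integrable f" using sob by (simp add: sobolev_def f_def)
    have f1: "integrable lborel f" unfolding f_def by (rule integrable_bounded_linear[OF bounded_linear_complex_vec h1])
    have L1: "L1_norm f = L1_norm h" by (simp add: L1_norm_def f_def norm_complex_vec)
    have L10: "L1_norm h \<ge> 0" by (simp add: L1_norm_def)
    have m1: "\<bar>- 1\<bar> = (1::real)" by simp
    define F where "F = vFT (-1) f"
    have F: "square_integrable F" unfolding F_def by (rule square_integrable_vFT[OF f]) simp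
    have Fl: "square_integrable (\<lambda>\<xi>. (\<i> * of_real \<xi>) ^ l *s F \<xi>)"
      unfolding F_def by (rule sobolev_derivative[OF _ l]) (use sob in \<open>simp add: f_def\<close>)
    have norm_l: "(norm ((\<i> * of_real \<xi>) ^ l *s x))\<^sup>2 = \<xi> ^ (2 * l) * (norm x)\<^sup>2" for \<xi> :: real and x :: "complex ^ 4"
      by (rule norm_monomial_smult)
    have Hf: "square_integrable (\<lambda>x. complex_mat H *v f x)" by (rule square_integrable_linear[OF matrix_vector_mul_bounded_linear f])
    define E where "E \<xi> = mat_exp (scale_mat (of_real t) (\<Phi> (\<i> * of_real \<xi>)))" for \<xi>
    define G where "G = vFT (-1) (\<lambda>x. complex_mat H *v f x)"
    define K where "K \<xi> = E \<xi> *v G \<xi>" for \<xi>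
    have sol: "solution t h = vFT 1 K"
      unfolding solution_def solution_op_def fourier_eq inverse_fourier_eq A0_eq matrix_inv_P K_def[abs_def] E_def G_def f_def complex_vec_mult ..
    have [measurable]: "(\<lambda>\<xi>. E \<xi> $ i $ j) \<in> borel_measurable borel" for i j
      unfolding E_def by (intro measurable_mat_exp_entry measurable_symbol)
    have [measurable]: "G \<in> borel_measurable borel"
      unfolding G_def by (intro square_integrable_borel square_integrable_vFT Hf) simp
    have mK: "K \<in> borel_measurable borel"
      by (rule measurable_vec) (simp add: K_def matrix_vector_mult_def)
    have [measurable]: "F \<in> borel_measurable borel" using F by (rule square_integrable_borel)
    define g where "g \<xi> = exp (- k * t) + (if \<bar>\<xi>\<bar> \<le> 1 then \<xi>\<^sup>2 * exp (- k * \<xi>\<^sup>2 * t) else 0)" for \<xi>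
    have Kb: "AE \<xi> in lborel. (norm (K \<xi>))\<^sup>2 \<le> D * (norm (F \<xi>))\<^sup>2 * g \<xi>"
      using vFT_matrix[OF f m1, of "complex_mat H"] fourier_complement[OF f[unfolded f_def] orth, folded f_def]
    proof eventually_elim
      case (elim \<xi>)
      have "(norm (E \<xi> *v (complex_mat H *v F \<xi>)))\<^sup>2 \<le> D * (norm (F \<xi>))\<^sup>2 * g \<xi>"
        unfolding E_def g_def by (rule freq[rule_format, OF t]) (use elim(2) in \<open>unfold F_def, blast+\<close>)
      moreover have "K \<xi> = E \<xi> *v (complex_mat H *v F \<xi>)" unfolding K_def G_def F_def elim(1) ..
      ultimately show ?case by (simp only:)
    qed
    have Fb: "AE \<xi> in lborel. norm (F \<xi>) \<le> 4 * L1_norm h"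
      using norm_fourier_le[OF f f1, of "-1"] by (simp add: F_def L1)
    define I where "I \<xi> = indicator {-1..1} \<xi> * (\<xi> ^ (2 * Suc l) * exp (- k * \<xi>\<^sup>2 * t))" for \<xi> :: real
    have II: "integrable lborel I" unfolding I_def by (rule JI[OF t])
    define R where "R \<xi> = D * exp (- k * t) * (norm ((\<i> * of_real \<xi>) ^ l *s F \<xi>))\<^sup>2 + D * (16 * (L1_norm h)\<^sup>2) * I \<xi>" for \<xi>
    have R: "integrable lborel R" unfolding R_def using II Fl by (simp add: square_integrable_def)
    have bound: "AE \<xi> in lborel. (norm ((\<i> * of_real \<xi>) ^ l *s K \<xi>))\<^sup>2 \<le> R \<xi>"
      using Kb Fb
    proof eventually_elim
      case (elim \<xi>)
      have "(norm ((\<i> * of_real \<xi>) ^ l *s K \<xi>))\<^sup>2 \<le> \<xi> ^ (2 * l) * (D * (norm (F \<xi>))\<^sup>2 * g \<xi>)"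
        unfolding norm_l by (intro mult_left_mono elim) (simp add: power_mult)
      also have "\<dots> = D * exp (- k * t) * (\<xi> ^ (2 * l) * (norm (F \<xi>))\<^sup>2) + D * (norm (F \<xi>))\<^sup>2 * I \<xi>"
        by (auto simp: g_def I_def algebra_simps power2_eq_square indicator_def abs_le_iff)
      also have "\<dots> \<le> D * exp (- k * t) * (\<xi> ^ (2 * l) * (norm (F \<xi>))\<^sup>2) + D * (16 * (L1_norm h)\<^sup>2) * I \<xi>"
      proof (intro add_left_mono mult_right_mono mult_left_mono)
        show "(norm (F \<xi>))\<^sup>2 \<le> 16 * (L1_norm h)\<^sup>2" using power_mono[OF elim(2), of 2] by (simp add: power_mult_distrib)
        show "0 \<le> I \<xi>" unfolding I_def by (simp add: power_mult del: power_Suc mult_Suc_right)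
      qed (use D in simp)
      finally show ?case by (simp add: R_def norm_l)
    qed
    have mKl: "(\<lambda>\<xi>. (\<i> * of_real \<xi>) ^ l *s K \<xi>) \<in> borel_measurable borel"
      by (rule measurable_vec) (use mK in \<open>simp add: vector_smult_component\<close>)
    have Kl: "square_integrable (\<lambda>\<xi>. (\<i> * of_real \<xi>) ^ l *s K \<xi>)"
      unfolding square_integrable_def
    proof
      show "integrable lborel (\<lambda>\<xi>. (norm ((\<i> * of_real \<xi>) ^ l *s K \<xi>))\<^sup>2)"
        by (rule Bochner_Integration.integrable_bound[OF R]) (use mKl bound in \<open>auto elim!: eventually_mono\<close>)
    qed (use mKl in simp)
    have K0: "square_integrable K"
      unfolding square_integrable_def
    proof
      have "integrable lborel (\<lambda>\<xi>. 2 * D * (norm (F \<xi>))\<^sup>2)" using F by (simp add: square_integrable_def)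
      then show "integrable lborel (\<lambda>\<xi>. (norm (K \<xi>))\<^sup>2)"
      proof (rule Bochner_Integration.integrable_bound)
        show "AE \<xi> in lborel. norm ((norm (K \<xi>))\<^sup>2) \<le> norm (2 * D * (norm (F \<xi>))\<^sup>2)"
          using Kb
        proof eventually_elim
          case (elim \<xi>)
          have "\<xi>\<^sup>2 * exp (- k * \<xi>\<^sup>2 * t) \<le> 1 * 1" if "\<bar>\<xi>\<bar> \<le> 1"
            using that k t by (intro mult_mono) (auto simp: abs_square_le_1)
          then have "(if \<bar>\<xi>\<bar> \<le> 1 then \<xi>\<^sup>2 * exp (- k * \<xi>\<^sup>2 * t) else 0) \<le> 1" by auto
          moreover have "exp (- k * t) \<le> 1" using k t by simp
          ultimately have "g \<xi> \<le> 2" unfolding g_def by linarith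
          have "(norm (K \<xi>))\<^sup>2 \<le> D * (norm (F \<xi>))\<^sup>2 * g \<xi>" by (rule elim)
          also have "\<dots> \<le> D * (norm (F \<xi>))\<^sup>2 * 2" using D by (intro mult_left_mono \<open>g \<xi> \<le> 2\<close>) simp
          also have "\<dots> = 2 * D * (norm (F \<xi>))\<^sup>2" by simp
          finally have "(norm (K \<xi>))\<^sup>2 \<le> 2 * D * (norm (F \<xi>))\<^sup>2" .
          then show ?case using D by (simp add: abs_mult)
        qed
      qed (use mK in measurable)
    qed (use mK in simp)
    note wd = weak_derivative_of_vFT[OF K0 Kl, folded sol]
    have nh: "L2_norm (weak_derivative l h) = L2_norm (\<lambda>\<xi>. (\<i> * of_real \<xi>) ^ l *s F \<xi>)"
      using L2_norm_weak_derivative[of h l] f Fl by (simp add: f_def F_def)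
    define A where "A = L2_norm (weak_derivative l h)"
    have A0: "A \<ge> 0" by (simp add: A_def L2_norm_def)
    have A2: "(\<integral>\<xi>. (norm ((\<i> * of_real \<xi>) ^ l *s F \<xi>))\<^sup>2 \<partial>lborel) = A\<^sup>2"
      unfolding A_def nh unfolding L2_norm_def by (rule real_sqrt_pow2[symmetric]) simp
    have "(\<integral>\<xi>. (norm ((\<i> * of_real \<xi>) ^ l *s K \<xi>))\<^sup>2 \<partial>lborel) \<le> (\<integral>\<xi>. R \<xi> \<partial>lborel)"
      using Kl by (intro integral_mono_AE R bound) (simp add: square_integrable_def)
    also have "\<dots> = D * exp (- k * t) * A\<^sup>2 + D * (16 * (L1_norm h)\<^sup>2) * (\<integral>\<xi>. I \<xi> \<partial>lborel)"
      unfolding R_def A2[symmetric] using II Fl by (simp add: square_integrable_def)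
    also have "\<dots> \<le> D * exp (- k * t) * A\<^sup>2 + D * (16 * (L1_norm h)\<^sup>2) * (J (Suc l) * (1 + t) powr (- (real (Suc l) + 1 / 2)))"
      unfolding I_def using D by (intro add_left_mono mult_left_mono JB[OF t]) auto
    finally have "L2_norm (weak_derivative l (solution t h)) \<le> sqrt (D * exp (- k * t) * A\<^sup>2 + D * (16 * (L1_norm h)\<^sup>2) * (J (Suc l) * (1 + t) powr (- (real (Suc l) + 1 / 2))))"
      unfolding wd(3) unfolding L2_norm_def by (rule real_sqrt_le_mono)
    also have "\<dots> \<le> sqrt (D * exp (- k * t) * A\<^sup>2) + sqrt (D * (16 * (L1_norm h)\<^sup>2) * (J (Suc l) * (1 + t) powr (- (real (Suc l) + 1 / 2))))"
      using D J by (intro sqrt_add_le_add_sqrt) auto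
    also have "sqrt (D * exp (- k * t) * A\<^sup>2) = sqrt D * exp (- (k / 2) * t) * A"
    proof -
      have "exp (- k * t) = (exp (- (k / 2) * t))\<^sup>2" by (simp add: power2_eq_square exp_add[symmetric])
      then show ?thesis using A0 by (simp add: real_sqrt_mult)
    qed
    also have "sqrt (D * (16 * (L1_norm h)\<^sup>2) * (J (Suc l) * (1 + t) powr (- (real (Suc l) + 1 / 2)))) = 4 * sqrt (D * J (Suc l)) * (1 + t) powr (- (real l / 2 + 3 / 4)) * L1_norm h"
    proof -
      have "(1 + t) powr (- (real (Suc l) + 1 / 2)) = ((1 + t) powr (- (real l / 2 + 3 / 4)))\<^sup>2"
      proof -
        have e: "- (real (Suc l) + 1 / 2) = - (real l / 2 + 3 / 4) + - (real l / 2 + 3 / 4)" by simp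
        show ?thesis unfolding e powr_add power2_eq_square ..
      qed
      moreover have "sqrt 16 = 4" by simp
      ultimately show ?thesis using L10 by (simp only: real_sqrt_mult real_sqrt_abs abs_of_nonneg powr_ge_zero) simp
    qed
    also have "sqrt D * exp (- (k / 2) * t) * A + 4 * sqrt (D * J (Suc l)) * (1 + t) powr (- (real l / 2 + 3 / 4)) * L1_norm h
      \<le> C * exp (- (k / 2) * t) * A + C * (1 + t) powr (- (real l / 2 + 3 / 4)) * L1_norm h"
      using CD CJ[OF l] A0 L10 by (intro add_mono mult_right_mono) auto
    finally have "L2_norm (weak_derivative l (solution t h)) \<le> C * exp (- (k / 2) * t) * L2_norm (weak_derivative l h) + C * (1 + t) powr (- (real l / 2 + 3 / 4)) * L1_norm h"
      by (simp add: A_def)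
    then show "has_weak_derivative l (solution t h) (weak_derivative l (solution t h)) \<and>
        square_integrable (weak_derivative l (solution t h)) \<and>
        L2_norm (weak_derivative l (solution t h))
          \<le> C * exp (- (k / 2) * t) * L2_norm (weak_derivative l h)
            + C * (1 + t) powr (- (real l / 2 + 3 / 4)) * L1_norm h"
      using wd(1,2) by simp
  qed
qed

end

theorem lemma4p5:
  fixes p e s :: "real \<times> real \<Rightarrow> real"
    and \<sigma>a \<sigma>s r :: real
    and Wbar :: "real^4"
  assumes "thermodynamic_laws p e s"
    and "\<sigma>a > 0" and "\<sigma>s > 0"
    and "Wbar \<in> W_domain e"
    and "Wbar $ 4 = temperature e Wbar ^ 4"
    and "r \<ge> 0"
  shows "\<exists>C>0. \<exists>c1>0. \<forall>h :: real \<Rightarrow> real^4.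
    sobolev r (\<lambda>x. complex_vec (h x)) \<longrightarrow>
    integrable lborel h \<longrightarrow>
    (AE x in lborel. h x \<in> orthogonal_comp (null_space (Lmat e s \<sigma>a Wbar))) \<longrightarrow>
    (\<forall>(l::nat) (t::real). real l \<le> r \<longrightarrow> t \<ge> 0 \<longrightarrow>
      (let \<Phi> = symbol (A0 e s Wbar) (A1 p e s Wbar) (Lmat e s \<sigma>a Wbar) (Bmat e s \<sigma>s Wbar);
           Z = solution_op \<Phi> t (\<lambda>x. complex_vec (matrix_inv (A0 e s Wbar) *v h x))
       in has_weak_derivative l Z (weak_derivative l Z) \<and>
          square_integrable (weak_derivative l Z) \<and>
          L2_norm (weak_derivative l Z)
            \<le> C * exp (- c1 * t) * L2_norm (weak_derivative l h)
              + C * (1 + t) powr (- (real l / 2 + 3 / 4)) * L1_norm h))"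
proof -
  interpret equilibrium p e s \<sigma>a \<sigma>s Wbar using assms by unfold_locales
  show ?thesis unfolding Let_def using decay_estimate[OF assms(6)] unfolding solution_def .
qed

end
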